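(* Let $X$ be the locally convex direct sum of a sequence $\{X_n\}_{n\in\mathbb Z_+}$ of locally convex spaces such that the topology of each $X_n$ is not weak and each $X_n$ admits an $\ell_1$-sequence with dense linear span. Then there is a hypercyclic operator on $X$.
   Context: All vector spaces are over $\mathbb K$, which is either $\mathbb R$ or $\mathbb C$; all topological spaces are Hausdorff; topological vector spaces are non-trivial ($\neq\{0\}$). $\mathbb Z_+$ is the set of non-negative integers. The (locally convex) direct sum of a family $\{X_\alpha\}$ of locally convex spaces is the algebraic direct sum $\bigoplus_\alpha X_\alpha$ endowed with the strongest locally convex topology which induces the original topology on each $X_\alpha$. The topology of a topological vector space $X$ is called weak if it is exactly the weakest topology making each $f\in Y$ continuous, for some linear space $Y$ of linear functionals on $X$ separating points of $X$. A sequence $\{x_n\}_{n\in\mathbb Z_+}$ in a locally convex space $X$ is an $\ell_1$-sequence if $x_n\to 0$ and the series $\sum_{n=0}^\infty a_nx_n$ converges in $X$ for each $a\in\ell_1$. A continuous linear operator $T$ on a topological vector space $X$ is hypercyclic if there is $x\in X$ such that $\{T^nx:n\in\mathbb Z_+\}$ is dense in $X$. *)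

theory Defs
  imports "HOL-Analysis.Analysis" "HOL-Library.Poly_Mapping"
begin

(* The scalar field is R or C. A norm that is multiplicative and extends the absolute value
   of R is the usual modulus on C, so the class fixes the topology of the field as well. *)

class real_or_complex = real_normed_field +
  assumes real_or_complex:
    "(\<forall>x. \<exists>a. x = a *\<^sub>R 1) \<or>
     (\<exists>i. i * i = - 1 \<and> (\<forall>x. \<exists>a b. x = a *\<^sub>R 1 + b *\<^sub>R i))"

instance real :: real_or_complex
proof
  have "\<forall>x::real. \<exists>a. x = a *\<^sub>R 1" by auto
  then show "(\<forall>x::real. \<exists>a. x = a *\<^sub>R 1) \<or>
     (\<exists>i::real. i * i = - 1 \<and> (\<forall>x. \<exists>a b. x = a *\<^sub>R 1 + b *\<^sub>R i))" by blast
qed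

instance complex :: real_or_complex
proof
  have "x = Re x *\<^sub>R 1 + Im x *\<^sub>R \<i>" for x :: complex
    by (simp add: complex_eq_iff)
  then have "\<forall>x::complex. \<exists>a b. x = a *\<^sub>R 1 + b *\<^sub>R \<i>" by blast
  moreover have "\<i> * \<i> = - 1" by simp
  ultimately show "(\<forall>x::complex. \<exists>a. x = a *\<^sub>R 1) \<or>
     (\<exists>i::complex. i * i = - 1 \<and> (\<forall>x. \<exists>a b. x = a *\<^sub>R 1 + b *\<^sub>R i))" by blast
qed

(* A topological vector space is given by a topology whose carrier is a linear subspace of an
   ambient vector space. This lets the members of a family of spaces be unrelated
   to each other: any family of spaces with elements in one type embeds, member by member, in
   such an ambient space, for instance in the direct sum of the family. *)

definition topological_vector_space ::
  "('k::real_or_complex \<Rightarrow> 'a::ab_group_add \<Rightarrow> 'a) \<Rightarrow> 'a topology \<Rightarrow> bool"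
where
  "topological_vector_space scl T \<longleftrightarrow>
     vector_space scl \<and>
     module.subspace scl (topspace T) \<and>
     topspace T \<noteq> {0} \<and>
     Hausdorff_space T \<and>
     continuous_map (prod_topology T T) T (\<lambda>(x, y). x + y) \<and>
     continuous_map (prod_topology euclidean T) T (\<lambda>(c, x). scl c x)"

definition convex_wrt ::
  "('k::real_or_complex \<Rightarrow> 'a::ab_group_add \<Rightarrow> 'a) \<Rightarrow> 'a set \<Rightarrow> bool"
where
  "convex_wrt scl S \<longleftrightarrow>
     (\<forall>x\<in>S. \<forall>y\<in>S. \<forall>u\<ge>0. \<forall>v\<ge>0. u + v = 1 \<longrightarrow>
        scl (of_real u) x + scl (of_real v) y \<in> S)"

definition locally_convex_space ::
  "('k::real_or_complex \<Rightarrow> 'a::ab_group_add \<Rightarrow> 'a) \<Rightarrow> 'a topology \<Rightarrow> bool"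
where
  "locally_convex_space scl T \<longleftrightarrow>
     topological_vector_space scl T \<and> neighbourhood_base_at 0 (convex_wrt scl) T"

definition linear_between ::
  "('k \<Rightarrow> 'a \<Rightarrow> 'a) \<Rightarrow> ('k \<Rightarrow> 'b \<Rightarrow> 'b) \<Rightarrow> 'a set \<Rightarrow> ('a::plus \<Rightarrow> 'b::plus) \<Rightarrow> bool"
where
  "linear_between scl1 scl2 V f \<longleftrightarrow>
     (\<forall>x\<in>V. \<forall>y\<in>V. f (x + y) = f x + f y) \<and>
     (\<forall>c. \<forall>x\<in>V. f (scl1 c x) = scl2 c (f x))"

(* A linear space of linear functionals on V. The values off V are irrelevant. *)

definition functional_space ::
  "('k::real_or_complex \<Rightarrow> 'a::ab_group_add \<Rightarrow> 'a) \<Rightarrow> 'a set \<Rightarrow> ('a \<Rightarrow> 'k) set \<Rightarrow> bool"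
where
  "functional_space scl V Y \<longleftrightarrow>
     (\<forall>f\<in>Y. linear_between scl (*) V f) \<and>
     (\<lambda>x. 0) \<in> Y \<and>
     (\<forall>f\<in>Y. \<forall>g\<in>Y. (\<lambda>x. f x + g x) \<in> Y) \<and>
     (\<forall>c. \<forall>f\<in>Y. (\<lambda>x. c * f x) \<in> Y)"

definition separates_points :: "('a \<Rightarrow> 'b) set \<Rightarrow> 'a set \<Rightarrow> bool"
where
  "separates_points Y V \<longleftrightarrow> (\<forall>x\<in>V. \<forall>y\<in>V. x \<noteq> y \<longrightarrow> (\<exists>f\<in>Y. f x \<noteq> f y))"

definition coarser :: "'a topology \<Rightarrow> 'a topology \<Rightarrow> bool"
where
  "coarser T T' \<longleftrightarrow> topspace T = topspace T' \<and> (\<forall>U. openin T U \<longrightarrow> openin T' U)"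

definition has_weak_topology ::
  "('k::real_or_complex \<Rightarrow> 'a::ab_group_add \<Rightarrow> 'a) \<Rightarrow> 'a topology \<Rightarrow> bool"
where
  "has_weak_topology scl T \<longleftrightarrow>
     (\<exists>Y. functional_space scl (topspace T) Y \<and>
          separates_points Y (topspace T) \<and>
          (\<forall>f\<in>Y. continuous_map T euclidean f) \<and>
          (\<forall>T'. topspace T' = topspace T \<and> (\<forall>f\<in>Y. continuous_map T' euclidean f) \<longrightarrow>
                coarser T T'))"

definition l1_sequence ::
  "('k::real_or_complex \<Rightarrow> 'a::ab_group_add \<Rightarrow> 'a) \<Rightarrow> 'a topology \<Rightarrow> (nat \<Rightarrow> 'a) \<Rightarrow> bool"
where
  "l1_sequence scl T x \<longleftrightarrow>
     range x \<subseteq> topspace T \<and>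
     limitin T x 0 sequentially \<and>
     (\<forall>a. summable (\<lambda>n. norm (a n)) \<longrightarrow>
          (\<exists>s. limitin T (\<lambda>N. \<Sum>n<N. scl (a n) (x n)) s sequentially))"

definition hypercyclic_operator ::
  "('k::real_or_complex \<Rightarrow> 'a::ab_group_add \<Rightarrow> 'a) \<Rightarrow> 'a topology \<Rightarrow> ('a \<Rightarrow> 'a) \<Rightarrow> bool"
where
  "hypercyclic_operator scl T S \<longleftrightarrow>
     continuous_map T T S \<and>
     linear_between scl scl (topspace T) S \<and>
     (\<exists>x\<in>topspace T. T closure_of {(S ^^ n) x |n. True} = topspace T)"

(* The algebraic direct sum consists of the finitely supported families with i-th entry in
   the i-th space, and Poly_Mapping.single i is the canonical embedding of the i-th space. *)

definition direct_sum_carrier :: "('i \<Rightarrow> 'a::ab_group_add topology) \<Rightarrow> ('i \<Rightarrow>\<^sub>0 'a) set"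
where
  "direct_sum_carrier X = {f. \<forall>i. Poly_Mapping.lookup f i \<in> topspace (X i)}"

definition direct_sum_scale ::
  "('k \<Rightarrow> 'a \<Rightarrow> 'a) \<Rightarrow> 'k \<Rightarrow> ('i \<Rightarrow>\<^sub>0 'a::ab_group_add) \<Rightarrow> ('i \<Rightarrow>\<^sub>0 'a)"
where
  "direct_sum_scale scl c = Poly_Mapping.map (scl c)"

definition direct_sum_candidate ::
  "('k::real_or_complex \<Rightarrow> 'a::ab_group_add \<Rightarrow> 'a) \<Rightarrow> ('i \<Rightarrow> 'a topology) \<Rightarrow>
   ('i \<Rightarrow>\<^sub>0 'a) topology \<Rightarrow> bool"
where
  "direct_sum_candidate scl X T \<longleftrightarrow>
     topspace T = direct_sum_carrier X \<and>
     locally_convex_space (direct_sum_scale scl) T \<and>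
     (\<forall>i. embedding_map (X i) T (Poly_Mapping.single i))"

definition locally_convex_direct_sum ::
  "('k::real_or_complex \<Rightarrow> 'a::ab_group_add \<Rightarrow> 'a) \<Rightarrow> ('i \<Rightarrow> 'a topology) \<Rightarrow>
   ('i \<Rightarrow>\<^sub>0 'a) topology \<Rightarrow> bool"
where
  "locally_convex_direct_sum scl X T \<longleftrightarrow>
     direct_sum_candidate scl X T \<and>
     (\<forall>T'. direct_sum_candidate scl X T' \<longrightarrow> coarser T' T)"

(* Well-definedness of the direct sum: the strongest topology is unique and exists. *)

lemma locally_convex_direct_sum_unique:
  assumes "locally_convex_direct_sum scl X T" "locally_convex_direct_sum scl X T'"
  shows "T = T'"
  using assms unfolding locally_convex_direct_sum_def coarser_def by (metis topology_eq)

lemma lookup_direct_sum_scale: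
  assumes "vector_space scl"
  shows "Poly_Mapping.lookup (direct_sum_scale scl c f) i = scl c (Poly_Mapping.lookup f i)"
proof -
  interpret vector_space scl by (rule assms)
  show ?thesis
    by (simp add: direct_sum_scale_def Poly_Mapping.map.rep_eq when_def)
qed

lemma vector_space_direct_sum_scale:
  assumes "vector_space scl"
  shows "vector_space (direct_sum_scale scl :: 'k::field \<Rightarrow> ('i \<Rightarrow>\<^sub>0 'a::ab_group_add) \<Rightarrow> _)"
proof -
  interpret vector_space scl by (rule assms)
  show ?thesis
    by unfold_locales
      (auto intro!: poly_mapping_eqI
        simp: lookup_direct_sum_scale[OF assms] lookup_add scale_right_distrib scale_left_distrib)
qed

lemma subspace_direct_sum_carrier:
  assumes "vector_space scl" "\<And>i. module.subspace scl (topspace (X i))"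
  shows "module.subspace (direct_sum_scale scl) (direct_sum_carrier X)"
proof -
  interpret V: vector_space scl by (rule assms)
  interpret W: vector_space "direct_sum_scale scl"
    by (rule vector_space_direct_sum_scale[OF assms(1)])
  show ?thesis
    using assms(2)
    by (auto simp: W.subspace_def V.subspace_def direct_sum_carrier_def lookup_add
        lookup_direct_sum_scale[OF assms(1)])
qed

lemma direct_sum_candidate_exists:
  fixes scl :: "'k::real_or_complex \<Rightarrow> 'a::ab_group_add \<Rightarrow> 'a"
    and X :: "'i \<Rightarrow> 'a topology"
  assumes X: "\<And>i. locally_convex_space scl (X i)"
  shows "\<exists>T. direct_sum_candidate scl X T"
proof -
  let ?C = "direct_sum_carrier X"
  define P where "P = pullback_topology ?C Poly_Mapping.lookup (product_topology X UNIV)"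
  have tvs: "\<And>i. topological_vector_space scl (X i)"
    and base: "\<And>i. neighbourhood_base_at 0 (convex_wrt scl) (X i)"
    using X by (auto simp: locally_convex_space_def)
  have vs: "vector_space scl" and sub: "\<And>i. module.subspace scl (topspace (X i))"
    and haus: "\<And>i. Hausdorff_space (X i)" and nz: "\<And>i. topspace (X i) \<noteq> {0}"
    and cadd: "\<And>i. continuous_map (prod_topology (X i) (X i)) (X i) (\<lambda>(x, y). x + y)"
    and cscale: "\<And>i. continuous_map (prod_topology euclidean (X i)) (X i) (\<lambda>(c, x). scl c x)"
    using tvs by (auto simp: topological_vector_space_def)
  interpret V: vector_space scl by (rule vs)
  interpret W: vector_space "direct_sum_scale scl :: 'k \<Rightarrow> ('i \<Rightarrow>\<^sub>0 'a) \<Rightarrow> _"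
    by (rule vector_space_direct_sum_scale[OF vs])
  note look = lookup_direct_sum_scale[OF vs]
  have zero: "0 \<in> topspace (X i)" for i using sub V.subspace_0 by blast
  have topP: "topspace P = ?C"
    by (auto simp: P_def topspace_pullback_topology direct_sum_carrier_def)
  have subC: "W.subspace ?C"
    by (rule subspace_direct_sum_carrier[OF vs sub])
  have contP: "continuous_map T P g" if "g ` topspace T \<subseteq> ?C"
    "\<And>i. continuous_map T (X i) (\<lambda>x. Poly_Mapping.lookup (g x) i)" for g and T :: "'c topology"
    unfolding P_def
    by (rule continuous_map_pullback')
      (use that in \<open>auto simp: continuous_map_componentwise_UNIV comp_def\<close>)
  have contL: "continuous_map P (X i) (\<lambda>f. Poly_Mapping.lookup f i)" for i
  proof -
    have "continuous_map P (X i) ((\<lambda>h. h i) \<circ> Poly_Mapping.lookup)"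
      unfolding P_def
      by (rule continuous_map_pullback) (simp add: continuous_map_product_projection)
    then show ?thesis by (simp add: comp_def)
  qed
  have singC: "Poly_Mapping.single i x \<in> ?C" if "x \<in> topspace (X i)" for i x
    using that zero by (auto simp: direct_sum_carrier_def lookup_single when_def)
  have "?C \<noteq> {0}"
  proof -
    fix i :: 'i
    obtain x where x: "x \<in> topspace (X i)" "x \<noteq> 0" using nz[of i] zero[of i] by blast
    have "Poly_Mapping.single i x \<noteq> 0" using x(2) by (metis lookup_single_eq lookup_zero)
    then show ?thesis using singC[OF x(1)] by blast
  qed
  moreover have "Hausdorff_space P"
    unfolding Hausdorff_space_def
  proof (intro allI impI, elim conjE)
    fix f g assume fg: "f \<in> topspace P" "g \<in> topspace P" "f \<noteq> g"
    then obtain i where i: "Poly_Mapping.lookup f i \<noteq> Poly_Mapping.lookup g i" by (metis poly_mapping_eqI)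
    have "Poly_Mapping.lookup f i \<in> topspace (X i)" "Poly_Mapping.lookup g i \<in> topspace (X i)"
      using fg by (auto simp: topP direct_sum_carrier_def)
    then obtain A B where AB: "openin (X i) A" "openin (X i) B"
      "Poly_Mapping.lookup f i \<in> A" "Poly_Mapping.lookup g i \<in> B" "disjnt A B"
      using haus[of i] i unfolding Hausdorff_space_def by metis
    let ?A = "{h \<in> topspace P. Poly_Mapping.lookup h i \<in> A}" and ?B = "{h \<in> topspace P. Poly_Mapping.lookup h i \<in> B}"
    have "openin P ?A" "openin P ?B"
      using AB openin_continuous_map_preimage[OF contL] by blast+
    moreover have "disjnt ?A ?B" using AB(5) by (auto simp: disjnt_def)
    ultimately show "\<exists>U Va. openin P U \<and> openin P Va \<and> f \<in> U \<and> g \<in> Va \<and> disjnt U Va"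
      using fg AB by blast
  qed
  moreover have "continuous_map (prod_topology P P) P (\<lambda>(x, y). x + y)"
  proof (rule contP)
    show "(\<lambda>(x, y). x + y) ` topspace (prod_topology P P) \<subseteq> ?C"
      using subC by (auto simp: topP W.subspace_add)
    fix i
    have "continuous_map (prod_topology P P) (X i)
       ((\<lambda>(x, y). x + y) \<circ> (\<lambda>z. (Poly_Mapping.lookup (fst z) i, Poly_Mapping.lookup (snd z) i)))"
      by (intro continuous_map_compose[OF _ cadd] continuous_map_pairedI
          continuous_map_compose[OF continuous_map_fst contL, unfolded comp_def]
          continuous_map_compose[OF continuous_map_snd contL, unfolded comp_def])
    then show "continuous_map (prod_topology P P) (X i) (\<lambda>x. Poly_Mapping.lookup (case x of (x, y) \<Rightarrow> x + y) i)"
      by (simp add: comp_def case_prod_unfold lookup_add)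
  qed
  moreover have "continuous_map (prod_topology euclidean P) P (\<lambda>(c, x). direct_sum_scale scl c x)"
  proof (rule contP)
    show "(\<lambda>(c, x). direct_sum_scale scl c x) ` topspace (prod_topology euclidean P) \<subseteq> ?C"
      using subC by (auto simp: topP W.subspace_scale)
    fix i
    have "continuous_map (prod_topology euclidean P) (X i)
       ((\<lambda>(c, x). scl c x) \<circ> (\<lambda>z. (fst z, Poly_Mapping.lookup (snd z) i)))"
      by (intro continuous_map_compose[OF _ cscale] continuous_map_pairedI continuous_map_fst
          continuous_map_compose[OF continuous_map_snd contL, unfolded comp_def])
    then show "continuous_map (prod_topology euclidean P) (X i)
        (\<lambda>x. Poly_Mapping.lookup (case x of (c, x) \<Rightarrow> direct_sum_scale scl c x) i)"
      by (simp add: comp_def case_prod_unfold look)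
  qed
  moreover have "neighbourhood_base_at 0 (convex_wrt (direct_sum_scale scl)) P"
    unfolding neighbourhood_base_at_def
  proof (intro allI impI, elim conjE)
    fix A assume A: "openin P A" "0 \<in> A"
    then obtain A' where A': "openin (product_topology X UNIV) A'" "A = Poly_Mapping.lookup -` A' \<inter> ?C"
      by (auto simp: P_def openin_pullback_topology)
    have "Poly_Mapping.lookup 0 \<in> A'" using A A' by auto
    then obtain U where U: "finite {i. U i \<noteq> topspace (X i)}" "\<And>i. openin (X i) (U i)"
       "Poly_Mapping.lookup 0 \<in> Pi\<^sub>E UNIV U" "Pi\<^sub>E UNIV U \<subseteq> A'"
      using A'(1) unfolding openin_product_topology_alt by auto
    have U0: "0 \<in> U i" for i using U(3) by (auto simp: PiE_iff)
    have "\<exists>G H. openin (X i) G \<and> convex_wrt scl H \<and> 0 \<in> G \<and> G \<subseteq> H \<and> H \<subseteq> U i" for i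
      using base[of i] U(2)[of i] U0[of i] unfolding neighbourhood_base_at_def by blast
    then obtain G H where GH: "\<And>i. openin (X i) (G i)" "\<And>i. convex_wrt scl (H i)"
       "\<And>i. 0 \<in> G i" "\<And>i. G i \<subseteq> H i" "\<And>i. H i \<subseteq> U i" by metis
    let ?I = "{i. U i \<noteq> topspace (X i)}"
    let ?G = "?C \<inter> (\<Inter>i\<in>?I. {f \<in> topspace P. Poly_Mapping.lookup f i \<in> G i})"
    let ?H = "?C \<inter> (\<Inter>i\<in>?I. {f \<in> topspace P. Poly_Mapping.lookup f i \<in> H i})"
    have oi: "openin P {f \<in> topspace P. Poly_Mapping.lookup f i \<in> G i}" for i
      by (rule openin_continuous_map_preimage[OF contL GH(1)])
    have "openin P ((\<Inter>i\<in>?I. {f \<in> topspace P. Poly_Mapping.lookup f i \<in> G i}) \<inter> topspace P)"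
      by (rule openin_INT[OF U(1) oi])
    then have "openin P ?G" by (simp only: topP Int_commute)
    moreover have "convex_wrt (direct_sum_scale scl) ?H"
    proof -
      have "direct_sum_scale scl (of_real u) x + direct_sum_scale scl (of_real v) y \<in> ?C"
        if "x \<in> ?C" "y \<in> ?C" for x y and u v :: real
        using that subC by (intro W.subspace_add W.subspace_scale)
      then show ?thesis
        using GH(2) unfolding convex_wrt_def topP by (auto simp: lookup_add look)
    qed
    moreover have "0 \<in> ?G" using W.subspace_0[OF subC] GH(3) by (auto simp: topP)
    moreover have "?G \<subseteq> ?H" using GH(4) by blast
    moreover have "?H \<subseteq> A"
    proof
      fix f assume f: "f \<in> ?H"
      have "Poly_Mapping.lookup f i \<in> U i" for i
        using f GH(5)[of i] by (cases "i \<in> ?I") (auto simp: direct_sum_carrier_def)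
      then show "f \<in> A" using U(4) A'(2) f by auto
    qed
    ultimately show "\<exists>U V. openin P U \<and> convex_wrt (direct_sum_scale scl) V \<and> 0 \<in> U \<and> U \<subseteq> V \<and> V \<subseteq> A"
      by blast
  qed
  moreover have "embedding_map (X i) P (Poly_Mapping.single i)" for i
  proof -
    have "continuous_map (X i) P (Poly_Mapping.single i)"
    proof (rule contP)
      show "Poly_Mapping.single i ` topspace (X i) \<subseteq> ?C" using singC by blast
      show "continuous_map (X i) (X j) (\<lambda>x. Poly_Mapping.lookup (Poly_Mapping.single i x) j)" for j
        by (cases "i = j") (auto simp: lookup_single zero)
    qed
    then have "section_map (X i) P (Poly_Mapping.single i)"
      unfolding section_map_def retraction_maps_def using contL[of i]
      by (intro exI[of _ "\<lambda>f. Poly_Mapping.lookup f i"]) auto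
    then show ?thesis by (rule section_imp_embedding_map)
  qed
  ultimately have "direct_sum_candidate scl X P"
    unfolding direct_sum_candidate_def locally_convex_space_def topological_vector_space_def
    using topP subC W.vector_space_axioms by auto
  then show ?thesis ..
qed

lemma locally_convex_direct_sum_exists:
  fixes scl :: "'k::real_or_complex \<Rightarrow> 'a::ab_group_add \<Rightarrow> 'a"
    and X :: "'i \<Rightarrow> 'a topology"
  assumes X: "\<And>i. locally_convex_space scl (X i)"
  shows "\<exists>T. locally_convex_direct_sum scl X T"
proof -
  let ?C = "direct_sum_carrier X"
    and ?s = "direct_sum_scale scl :: 'k \<Rightarrow> ('i \<Rightarrow>\<^sub>0 'a) \<Rightarrow> _"
  have "\<exists>P. direct_sum_candidate scl X P"
    by (rule direct_sum_candidate_exists[OF X])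
  then obtain P where P: "direct_sum_candidate scl X P" ..
  define S where "S = {U. \<exists>T. direct_sum_candidate scl X T \<and> openin T U}"
  define D where "D = topology_generated_by S"
  have finer: "openin D U" if "direct_sum_candidate scl X T" "openin T U" for T U
    unfolding D_def using that by (intro topology_generated_by_Basis) (auto simp: S_def)
  have topT: "topspace T = ?C" if "direct_sum_candidate scl X T" for T
    using that by (simp add: direct_sum_candidate_def)
  have topD: "topspace D = ?C"
  proof -
    have "U \<subseteq> ?C" if "U \<in> S" for U
      using that topT openin_subset unfolding S_def by blast
    moreover have "?C \<in> S"
      using P openin_topspace[of P] topT[OF P] unfolding S_def by auto
    ultimately have "\<Union>S = ?C" by blast
    then show ?thesis by (simp add: D_def)
  qed
  have tvsT: "topological_vector_space ?s T" and baseT: "neighbourhood_base_at 0 (convex_wrt ?s) T"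
    and embT: "embedding_map (X i) T (Poly_Mapping.single i)"
    if "direct_sum_candidate scl X T" for T i
    using that by (auto simp: direct_sum_candidate_def locally_convex_space_def)
  have idc: "continuous_map D T id" if "direct_sum_candidate scl X T" for T
    unfolding continuous_map_def
  proof (intro conjI allI impI)
    show "id \<in> topspace D \<rightarrow> topspace T" using topT[OF that] topD by simp
    fix U assume U: "openin T U"
    then have "{x \<in> topspace D. id x \<in> U} = U"
      using openin_subset[OF U] topT[OF that] topD by auto
    then show "openin D {x \<in> topspace D. id x \<in> U}" using finer[OF that U] by simp
  qed
  have idin: "continuous_map Z D f"
    if "f \<in> topspace Z \<rightarrow> ?C" "\<And>T. direct_sum_candidate scl X T \<Longrightarrow> continuous_map Z T f"
    for Z :: "'c topology" and f
    unfolding D_def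
  proof (rule continuous_on_generated_topo)
    show "openin Z (f -` U \<inter> topspace Z)" if "U \<in> S" for U
    proof -
      obtain T where T: "direct_sum_candidate scl X T" "openin T U"
        using \<open>U \<in> S\<close> by (auto simp: S_def)
      have "openin Z {x \<in> topspace Z. f x \<in> U}"
        using openin_continuous_map_preimage[OF \<open>\<And>T. direct_sum_candidate scl X T \<Longrightarrow> continuous_map Z T f\<close>[OF T(1)] T(2)] .
      then show ?thesis by (simp add: vimage_def Int_def conj_commute)
    qed
    show "f ` topspace Z \<subseteq> \<Union>S"
      using that(1) topD by (auto simp: D_def)
  qed
  have subC: "module.subspace ?s ?C" and vs: "vector_space ?s" and nz: "?C \<noteq> {0}"
    using tvsT[OF P] unfolding topological_vector_space_def topT[OF P]
    by - blast+
  interpret W: vector_space ?s by (rule vs)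
  have "Hausdorff_space D"
    unfolding Hausdorff_space_def
  proof (intro allI impI, elim conjE)
    fix x y assume "x \<in> topspace D" "y \<in> topspace D" "x \<noteq> y"
    then obtain U V where "openin P U" "openin P V" "x \<in> U" "y \<in> V" "disjnt U V"
      using tvsT[OF P] topT[OF P] topD
      unfolding topological_vector_space_def Hausdorff_space_def by metis
    then show "\<exists>U V. openin D U \<and> openin D V \<and> x \<in> U \<and> y \<in> V \<and> disjnt U V"
      using finer[OF P] by blast
  qed
  moreover have "continuous_map (prod_topology D D) D (\<lambda>(x, y). x + y)"
  proof (rule idin)
    show "(\<lambda>(x, y). x + y) \<in> topspace (prod_topology D D) \<rightarrow> ?C"
      using subC by (auto simp: topD W.subspace_add)
    fix T assume T: "direct_sum_candidate scl X T"
    have "continuous_map (prod_topology D D) T ((\<lambda>(x, y). x + y) \<circ> (\<lambda>z. (id (fst z), id (snd z))))"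
      using tvsT[OF T] unfolding topological_vector_space_def
      by (intro continuous_map_compose[where X' = "prod_topology T T"] continuous_map_pairedI
          continuous_map_compose[OF continuous_map_fst idc[OF T], unfolded comp_def]
          continuous_map_compose[OF continuous_map_snd idc[OF T], unfolded comp_def]) auto
    then show "continuous_map (prod_topology D D) T (\<lambda>(x, y). x + y)" by (simp add: comp_def)
  qed
  moreover have "continuous_map (prod_topology euclidean D) D (\<lambda>(c, x). ?s c x)"
  proof (rule idin)
    show "(\<lambda>(c, x). ?s c x) \<in> topspace (prod_topology euclidean D) \<rightarrow> ?C"
      using subC by (auto simp: topD W.subspace_scale)
    fix T assume T: "direct_sum_candidate scl X T"
    have "continuous_map (prod_topology euclidean D) T ((\<lambda>(c, x). ?s c x) \<circ> (\<lambda>z. (fst z, id (snd z))))"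
      using tvsT[OF T] unfolding topological_vector_space_def
      by (intro continuous_map_compose[where X' = "prod_topology euclidean T"] continuous_map_pairedI
          continuous_map_fst
          continuous_map_compose[OF continuous_map_snd idc[OF T], unfolded comp_def]) auto
    then show "continuous_map (prod_topology euclidean D) T (\<lambda>(c, x). ?s c x)" by (simp add: comp_def)
  qed
  moreover have "neighbourhood_base_at 0 (convex_wrt ?s) D"
    unfolding neighbourhood_base_at_def
  proof (intro allI impI, elim conjE)
    fix A assume "openin D A" and A0: "0 \<in> A"
    then have "generate_topology_on S A" by (simp add: D_def openin_topology_generated_by_iff)
    then show "\<exists>U V. openin D U \<and> convex_wrt ?s V \<and> 0 \<in> U \<and> U \<subseteq> V \<and> V \<subseteq> A"
      using A0
    proof (induction rule: generate_topology_on.induct)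
      case Empty
      then show ?case by simp
    next
      case (Int a b)
      obtain U V where UV: "openin D U" "convex_wrt ?s V" "0 \<in> U" "U \<subseteq> V" "V \<subseteq> a"
        using Int by blast
      obtain U' V' where UV': "openin D U'" "convex_wrt ?s V'" "0 \<in> U'" "U' \<subseteq> V'" "V' \<subseteq> b"
        using Int by blast
      have "convex_wrt ?s (V \<inter> V')"
        using UV(2) UV'(2) by (auto simp: convex_wrt_def)
      then show ?case using UV UV' by (intro exI[of _ "U \<inter> U'"] exI[of _ "V \<inter> V'"]) auto
    next
      case (UN K)
      then obtain k where "k \<in> K" "0 \<in> k" by blast
      then show ?case using UN.IH[of k] by (meson Union_upper order_trans)
    next
      case (Basis s)
      then obtain T where T: "direct_sum_candidate scl X T" "openin T s" by (auto simp: S_def)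
      then show ?case
        using baseT[OF T(1)] Basis finer[OF T(1)] unfolding neighbourhood_base_at_def by meson
    qed
  qed
  moreover have "embedding_map (X i) D (Poly_Mapping.single i)" for i
  proof -
    have cP: "continuous_map (X i) T (Poly_Mapping.single i)"
      if "direct_sum_candidate scl X T" for T
      using embT[OF that] by (simp add: embedding_map_def homeomorphic_eq_everything_map
          continuous_map_in_subtopology)
    have cD: "continuous_map (X i) D (Poly_Mapping.single i)"
      using cP cP[OF P] topT[OF P] by (intro idin) (auto simp: continuous_map_def)
    obtain g where g: "homeomorphic_maps (X i)
        (subtopology P (Poly_Mapping.single i ` topspace (X i))) (Poly_Mapping.single i) g"
      using embT[OF P, of i] unfolding embedding_map_def homeomorphic_map_maps by blast
    have "continuous_map (subtopology D A) (subtopology P A) id" for A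
      using idc[OF P]
      by (auto simp: continuous_map_in_subtopology continuous_map_from_subtopology)
    then have "continuous_map (subtopology D (Poly_Mapping.single i ` topspace (X i))) (X i) (g \<circ> id)"
      using g by (intro continuous_map_compose) (auto simp: homeomorphic_maps_def)
    with g cD have "homeomorphic_maps (X i)
        (subtopology D (Poly_Mapping.single i ` topspace (X i))) (Poly_Mapping.single i) g"
      by (auto simp: homeomorphic_maps_def continuous_map_in_subtopology topD topT[OF P])
    then show ?thesis
      unfolding embedding_map_def homeomorphic_map_maps by blast
  qed
  ultimately have "direct_sum_candidate scl X D"
    unfolding direct_sum_candidate_def locally_convex_space_def topological_vector_space_def
    using topD subC vs nz by auto
  then have "locally_convex_direct_sum scl X D"
    using finer topT unfolding locally_convex_direct_sum_def coarser_def by metis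
  then show ?thesis ..
qed

end

(* Since the topology of X_n is not weak, some continuous seminorm p_n is not dominated by finitely
   many continuous functionals. Hahn-Banach and a Gram-Schmidt process give a biorthogonal system
   (g_i, f_i) in X_n with p_n-bounded f_i, where the g_i span a dense subspace and lie in the
   absolutely convex l_1-hull of the given l_1-sequence. Hence every matrix with sufficiently
   small entries defines a continuous operator between the X_n.

   Let S = I + T, where T shifts chains of suitably scaled basis vectors, H(c,j) to H(c,j-1), and
   every chain comes out of X_0, up to its level. On the span of the H(c,j) the coefficients of
   the orbit at time t are the differences (Delta^j P_c)(t) of polynomials P_c, and S is translation of
   the P_c. A sequence of such polynomial families, corrected in the far future only, converges
   in X_0 to a vector whose orbit approaches each element of a countable dense set. The topology
   of the direct sum is so fine that the orbit must return into finite partial sums exactly; this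
   amounts to exact zeros of the P_c, which are preserved by multiplicative corrections. *)
theory Submission
  imports Defs
begin

section \<open>The scalar field and absolutely summable sequences\<close>

text \<open>The summands need not be complete or metrizable, so a Baire category argument is out of
  reach and a vector with dense orbit is built by hand. The only infinite sums known to converge
  have l1-coefficients, so limits are formed among coefficient sequences and then mapped by
  \<open>\<Phi>\<close>. Non-weakness supplies infinitely many independent functionals dominated by
  one continuous seminorm. This is why an operator with infinitely many nonzero matrix entries can
  be continuous: a single \<open>p n\<close> controls all its coefficients. A vector has finitely
  many nonzero coordinates, yet its orbit has to reach every summand. Hence T maps X_n to X_(n+1),
  and X_0 also to itself, and chains can be entered arbitrarily deep inside X_0. On the span of a
  chain T is locally nilpotent, so S^t is the sum of (t choose j) T^j, with coefficients polynomial
  in t: hitting a target at a late time is an interpolation problem. A continuous seminorm may weigh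
  the summands with arbitrarily fast growing constants, so small coefficients help only in finitely
  many summands; in all others they have to vanish.\<close>

lemma real_or_complex_norm_unit:
  fixes i :: "'k::real_or_complex"
  assumes "i * i = - 1"
  shows "norm i = 1"
proof -
  have "norm i * norm i = 1" using assms by (metis norm_minus_cancel norm_mult norm_one)
  then show ?thesis
    by (metis abs_norm_cancel power2_eq_square power2_eq_1_iff abs_1 abs_minus_cancel)
qed

text \<open>Multiplying by the conjugate gives \<open>a * a + b * b\<close>, and the conjugate has
  norm at most |a| + |b|. The estimate makes the coordinates of a Cauchy sequence Cauchy, and later
  shows that a functional is nonzero where its real part is.\<close>

lemma real_or_complex_norm_ge:
  fixes i :: "'k::real_or_complex"
  assumes "i * i = - 1"
  shows "(\<bar>a\<bar> + \<bar>b\<bar>) / 2 \<le> norm (a *\<^sub>R 1 + b *\<^sub>R i)"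
proof (cases "a = 0 \<and> b = 0")
  case False
  have ni: "norm i = 1" by (rule real_or_complex_norm_unit[OF assms])
  have "(a *\<^sub>R 1 + b *\<^sub>R i) * (a *\<^sub>R 1 - b *\<^sub>R i) = (a*a) *\<^sub>R 1 - (b * b) *\<^sub>R (i * i)"
    by (simp add: algebra_simps)
  also have "\<dots> = (a * a + b * b) *\<^sub>R 1" by (simp add: assms scaleR_left.add)
  finally have eq: "norm (a *\<^sub>R 1 + b *\<^sub>R i) * norm (a *\<^sub>R 1 - b *\<^sub>R i) = a * a + b * b"
    by (metis abs_of_nonneg norm_mult norm_scaleR norm_one mult.right_neutral sum_squares_ge_zero)
  have le: "norm (a *\<^sub>R 1 - b *\<^sub>R i) \<le> \<bar>a\<bar> + \<bar>b\<bar>"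
    using norm_triangle_ineq4[of "a *\<^sub>R 1" "b *\<^sub>R i"] ni by simp
  have pos: "0 < \<bar>a\<bar> + \<bar>b\<bar>" using False by auto
  have "(\<bar>a\<bar> + \<bar>b\<bar>) / 2 * (\<bar>a\<bar> + \<bar>b\<bar>) \<le> a * a + b * b"
  proof -
    have "0 \<le> (\<bar>a\<bar> - \<bar>b\<bar>) * (\<bar>a\<bar> - \<bar>b\<bar>)" by simp
    then show ?thesis by (simp add: algebra_simps)
  qed
  also have "\<dots> \<le> norm (a *\<^sub>R 1 + b *\<^sub>R i) * (\<bar>a\<bar> + \<bar>b\<bar>)"
    using eq le by (metis mult_left_mono norm_ge_zero)
  finally show ?thesis using pos by (simp only: mult_le_cancel_right_pos)
qed simp

text \<open>Completeness of the scalars is what allows series of coefficient sequences to be summed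
  coordinate by coordinate.\<close>

instance real_or_complex \<subseteq> banach
proof
  fix X :: "nat \<Rightarrow> 'a" assume X: "Cauchy X"
  consider "\<forall>x::'a. \<exists>a. x = a *\<^sub>R 1"
    | i :: 'a where "i * i = - 1" "\<forall>x. \<exists>a b. x = a *\<^sub>R 1 + b *\<^sub>R i"
    using real_or_complex by blast
  then show "convergent X"
  proof cases
    case 1
    then have "\<forall>n. \<exists>a. X n = a *\<^sub>R 1" by blast
    from choice[OF this] obtain a where a: "\<And>n. X n = a n *\<^sub>R 1" by blast
    have "dist (X m) (X n) = dist (a m) (a n)" for m n
      by (simp add: a dist_norm flip: scaleR_diff_left)
    then have "Cauchy a" using X by (simp add: Cauchy_def)
    then obtain l where "a \<longlonglongrightarrow> l" by (auto simp: Cauchy_convergent_iff convergent_def)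
    then have "X \<longlonglongrightarrow> l *\<^sub>R 1" unfolding a by (intro tendsto_intros)
    then show ?thesis by (auto simp: convergent_def)
  next
    case (2 i)
    then have "\<forall>n. \<exists>c. X n = fst c *\<^sub>R 1 + snd c *\<^sub>R i" by (metis fst_conv snd_conv)
    from choice[OF this] obtain c where "\<And>n. X n = fst (c n) *\<^sub>R 1 + snd (c n) *\<^sub>R i" by blast
    then obtain a b where ab: "\<And>n. X n = a n *\<^sub>R 1 + b n *\<^sub>R i"
      by (rule that[of "\<lambda>n. fst (c n)" "\<lambda>n. snd (c n)"])
    have "X m - X n = (a m - a n) *\<^sub>R 1 + (b m - b n) *\<^sub>R i" for m n
      by (simp add: ab algebra_simps)
    then have *: "(dist (a m) (a n) + dist (b m) (b n)) / 2 \<le> dist (X m) (X n)" for m n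
      using real_or_complex_norm_ge[OF 2(1), of "a m - a n" "b m - b n"] by (simp add: dist_norm)
    have half_sum: "u \<le> 2 * w \<and> v \<le> 2 * w" if "(u + v) / 2 \<le> w" "0 \<le> u" "0 \<le> v" for u v w :: real
      using that by auto
    have 2: "dist (a m) (a n) \<le> 2 * dist (X m) (X n)" "dist (b m) (b n) \<le> 2 * dist (X m) (X n)" for m n
      using half_sum[OF *[of m n] zero_le_dist zero_le_dist] by auto
    have "\<exists>M. \<forall>m\<ge>M. \<forall>n\<ge>M. 2 * dist (X m) (X n) < e" if "0 < e" for e
      using metric_CauchyD[OF X half_gt_zero[OF that]] by (simp add: mult.commute)
    then have "Cauchy a" "Cauchy b"
      unfolding Cauchy_def using 2 by (meson order.strict_trans1)+
    then obtain l l' where "a \<longlonglongrightarrow> l" "b \<longlonglongrightarrow> l'"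
      by (auto simp: Cauchy_convergent_iff convergent_def)
    then have "X \<longlonglongrightarrow> l *\<^sub>R 1 + l' *\<^sub>R i" unfolding ab by (intro tendsto_intros)
    then show ?thesis by (auto simp: convergent_def)
  qed
qed

lemma real_or_complex_dense_sequence:
  "\<exists>q :: nat \<Rightarrow> 'k::real_or_complex. \<forall>x. \<forall>e>0. \<exists>n. norm (x - q n) < e"
proof -
  have rat: "\<exists>r::rat. \<bar>a - of_rat r\<bar> < e" if "0 < e" for a e :: real
  proof -
    have "a - e < a + e" using that by simp
    from of_rat_dense[OF this] obtain r where "a - e < of_rat r" "of_rat r < a + e" by blast
    then show ?thesis by (intro exI[of _ r]) linarith
  qed
  \<comment> \<open>In the real case any \<open>i\<close> will do, with coefficient 0, so one
    enumeration by pairs of rationals serves both fields.\<close>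
  have "\<exists>i :: 'k. \<forall>x. \<exists>a b. x = a *\<^sub>R 1 + b *\<^sub>R i"
    using real_or_complex by (metis add.right_neutral scale_zero_left)
  then obtain i :: 'k where i: "\<And>x. \<exists>a b. x = a *\<^sub>R 1 + b *\<^sub>R i" by blast
  define q :: "nat \<Rightarrow> 'k" where
    "q n = (case from_nat n of (r, s) \<Rightarrow> of_rat r *\<^sub>R 1 + of_rat s *\<^sub>R i)" for n
  have "\<exists>n. norm (x - q n) < e" if "0 < e" for x e
  proof -
    obtain a b where x: "x = a *\<^sub>R 1 + b *\<^sub>R i" using i by blast
    have e2: "0 < e / 2" "0 < e / 2 / (norm i + 1)"
      using that by (auto intro!: divide_pos_pos add_nonneg_pos)
    obtain r where r: "\<bar>a - of_rat r\<bar> < e / 2" using rat[OF e2(1)] by blast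
    obtain s where s: "\<bar>b - of_rat s\<bar> < e / 2 / (norm i + 1)" using rat[OF e2(2)] by blast
    have "\<bar>b - of_rat s\<bar> * norm i \<le> \<bar>b - of_rat s\<bar> * (norm i + 1)"
      by (intro mult_left_mono) auto
    also have "\<dots> < e / 2"
      using s by (simp only: pos_less_divide_eq[OF add_nonneg_pos[OF norm_ge_zero zero_less_one]])
    finally have s': "\<bar>b - of_rat s\<bar> * norm i < e / 2" .
    have "x - q (to_nat (r, s)) = (a - of_rat r) *\<^sub>R 1 + (b - of_rat s) *\<^sub>R i"
      by (simp add: x q_def algebra_simps)
    also have "norm \<dots> \<le> \<bar>a - of_rat r\<bar> + \<bar>b - of_rat s\<bar> * norm i"
      by (rule order_trans[OF norm_triangle_ineq]) simp
    finally show ?thesis using r s' by (intro exI[of _ "to_nat (r, s)"]) linarith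
  qed
  then show ?thesis by blast
qed

section \<open>Absolutely summable sequences\<close>

definition l1_norm :: "(nat \<Rightarrow> 'k::real_normed_vector) \<Rightarrow> real" where
  "l1_norm a = suminf (\<lambda>n. norm (a n))"

abbreviation l1 :: "(nat \<Rightarrow> 'k::real_normed_vector) \<Rightarrow> bool" where
  "l1 a \<equiv> summable (\<lambda>n. norm (a n))"

lemma l1_add: "l1 a \<Longrightarrow> l1 b \<Longrightarrow> l1 (\<lambda>n. a n + b n)"
  by (rule summable_comparison_test'[where g = "\<lambda>n. norm (a n) + norm (b n)" and N = 0])
    (auto intro: summable_add norm_triangle_ineq)

lemma l1_mult: "l1 a \<Longrightarrow> l1 (\<lambda>n. c * a n)" for c :: "'k::real_normed_field"
  by (simp add: norm_mult summable_mult)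

lemma l1_finite: "finite {n. a n \<noteq> 0} \<Longrightarrow> l1 a"
  by (rule summable_finite[of "{n. a n \<noteq> 0}"]) auto

lemma l1_norm_mult: "l1 a \<Longrightarrow> l1_norm (\<lambda>n. c * a n) = norm c * l1_norm a"
  for c :: "'k::real_normed_field"
  by (simp add: l1_norm_def norm_mult suminf_mult)

text \<open>Completeness of l1, phrased without a topology on the sequence space: interchanging a
  finite sum with the series bounds each partial sum of the norms of the coordinatewise limit by
  \<open>suminf e\<close>.\<close>

lemma l1_series:
  fixes v :: "nat \<Rightarrow> nat \<Rightarrow> 'k::banach"
  assumes v: "\<And>s. l1 (v s)" "\<And>s. l1_norm (v s) \<le> e s" and e: "summable e"
  shows "summable (\<lambda>s. v s i)" and "l1 (\<lambda>i. suminf (\<lambda>s. v s i))" and "l1_norm (\<lambda>i. suminf (\<lambda>s. v s i)) \<le> suminf e"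
proof -
  have le: "(\<Sum>i<n. norm (v s i)) \<le> e s" for s n
    using sum_le_suminf[OF v(1)[of s], of "{..<n}"] v(2)[of s] by (simp add: l1_norm_def)
  have le1: "norm (v s i) \<le> e s" for s i
    using le[of s "Suc i"] sum_nonneg[of "{..<i}" "\<lambda>i. norm (v s i)"] by auto
  have sn: "summable (\<lambda>s. norm (v s i))" for i
    by (rule summable_comparison_test'[OF e, where N = 0]) (simp add: le1)
  then show "summable (\<lambda>s. v s i)" by (rule summable_norm_cancel)
  have bound: "(\<Sum>i<n. norm (suminf (\<lambda>s. v s i))) \<le> suminf e" for n
  proof -
    have "(\<Sum>i<n. norm (suminf (\<lambda>s. v s i))) \<le> (\<Sum>i<n. suminf (\<lambda>s. norm (v s i)))"
      by (intro sum_mono summable_norm sn)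
    also have "\<dots> = suminf (\<lambda>s. \<Sum>i<n. norm (v s i))"
      by (rule suminf_sum[symmetric]) (rule sn)
    also have "\<dots> \<le> suminf e"
      by (intro suminf_le le summable_sum sn e)
    finally show ?thesis .
  qed
  show l: "l1 (\<lambda>i. suminf (\<lambda>s. v s i))"
    by (rule summableI_nonneg_bounded[OF _ bound]) simp
  then show "l1_norm (\<lambda>i. suminf (\<lambda>s. v s i)) \<le> suminf e"
    unfolding l1_norm_def by (intro suminf_le_const bound)
qed

section \<open>Polynomial functions on the integers\<close>

definition fwd_diff :: "(int \<Rightarrow> 'k::ring_1) \<Rightarrow> int \<Rightarrow> 'k" where
  "fwd_diff F t = F (t + 1) - F t"

lemma fwd_diff_pow_Suc: "(fwd_diff ^^ Suc j) F t = (fwd_diff ^^ j) F (t + 1) - (fwd_diff ^^ j) F t"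
  by (simp add: fwd_diff_def)

lemma fwd_diff_zero [simp]: "fwd_diff (\<lambda>_. 0) = (\<lambda>_. 0)"
  by (simp add: fwd_diff_def fun_eq_iff)

lemma fwd_diff_pow_zero [simp]: "(fwd_diff ^^ j) (\<lambda>_. 0) = (\<lambda>_. 0)"
  by (induction j) auto

lemma fwd_diff_pow_add:
  "(fwd_diff ^^ j) (\<lambda>t. F t + G t) = (\<lambda>t. (fwd_diff ^^ j) F t + (fwd_diff ^^ j) G t)"
  by (induction j) (auto simp: fwd_diff_def fun_eq_iff)

lemma fwd_diff_pow_diff:
  "(fwd_diff ^^ j) (\<lambda>t. F t - G t) = (\<lambda>t. (fwd_diff ^^ j) F t - (fwd_diff ^^ j) G t)"
  by (induction j) (auto simp: fwd_diff_def fun_eq_iff)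

lemma fwd_diff_pow_cmult:
  "(fwd_diff ^^ j) (\<lambda>t. c * F t) = (\<lambda>t. c * (fwd_diff ^^ j) F t)"
  by (induction j) (auto simp: fwd_diff_def fun_eq_iff algebra_simps)

lemma fwd_diff_pow_shift: "(fwd_diff ^^ j) (\<lambda>t. F (t + k)) = (\<lambda>t. (fwd_diff ^^ j) F (t + k))"
  by (induction j) (auto simp: fwd_diff_def fun_eq_iff algebra_simps)

text \<open>The difference of order \<open>j\<close> at \<open>t\<close> sees only the values at t,
  ..., t + j. Through this, zeros at consecutive integers become vanishing coefficients of the first
  entries of a chain, which are those outside the summand 0.\<close>

lemma fwd_diff_pow_eq_0:
  "(\<And>i. i \<le> j \<Longrightarrow> F (t + int i) = 0) \<Longrightarrow> (fwd_diff ^^ j) F t = 0"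
proof (induction j arbitrary: t)
  case (Suc j)
  have "(fwd_diff ^^ j) F (t + 1) = 0"
    using Suc.prems[of "Suc i" for i] by (intro Suc.IH) (auto simp: algebra_simps)
  then show ?case using Suc.IH[of t] Suc.prems unfolding fwd_diff_pow_Suc by simp
qed simp

lemma fwd_diff_pow_tendsto:
  fixes F :: "'i \<Rightarrow> int \<Rightarrow> 'k::real_normed_field"
  assumes "\<And>t. 0 \<le> t \<Longrightarrow> ((\<lambda>k. F k t) \<longlongrightarrow> 0) L" "0 \<le> t"
  shows "((\<lambda>k. (fwd_diff ^^ j) (F k) t) \<longlongrightarrow> 0) L"
  using assms(2)
proof (induction j arbitrary: t)
  case (Suc j)
  show ?case unfolding fwd_diff_pow_Suc
    using tendsto_diff[OF Suc.IH[of "t + 1"] Suc.IH[of t]] Suc.prems by simp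
qed (simp add: assms(1))

text \<open>In characteristic 0 these are the restrictions to the integers of polynomials of degree
  less than \<open>d\<close>. The orbit is described by iterated differences, so this form is closer
  to the use than coefficients would be.\<close>

definition poly_fun :: "nat \<Rightarrow> (int \<Rightarrow> 'k::ring_1) set" where
  "poly_fun d = {F. (fwd_diff ^^ d) F = (\<lambda>_. 0)}"

lemma poly_fun_Suc: "F \<in> poly_fun (Suc d) \<longleftrightarrow> fwd_diff F \<in> poly_fun d"
  by (simp add: poly_fun_def funpow_Suc_right del: funpow.simps(2))

lemma poly_fun_0: "F \<in> poly_fun 0 \<longleftrightarrow> F = (\<lambda>_. 0)"
  by (simp add: poly_fun_def)

lemma poly_fun_mono: "d \<le> d' \<Longrightarrow> F \<in> poly_fun d \<Longrightarrow> F \<in> poly_fun d'"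
  by (rule dec_induct) (auto simp: poly_fun_def)

lemma poly_fun_zero: "(\<lambda>_. 0) \<in> poly_fun d"
  by (simp add: poly_fun_def)

lemma poly_fun_add: "F \<in> poly_fun d \<Longrightarrow> G \<in> poly_fun d \<Longrightarrow> (\<lambda>t. F t + G t) \<in> poly_fun d"
  by (simp add: poly_fun_def fwd_diff_pow_add)

lemma poly_fun_diff: "F \<in> poly_fun d \<Longrightarrow> G \<in> poly_fun d \<Longrightarrow> (\<lambda>t. F t - G t) \<in> poly_fun d"
  by (simp add: poly_fun_def fwd_diff_pow_diff)

lemma poly_fun_shift: "F \<in> poly_fun d \<Longrightarrow> (\<lambda>t. F (t + k)) \<in> poly_fun d"
  by (simp add: poly_fun_def fwd_diff_pow_shift fun_eq_iff)

lemma poly_fun_affine: "(\<lambda>t. a + b * of_int t) \<in> poly_fun 2"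
  by (simp add: poly_fun_def fwd_diff_def numeral_2_eq_2 fun_eq_iff algebra_simps
      flip: mult_2_right)

text \<open>By the Leibniz rule, the difference of F G at t is F (t + 1) times the difference of G,
  plus the difference of F times G. Each summand has lowered one of the two orders, whence the
  induction on \<open>a + b\<close>. The sharp order would be one less.\<close>

lemma poly_fun_mult:
  assumes "F \<in> poly_fun a" "G \<in> poly_fun b"
  shows "(\<lambda>t. F t * G t) \<in> poly_fun (a + b)"
  using assms
proof (induction "a + b" arbitrary: a b F G)
  case 0
  then show ?case by (simp add: poly_fun_0)
next
  case (Suc n)
  show ?case
  proof (cases "a = 0 \<or> b = 0")
    case True
    then show ?thesis using Suc.prems poly_fun_zero[of "a + b"] by (auto simp: poly_fun_0)
  next
    case False
    then obtain a' b' where ab: "a = Suc a'" "b = Suc b'" by (metis not0_implies_Suc)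
    have n: "n = a + b'" "n = a' + b" using Suc.hyps(2) ab by auto
    have "fwd_diff F \<in> poly_fun a'" "fwd_diff G \<in> poly_fun b'"
      using Suc.prems by (auto simp: ab poly_fun_Suc)
    then have "(\<lambda>t. F (t + 1) * fwd_diff G t) \<in> poly_fun n" "(\<lambda>t. fwd_diff F t * G t) \<in> poly_fun n"
      using Suc.hyps(1)[OF n(1) poly_fun_shift[OF Suc.prems(1), of 1]] Suc.hyps(1)[OF n(2) _ Suc.prems(2)]
        n by auto
    moreover have eq: "fwd_diff (\<lambda>t. F t * G t) = (\<lambda>t. F (t + 1) * fwd_diff G t + fwd_diff F t * G t)"
      by (simp add: fwd_diff_def fun_eq_iff algebra_simps)
    ultimately show ?thesis
      using poly_fun_add[of _ n] by (simp only: poly_fun_Suc eq flip: Suc.hyps(2))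
  qed
qed

lemma poly_fun_prod_affine:
  fixes a b :: "nat \<Rightarrow> 'k::comm_ring_1"
  shows "(\<lambda>t. \<Prod>i<n. (a i + b i * of_int t)) \<in> poly_fun (2 * n + 1)"
proof (induction n)
  case 0
  then show ?case by (simp add: poly_fun_def fwd_diff_def fun_eq_iff)
next
  case (Suc n)
  show ?case using poly_fun_mult[OF Suc poly_fun_affine[of "a n" "b n"]] by (simp add: eval_nat_numeral)
qed

text \<open>Summing the first differences outwards from 0, in both directions, costs one power of
  the argument per order.\<close>

lemma poly_fun_growth:
  fixes F :: "int \<Rightarrow> 'k::real_normed_field"
  assumes "F \<in> poly_fun d"
  shows "\<exists>C\<ge>0. \<forall>k. norm (F k) \<le> C * (1 + \<bar>of_int k\<bar>) ^ d"
  using assms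
proof (induction d arbitrary: F)
  case 0
  then show ?case by (auto simp: poly_fun_0)
next
  case (Suc d)
  then obtain C where C: "0 \<le> C" "\<And>k. norm (fwd_diff F k) \<le> C * (1 + \<bar>of_int k\<bar>) ^ d"
    using poly_fun_Suc by metis
  define D where "D = C + norm (F 0)"
  have step: "norm (F (k + 1) - F k) \<le> C * (1 + \<bar>of_int k\<bar>) ^ d" for k
    using C(2)[of k] by (simp add: fwd_diff_def)
  have pos: "norm (F (int n)) \<le> norm (F 0) + C * real n * (1 + real n) ^ d" for n
  proof (induction n)
    case (Suc n)
    have "norm (F (int (Suc n))) \<le> norm (F (int n)) + C * (1 + real n) ^ d"
      using step[of "int n"] norm_triangle_sub[of "F (int n + 1)" "F (int n)"] by (simp add: algebra_simps)
    also have "\<dots> \<le> norm (F 0) + (C * real n * (1 + real n) ^ d + C * (1 + real n) ^ d)"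
      using Suc.IH by simp
    also have "C * real n * (1 + real n) ^ d + C * (1 + real n) ^ d = C * real (Suc n) * (1 + real n) ^ d"
      by (simp add: algebra_simps)
    also have "\<dots> \<le> C * real (Suc n) * (1 + real (Suc n)) ^ d"
      using C(1) by (intro mult_left_mono power_mono) auto
    finally show ?case by simp
  qed simp
  have neg: "norm (F (- int n)) \<le> norm (F 0) + C * real n * (1 + real n) ^ d" for n
  proof (induction n)
    case (Suc n)
    have "norm (F (- int (Suc n))) \<le> norm (F (- int n)) + C * (1 + real (Suc n)) ^ d"
      using step[of "- int (Suc n)"] norm_triangle_sub[of "F (- int (Suc n))" "F (- int n)"]
      by (simp add: algebra_simps norm_minus_commute)
    also have "\<dots> \<le> norm (F 0) + (C * real n * (1 + real n) ^ d + C * (1 + real (Suc n)) ^ d)"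
      using Suc.IH by simp
    also have "\<dots> \<le> norm (F 0) + (C * real n * (1 + real (Suc n)) ^ d + C * (1 + real (Suc n)) ^ d)"
      using C(1) by (intro add_left_mono add_right_mono mult_left_mono power_mono) auto
    also have "C * real n * (1 + real (Suc n)) ^ d + C * (1 + real (Suc n)) ^ d
        = C * real (Suc n) * (1 + real (Suc n)) ^ d"
      by (simp add: algebra_simps)
    finally show ?case by simp
  qed simp
  have "norm (F k) \<le> D * (1 + \<bar>of_int k\<bar>) ^ Suc d" for k
  proof -
    obtain n where n: "k = int n \<or> k = - int n" using int_cases2 by metis
    have "norm (F k) \<le> norm (F 0) + C * real n * (1 + real n) ^ d"
      using pos neg n by blast
    also have "\<dots> \<le> norm (F 0) * (1 + real n) ^ Suc d + C * ((1 + real n) * (1 + real n) ^ d)"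
    proof (rule add_mono)
      have "1 \<le> (1 + real n) ^ Suc d" by (rule one_le_power) simp
      then show "norm (F 0) \<le> norm (F 0) * (1 + real n) ^ Suc d"
        using mult_left_mono[of 1 _ "norm (F 0)"] by simp
      show "C * real n * (1 + real n) ^ d \<le> C * ((1 + real n) * (1 + real n) ^ d)"
        using C(1) by (simp add: mult.assoc mult_left_mono mult_right_mono)
    qed
    also have "\<dots> = D * (1 + \<bar>of_int k\<bar>) ^ Suc d"
      using n by (auto simp: D_def algebra_simps)
    finally show ?thesis .
  qed
  moreover have "0 \<le> D" using C(1) by (simp add: D_def)
  ultimately show ?case by blast
qed

text \<open>A polynomial function at an argument of size at most \<open>t + k\<close> grows at most
  like the \<open>d\<close>-th power of \<open>k\<close>, and a product of \<open>m\<close> bounded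
  factors divided by about \<open>k\<close> decays like its \<open>m\<close>-th power. This makes
  each weight of the interpolation suppress the polynomial that it should hide.\<close>

lemma poly_fun_mult_tendsto_0:
  fixes F :: "int \<Rightarrow> 'k::real_normed_field"
  assumes F: "F \<in> poly_fun d" and s: "\<And>k. \<bar>s k\<bar> \<le> int t + int k" and m: "d < m"
    and G: "\<And>k. norm (G k) \<le> A / (1 + real k) ^ m"
  shows "(\<lambda>k. F (s k) * G k) \<longlonglongrightarrow> 0"
proof -
  obtain C where C: "0 \<le> C" "\<And>k. norm (F k) \<le> C * (1 + \<bar>of_int k\<bar>) ^ d"
    using poly_fun_growth[OF F] by blast
  have A: "0 \<le> A" using order_trans[OF norm_ge_zero G[of 0]] by simp
  have "norm (F (s k) * G k) \<le> C * (1 + real t) ^ d * A * inverse (real (Suc k))" for k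
  proof -
    have "\<bar>of_int (s k)\<bar> \<le> real t + real k"
      using s[of k] by linarith
    also have "1 + (real t + real k) \<le> (1 + real t) * (1 + real k)" by (simp add: algebra_simps)
    finally have "1 + \<bar>of_int (s k)\<bar> \<le> (1 + real t) * (1 + real k)" by simp
    then have "C * (1 + \<bar>of_int (s k)\<bar>) ^ d \<le> C * ((1 + real t) * (1 + real k)) ^ d"
      using C(1) by (intro mult_left_mono power_mono) auto
    with C(2) have "norm (F (s k)) \<le> C * ((1 + real t) * (1 + real k)) ^ d"
      by (rule order_trans)
    then have "norm (F (s k) * G k) \<le> C * ((1 + real t) * (1 + real k)) ^ d * (A / (1 + real k) ^ m)"
      unfolding norm_mult using G[of k] C(1) by (intro mult_mono) auto
    also have "A / (1 + real k) ^ m \<le> A / (1 + real k) ^ Suc d"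
      using m A by (intro divide_left_mono power_increasing) auto
    then have "C * ((1 + real t) * (1 + real k)) ^ d * (A / (1 + real k) ^ m) \<le>
        C * ((1 + real t) * (1 + real k)) ^ d * (A / (1 + real k) ^ Suc d)"
      using C(1) by (intro mult_left_mono) auto
    also have "\<dots> = C * (1 + real t) ^ d * A * inverse (real (Suc k))"
      by (simp add: power_mult_distrib divide_inverse)
    finally show ?thesis .
  qed
  moreover have "(\<lambda>k. C * (1 + real t) ^ d * A * inverse (real (Suc k))) \<longlonglongrightarrow> 0"
    by (intro tendsto_mult_right_zero LIMSEQ_inverse_real_of_nat)
  ultimately show ?thesis
    by (rule Lim_null_comparison[OF always_eventually[OF allI]])
qed

lemma tendsto_shift_quotient:
  "(\<lambda>k. of_int (int k + c) / of_nat (k + i + 1) :: 'k::real_normed_field) \<longlonglongrightarrow> 1"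
proof -
  have "(\<lambda>k. 1 + of_int (c - int i - 1) * inverse (of_nat (k + (i + 1))) :: 'k) \<longlonglongrightarrow> 1 + of_int (c - int i - 1) * 0"
    by (intro tendsto_intros LIMSEQ_ignore_initial_segment[OF lim_inverse_n])
  moreover have "1 + of_int (c - int i - 1) * inverse (of_nat (k + (i + 1))) =
      (of_int (int k + c) / of_nat (k + i + 1) :: 'k)" for k
  proof -
    have nz: "(of_nat (k + i + 1) :: 'k) \<noteq> 0" using of_nat_neq_0[of "k + i"] by simp
    have "(of_int (int k + c) :: 'k) = of_nat (k + i + 1) + of_int (c - int i - 1)" by simp
    then show ?thesis using nz
      by (simp only: divide_inverse distrib_right right_inverse not_False_eq_True add.assoc)
  qed
  ultimately show ?thesis by simp
qed

text \<open>With polynomial weights that are close to 1 near 0 and close to 0 near \<open>k\<close>, or vice versa,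
  \<open>Q k t = P t * (\<Prod>i<m. (k + i - t) / (k + i + 1)) + e (t - k) * (\<Prod>b<r. (t - b) / (k + 1))\<close>:
  it tends to \<open>P\<close> at 0 and to \<open>e\<close> at \<open>k\<close> as soon as \<open>m\<close> and \<open>r\<close> exceed the
  degrees, and the linear factors preserve prescribed zeros exactly.\<close>

lemma poly_fun_transfer:
  fixes P e :: "int \<Rightarrow> 'k::real_normed_field"
  assumes P: "P \<in> poly_fun d" and e: "e \<in> poly_fun d"
  shows "\<exists>D Q. (\<forall>k::nat. Q k \<in> poly_fun D) \<and>
    (\<forall>t\<ge>0. (\<lambda>k. Q k t) \<longlonglongrightarrow> P t) \<and>
    (\<forall>t\<ge>0. (\<lambda>k. Q k (int k + t)) \<longlonglongrightarrow> e t) \<and>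
    (\<forall>k. \<forall>t<R. P (int t) = 0 \<longrightarrow> Q k (int t) = 0) \<and>
    (\<forall>k. \<forall>i<M. e (int i) = 0 \<longrightarrow> Q k (int k + int i) = 0)"
proof -
  \<comment> \<open>The first summand reserves a linear factor for every prescribed zero, the rest
    makes the number of factors exceed the degree bound. The \<open>+ 1\<close> in the denominators
    below keeps them nonzero at \<open>k = 0\<close>.\<close>
  define m where "m = M + d + 1"
  define r where "r = R + d + 1"
  define X where "X k t = (\<Prod>i<m. of_int (int k + int i - t) / of_nat (k + i + 1) :: 'k)" for k :: nat and t
  define Y where "Y k t = (\<Prod>b<r. of_int (t - int b) / of_nat (k + 1) :: 'k)" for k :: nat and t
  define Q where "Q k t = P t * X k t + e (t - int k) * Y k t" for k t
  have X: "X k \<in> poly_fun (2 * m + 1)" for k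
  proof -
    have "X k = (\<lambda>t. \<Prod>i<m. of_int (int k + int i) / of_nat (k + i + 1) + (- 1 / of_nat (k + i + 1)) * of_int t)"
      by (auto simp: X_def fun_eq_iff diff_divide_distrib add_divide_distrib intro!: prod.cong)
    then show ?thesis by (simp only: poly_fun_prod_affine)
  qed
  have Y: "Y k \<in> poly_fun (2 * r + 1)" for k
  proof -
    have "Y k = (\<lambda>t. \<Prod>b<r. - of_int (int b) / of_nat (k + 1) + (1 / of_nat (k + 1)) * of_int t)"
      by (auto simp: Y_def fun_eq_iff diff_divide_distrib intro!: prod.cong)
    then show ?thesis by (simp only: poly_fun_prod_affine)
  qed
  have "Q k \<in> poly_fun (d + (2 * m + 1) + (d + (2 * r + 1)))" for k
  proof -
    have "(\<lambda>t. e (t - int k)) \<in> poly_fun d" using poly_fun_shift[OF e, of "- int k"] by simp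
    from poly_fun_add[OF poly_fun_mono[OF le_add1 poly_fun_mult[OF P X]]
        poly_fun_mono[OF le_add2 poly_fun_mult[OF this Y]]]
    show ?thesis unfolding Q_def .
  qed
  moreover have "(\<lambda>k. Q k t) \<longlonglongrightarrow> P t" if "0 \<le> t" for t
  proof -
    have "(\<lambda>k. X k t) \<longlonglongrightarrow> (\<Prod>i<m. 1)"
      unfolding X_def using tendsto_shift_quotient[of "int i - t" for i]
      by (intro tendsto_prod) (simp add: algebra_simps)
    moreover have "(\<lambda>k. e (t - int k) * Y k t) \<longlonglongrightarrow> 0"
    proof (rule poly_fun_mult_tendsto_0[OF e, where t = "nat t" and m = r])
      show "\<bar>t - int k\<bar> \<le> int (nat t) + int k" for k using that by auto
      show "d < r" by (simp add: r_def)
      show "norm (Y k t) \<le> (\<Prod>b<r. norm (of_int (t - int b) :: 'k)) / (1 + real k) ^ r" for k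
        unfolding Y_def prod_norm[symmetric] norm_divide prod_dividef norm_of_nat by simp
    qed
    ultimately have "(\<lambda>k. Q k t) \<longlonglongrightarrow> P t * 1 + 0"
      unfolding Q_def by (intro tendsto_intros) simp_all
    then show ?thesis by simp
  qed
  moreover have "(\<lambda>k. Q k (int k + t)) \<longlonglongrightarrow> e t" if "0 \<le> t" for t
  proof -
    have "(\<lambda>k. Y k (int k + t)) \<longlonglongrightarrow> (\<Prod>i<r. 1)"
      unfolding Y_def using tendsto_shift_quotient[of "t - int b" 0 for b]
      by (intro tendsto_prod) (simp add: algebra_simps)
    moreover have "(\<lambda>k. P (int k + t) * X k (int k + t)) \<longlonglongrightarrow> 0"
    proof (rule poly_fun_mult_tendsto_0[OF P, where t = "nat t" and m = m])
      show "\<bar>int k + t\<bar> \<le> int (nat t) + int k" for k using that by auto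
      show "d < m" by (simp add: m_def)
      have "norm (X k (int k + t)) = (\<Prod>i<m. norm (of_int (int i - t) :: 'k) / (1 + real (k + i)))" for k
        unfolding X_def prod_norm[symmetric] norm_divide norm_of_nat by (intro prod.cong) auto
      also have "\<dots> k \<le> (\<Prod>i<m. norm (of_int (int i - t) :: 'k) / (1 + real k))" for k
        by (intro prod_mono) (auto intro!: divide_left_mono)
      finally show "norm (X k (int k + t)) \<le> (\<Prod>i<m. norm (of_int (int i - t) :: 'k)) / (1 + real k) ^ m" for k
        by (simp add: prod_dividef)
    qed
    ultimately have "(\<lambda>k. Q k (int k + t)) \<longlonglongrightarrow> 0 + e t * 1"
      unfolding Q_def by (intro tendsto_intros) simp_all
    then show ?thesis by simp
  qed
  moreover have "Q k (int t) = 0" if "t < R" "P (int t) = 0" for k t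
  proof -
    have "Y k (int t) = 0"
      unfolding Y_def using that by (intro prod_zero bexI[of _ t]) (auto simp: r_def)
    then show ?thesis using that by (simp add: Q_def)
  qed
  moreover have "Q k (int k + int i) = 0" if "i < M" "e (int i) = 0" for k i
  proof -
    have "X k (int k + int i) = 0"
      unfolding X_def using that by (intro prod_zero bexI[of _ i]) (auto simp: m_def)
    then show ?thesis using that by (simp add: Q_def)
  qed
  ultimately show ?thesis by blast
qed

section \<open>Finite families of polynomial functions and their jets\<close>

definition poly_family :: "nat \<Rightarrow> (nat \<Rightarrow> int \<Rightarrow> 'k::ring_1) \<Rightarrow> bool" where
  "poly_family N F \<longleftrightarrow> (\<forall>c\<ge>N. F c = (\<lambda>_. 0)) \<and> (\<forall>c. F c \<in> poly_fun N)"

text \<open>One bound \<open>N\<close> limits both the active chains and the degrees of a family, so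
  this square sum contains all nonzero differences. \<open>W c j\<close> will be the scaling factor
  of the chain vector \<open>H c j\<close>; the value is then the l1 norm of the coefficients at
  time \<open>t\<close> with respect to the unscaled vectors.\<close>

definition jet_norm ::
  "(nat \<Rightarrow> nat \<Rightarrow> real) \<Rightarrow> nat \<Rightarrow> (nat \<Rightarrow> int \<Rightarrow> 'k::real_normed_field) \<Rightarrow> int \<Rightarrow> real" where
  "jet_norm W N F t = (\<Sum>c<N. \<Sum>j<N. W c j * norm ((fwd_diff ^^ j) (F c) t))"

lemma poly_family_zero: "poly_family N (\<lambda>_ _. 0)"
  by (simp add: poly_family_def poly_fun_zero)

lemma poly_family_mono: "N \<le> N' \<Longrightarrow> poly_family N F \<Longrightarrow> poly_family N' F"
  by (auto simp: poly_family_def intro: poly_fun_mono[of N N'])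

lemma poly_family_diff:
  "poly_family N F \<Longrightarrow> poly_family N G \<Longrightarrow> poly_family N (\<lambda>c t. F c t - G c t)"
  by (simp add: poly_family_def poly_fun_diff)

lemma poly_family_shift: "poly_family N F \<Longrightarrow> poly_family N (\<lambda>c t. F c (t + k))"
  by (simp add: poly_family_def poly_fun_shift)

lemma poly_family_fwd_diff_eq_0:
  assumes "poly_family N F" "N \<le> c \<or> N \<le> j"
  shows "(fwd_diff ^^ j) (F c) t = 0"
proof (cases "N \<le> c")
  case True
  then show ?thesis using assms by (simp add: poly_family_def)
next
  case False
  then have "F c \<in> poly_fun N" "N \<le> j" using assms by (auto simp: poly_family_def)
  then have "F c \<in> poly_fun j" by (rule poly_fun_mono[rotated])
  then show ?thesis by (simp add: poly_fun_def)
qed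

lemma poly_family_sum_mono:
  fixes f :: "nat \<Rightarrow> nat \<Rightarrow> 'k::ring_1 \<Rightarrow> 'b::comm_monoid_add"
  assumes "poly_family N F" "N \<le> N'" "\<And>c j. f c j 0 = 0"
  shows "(\<Sum>c<N'. \<Sum>j<N'. f c j ((fwd_diff ^^ j) (F c) t)) = (\<Sum>c<N. \<Sum>j<N. f c j ((fwd_diff ^^ j) (F c) t))"
proof -
  have "f c j ((fwd_diff ^^ j) (F c) t) = 0" if "N \<le> c \<or> N \<le> j" for c j
    using poly_family_fwd_diff_eq_0[OF assms(1) that, of t] assms(3) by simp
  then show ?thesis
    unfolding sum.cartesian_product using assms(2)
    by (intro sum.mono_neutral_right) (auto simp: not_less[symmetric])
qed

lemma jet_norm_mono: "poly_family N F \<Longrightarrow> N \<le> N' \<Longrightarrow> jet_norm W N' F t = jet_norm W N F t"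
  unfolding jet_norm_def by (rule poly_family_sum_mono) auto

lemma jet_norm_shift: "jet_norm W N (\<lambda>c t. F c (t + k)) t = jet_norm W N F (t + k)"
  by (simp add: jet_norm_def fwd_diff_pow_shift)

lemma jet_norm_add:
  assumes "\<And>c j. 0 \<le> W c j"
  shows "jet_norm W N (\<lambda>c t. F c t + G c t) t \<le> jet_norm W N F t + jet_norm W N G t"
  unfolding jet_norm_def fwd_diff_pow_add sum.distrib[symmetric] distrib_left[symmetric]
  by (intro sum_mono mult_left_mono norm_triangle_ineq assms)

lemma jet_norm_tendsto:
  fixes F :: "'i \<Rightarrow> nat \<Rightarrow> int \<Rightarrow> 'k::real_normed_field"
  assumes "\<And>c t. 0 \<le> t \<Longrightarrow> ((\<lambda>k. F k c t) \<longlongrightarrow> 0) L" "0 \<le> t"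
  shows "((\<lambda>k. jet_norm W N (F k) t) \<longlongrightarrow> 0) L"
  unfolding jet_norm_def
  by (intro tendsto_null_sum tendsto_mult_right_zero tendsto_norm_zero
      fwd_diff_pow_tendsto[OF assms(1) assms(2)])

lemma poly_family_step:
  fixes P e :: "nat \<Rightarrow> int \<Rightarrow> 'k::real_normed_field"
  assumes P: "poly_family N P" and e: "poly_family N e" and eps: "0 < \<epsilon>"
  shows "\<exists>N' k P'. N \<le> N' \<and> poly_family N' P' \<and>
    (\<forall>c. \<forall>t<K + cl c. P c (int t) = 0 \<longrightarrow> P' c (int t) = 0) \<and>
    (\<forall>t\<le>K. jet_norm W N' (\<lambda>c t. P' c t - P c t) (int t) < \<epsilon>) \<and>
    jet_norm W N' (\<lambda>c t. P' c (t + int k) - e c t) 0 < \<epsilon> \<and>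
    (\<forall>c. \<forall>i<cl c. e c (int i) = 0 \<longrightarrow> P' c (int k + int i) = 0)"
proof -
  define good where "good c D Q \<longleftrightarrow> (\<forall>k::nat. Q k \<in> poly_fun D) \<and>
    (\<forall>t\<ge>0. (\<lambda>k. Q k t) \<longlonglongrightarrow> P c t) \<and>
    (\<forall>t\<ge>0. (\<lambda>k. Q k (int k + t)) \<longlonglongrightarrow> e c t) \<and>
    (\<forall>k. \<forall>t<K + cl c. P c (int t) = 0 \<longrightarrow> Q k (int t) = 0) \<and>
    (\<forall>k. \<forall>i<cl c. e c (int i) = 0 \<longrightarrow> Q k (int k + int i) = 0)" for c D Q
  have "\<forall>c. \<exists>D Q. good c D Q"
    using P e unfolding good_def by (intro allI poly_fun_transfer[of _ N]) (auto simp: poly_family_def)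
  then obtain D Q where "\<And>c. good c (D c) (Q c)" by metis
  then have Q: "\<And>c k. Q c (k::nat) \<in> poly_fun (D c)"
      "\<And>c t. 0 \<le> t \<Longrightarrow> (\<lambda>k. Q c k t) \<longlonglongrightarrow> P c t"
      "\<And>c t. 0 \<le> t \<Longrightarrow> (\<lambda>k. Q c k (int k + t)) \<longlonglongrightarrow> e c t"
      "\<And>c k t. t < K + cl c \<Longrightarrow> P c (int t) = 0 \<Longrightarrow> Q c k (int t) = 0"
      "\<And>c k i. i < cl c \<Longrightarrow> e c (int i) = 0 \<Longrightarrow> Q c k (int k + int i) = 0"
    unfolding good_def by blast+
  define N' where "N' = Max (insert N (D ` {..<N}))"
  define P' where "P' k c = (if c < N then Q c k else (\<lambda>_. 0))" for k c
  have N': "N \<le> N'" "\<And>c. c < N \<Longrightarrow> D c \<le> N'" by (auto simp: N'_def)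
  have fam: "poly_family N' (P' k)" for k
    unfolding poly_family_def P'_def
    using N'(1) poly_fun_mono[OF N'(2) Q(1)] by (simp add: poly_fun_zero)
  have "(\<lambda>k. P' k c t - P c t) \<longlonglongrightarrow> 0" if "0 \<le> t" for c t
    using Q(2)[OF that, of c] P by (cases "c < N") (auto simp: P'_def poly_family_def LIM_zero_iff)
  then have "(\<lambda>k. jet_norm W N' (\<lambda>c t. P' k c t - P c t) (int t)) \<longlonglongrightarrow> 0" for t
    by (intro jet_norm_tendsto) auto
  then have "\<forall>\<^sub>F k in sequentially. jet_norm W N' (\<lambda>c t. P' k c t - P c t) (int t) < \<epsilon>" for t
    using eps order_tendstoD(2) by blast
  then have 1: "\<forall>\<^sub>F k in sequentially. \<forall>t\<in>{..K}. jet_norm W N' (\<lambda>c t. P' k c t - P c t) (int t) < \<epsilon>"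
    by (intro eventually_ball_finite) auto
  have "(\<lambda>k. P' k c (t + int k) - e c t) \<longlonglongrightarrow> 0" if "0 \<le> t" for c t
    using Q(3)[OF that, of c] e by (cases "c < N") (auto simp: P'_def poly_family_def LIM_zero_iff add.commute)
  then have "(\<lambda>k. jet_norm W N' (\<lambda>c t. P' k c (t + int k) - e c t) 0) \<longlonglongrightarrow> 0"
    by (intro jet_norm_tendsto) auto
  then have "\<forall>\<^sub>F k in sequentially. jet_norm W N' (\<lambda>c t. P' k c (t + int k) - e c t) 0 < \<epsilon>"
    using eps order_tendstoD(2) by blast
  with 1 have "\<forall>\<^sub>F k in sequentially. (\<forall>t\<in>{..K}. jet_norm W N' (\<lambda>c t. P' k c t - P c t) (int t) < \<epsilon>) \<and>
      jet_norm W N' (\<lambda>c t. P' k c (t + int k) - e c t) 0 < \<epsilon>"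
    by (rule eventually_conj)
  then obtain k where "\<forall>t\<in>{..K}. jet_norm W N' (\<lambda>c t. P' k c t - P c t) (int t) < \<epsilon>"
      "jet_norm W N' (\<lambda>c t. P' k c (t + int k) - e c t) 0 < \<epsilon>"
    using eventually_happens'[OF sequentially_bot] by blast
  then show ?thesis
    using N'(1) fam[of k] Q(4,5)
    by (intro exI[of _ N'] exI[of _ k] exI[of _ "P' k"]) (auto simp: P'_def)
qed

text \<open>\<open>k r\<close> is the time at which the target \<open>e r\<close> is approached; since targets have finite
  support, the last clause makes all but finitely many coordinates vanish exactly at that time.\<close>

lemma poly_family_sequence:
  fixes e :: "nat \<Rightarrow> nat \<Rightarrow> int \<Rightarrow> 'k::real_normed_field"
  assumes W: "\<And>c j. 0 \<le> W c j" and e: "\<And>s. poly_family (M s) (e s)"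
  shows "\<exists>P N k. incseq N \<and> (\<forall>s. M s \<le> N (Suc s) \<and> poly_family (N s) (P s)) \<and>
    (\<forall>s c. \<forall>i<cl c. P s c (int i) = 0) \<and>
    (\<forall>s. jet_norm W (N (Suc s)) (\<lambda>c t. P (Suc s) c t - P s c t) 0 \<le> (1/2) ^ s) \<and>
    (\<forall>r. \<forall>s>r. jet_norm W (N s) (\<lambda>c t. P s c (t + int (k r)) - e r c t) 0 \<le> 2 * (1/2) ^ r) \<and>
    (\<forall>r. \<forall>s>r. \<forall>c. e r c = (\<lambda>_. 0) \<longrightarrow> (\<forall>i<cl c. P s c (int (k r) + int i) = 0))"
proof -
  \<comment> \<open>The state carries a horizon \<open>K\<close> beyond all times used so far, so
    that each later correction is small, and keeps the exact zeros, at all earlier target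
    times.\<close>
  define Step where "Step s x y \<longleftrightarrow> (case x of (P, N, K) \<Rightarrow> case y of (P', N', K') \<Rightarrow>
    N \<le> N' \<and> M s \<le> N' \<and> K \<le> K' \<and>
    (\<forall>c. \<forall>t<K + cl c. P c (int t) = 0 \<longrightarrow> P' c (int t) = 0) \<and>
    (\<forall>t\<le>K. jet_norm W N' (\<lambda>c t. P' c t - P c t) (int t) < (1/2)^s) \<and>
    (\<exists>k\<le>K'. jet_norm W N' (\<lambda>c t. P' c (t + int k) - e s c t) 0 < (1/2)^s \<and>
      (\<forall>c. \<forall>i<cl c. e s c (int i) = 0 \<longrightarrow> P' c (int k + int i) = 0)))"
    for s :: nat and x y :: "(nat \<Rightarrow> int \<Rightarrow> 'k) \<times> nat \<times> nat"
  have "\<exists>f. \<forall>s. (poly_family (fst (snd (f s))) (fst (f s)) \<and> (s = 0 \<longrightarrow> fst (f s) = (\<lambda>_ _. 0))) \<and>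
      Step s (f s) (f (Suc s))"
  proof (rule dependent_nat_choice)
    show "\<exists>x :: (nat \<Rightarrow> int \<Rightarrow> 'k) \<times> nat \<times> nat. poly_family (fst (snd x)) (fst x) \<and> (0 = 0 \<longrightarrow> fst x = (\<lambda>_ _. 0))"
      using poly_family_zero[of 0, where 'a = 'k] by (intro exI[of _ "(\<lambda>_ _. 0, 0, 0)"]) auto
  next
    fix x :: "(nat \<Rightarrow> int \<Rightarrow> 'k) \<times> nat \<times> nat" and s :: nat
    assume x: "poly_family (fst (snd x)) (fst x) \<and> (s = 0 \<longrightarrow> fst x = (\<lambda>_ _. 0))"
    obtain P N K where xe: "x = (P, N, K)" by (cases x) auto
    define N0 where "N0 = max N (M s)"
    have "poly_family N P" "N \<le> N0" "M s \<le> N0" using x by (auto simp: xe N0_def)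
    then have "poly_family N0 P" "poly_family N0 (e s)"
      using e[of s] poly_family_mono by blast+
    from poly_family_step[OF this, of "(1/2)^s" K cl W]
    obtain N' k P' where *: "N0 \<le> N'" "poly_family N' P'"
      "\<forall>c. \<forall>t<K + cl c. P c (int t) = 0 \<longrightarrow> P' c (int t) = 0"
      "\<forall>t\<le>K. jet_norm W N' (\<lambda>c t. P' c t - P c t) (int t) < (1/2)^s"
      "jet_norm W N' (\<lambda>c t. P' c (t + int k) - e s c t) 0 < (1/2)^s"
      "\<forall>c. \<forall>i<cl c. e s c (int i) = 0 \<longrightarrow> P' c (int k + int i) = 0"
      by auto
    have "Step s x (P', N', max K k)"
      unfolding Step_def xe prod.case using * by (auto simp: N0_def intro!: exI[of _ k])
    then show "\<exists>y. (poly_family (fst (snd y)) (fst y) \<and> (Suc s = 0 \<longrightarrow> fst y = (\<lambda>_ _. 0))) \<and> Step s x y"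
      using *(2) by (intro exI[of _ "(P', N', max K k)"]) auto
  qed
  then obtain f where f: "\<And>s. poly_family (fst (snd (f s))) (fst (f s))" "fst (f 0) = (\<lambda>_ _. 0)"
    "\<And>s. Step s (f s) (f (Suc s))" by blast
  define P where "P s = fst (f s)" for s
  define N where "N s = fst (snd (f s))" for s
  define K where "K s = snd (snd (f s))" for s
  have fe: "f s = (P s, N s, K s)" for s by (simp add: P_def N_def K_def)
  have fam: "poly_family (N s) (P s)" for s using f(1)[of s] by (simp add: P_def N_def)
  have P0: "P 0 = (\<lambda>_ _. 0)" using f(2) by (simp add: P_def)
  have St: "Step s (P s, N s, K s) (P (Suc s), N (Suc s), K (Suc s))" for s
    using f(3)[of s] by (simp add: fe)
  have "\<forall>s. \<exists>k\<le>K (Suc s). jet_norm W (N (Suc s)) (\<lambda>c t. P (Suc s) c (t + int k) - e s c t) 0 < (1/2)^s \<and>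
      (\<forall>c. \<forall>i<cl c. e s c (int i) = 0 \<longrightarrow> P (Suc s) c (int k + int i) = 0)"
    using St by (simp add: Step_def)
  from choice[OF this] obtain k where k: "\<And>s. k s \<le> K (Suc s)"
    "\<And>s. jet_norm W (N (Suc s)) (\<lambda>c t. P (Suc s) c (t + int (k s)) - e s c t) 0 < (1/2)^s"
    "\<And>s c i. i < cl c \<Longrightarrow> e s c (int i) = 0 \<Longrightarrow> P (Suc s) c (int (k s) + int i) = 0"
    by blast
  have N: "N s \<le> N (Suc s)" "M s \<le> N (Suc s)" and K: "K s \<le> K (Suc s)"
    and zero: "\<And>c t. t < K s + cl c \<Longrightarrow> P s c (int t) = 0 \<Longrightarrow> P (Suc s) c (int t) = 0"
    and small: "\<And>t. t \<le> K s \<Longrightarrow> jet_norm W (N (Suc s)) (\<lambda>c t. P (Suc s) c t - P s c t) (int t) < (1/2)^s" for s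
    using St[of s] by (auto simp: Step_def)
  have incN: "incseq N" and incK: "incseq K" using N K by (auto intro: incseq_SucI)
  have kK: "k r \<le> K s" if "r < s" for r s
    using k(1)[of r] incseqD[OF incK, of "Suc r" s] that by simp
  \<comment> \<open>The initial family is zero, and every window contains the arguments below
    \<open>cl c\<close> whatever the horizon. This will keep the starting vector inside the summand
    0.\<close>
  have A: "P s c (int i) = 0" if "i < cl c" for s c i
    by (induction s) (use that zero in \<open>auto simp: P0\<close>)
  have B: "P s c (int (k r) + int i) = 0" if "r < s" "e r c = (\<lambda>_. 0)" "i < cl c" for r s c i
    using that(1)
  proof (induction s)
    case (Suc s)
    show ?case
    proof (cases "r = s")
      case True
      then show ?thesis using k(3) that by simp
    next
      case False
      then have "r < s" using Suc.prems by simp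
      then have "P s c (int (k r + i)) = 0" "k r + i < K s + cl c"
        using Suc.IH kK[of r s] that by auto
      then show ?thesis using zero[of "k r + i" s c] by simp
    qed
  qed simp
  \<comment> \<open>The bound is the geometric sum of \<open>(1/2) ^ i\<close> for i from
    \<open>r\<close> to \<open>s - 1\<close>, in closed form: one term for installing the target and
    one for each later correction.\<close>
  have C: "jet_norm W (N s) (\<lambda>c t. P s c (t + int (k r)) - e r c t) 0 \<le> 2 * (1/2) ^ r - 2 * (1/2) ^ s"
    if "r < s" for r s
    using that
  proof (induction s)
    case (Suc s)
    show ?case
    proof (cases "r = s")
      case True
      then show ?thesis using k(2)[of s] by simp
    next
      case False
      then have rs: "r < s" using Suc.prems by simp
      have "M r \<le> N s" using N(2)[of r] incseqD[OF incN, of "Suc r" s] rs by simp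
      then have fd: "poly_family (N s) (\<lambda>c t. P s c (t + int (k r)) - e r c t)"
        using e[of r] by (intro poly_family_diff poly_family_shift fam) (rule poly_family_mono)
      have "jet_norm W (N (Suc s)) (\<lambda>c t. P (Suc s) c (t + int (k r)) - e r c t) 0 =
          jet_norm W (N (Suc s)) (\<lambda>c t. (P s c (t + int (k r)) - e r c t) +
            (P (Suc s) c (t + int (k r)) - P s c (t + int (k r)))) 0"
        by (simp add: algebra_simps)
      also have "\<dots> \<le> jet_norm W (N (Suc s)) (\<lambda>c t. P s c (t + int (k r)) - e r c t) 0 +
          jet_norm W (N (Suc s)) (\<lambda>c t. P (Suc s) c (t + int (k r)) - P s c (t + int (k r))) 0"
        by (rule jet_norm_add[OF W])
      also have "jet_norm W (N (Suc s)) (\<lambda>c t. P (Suc s) c (t + int (k r)) - P s c (t + int (k r))) 0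
          = jet_norm W (N (Suc s)) (\<lambda>c t. P (Suc s) c t - P s c t) (int (k r))"
        using jet_norm_shift[of W "N (Suc s)" "\<lambda>c t. P (Suc s) c t - P s c t" "int (k r)" 0] by simp
      also have "\<dots> \<le> (1/2)^s" using small[OF kK[OF rs]] by simp
      also have "jet_norm W (N (Suc s)) (\<lambda>c t. P s c (t + int (k r)) - e r c t) 0
          \<le> 2 * (1/2) ^ r - 2 * (1/2) ^ s"
        using Suc.IH[OF rs] jet_norm_mono[OF fd N(1)] by simp
      finally show ?thesis by simp
    qed
  qed simp
  have C': "jet_norm W (N s) (\<lambda>c t. P s c (t + int (k r)) - e r c t) 0 \<le> 2 * (1/2) ^ r" if "r < s" for r s
    using C[OF that] by (smt (verit) zero_le_power zero_le_divide_1_iff)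
  have D: "jet_norm W (N (Suc s)) (\<lambda>c t. P (Suc s) c t - P s c t) 0 \<le> (1/2)^s" for s
    using small[of 0 s] by simp
  show ?thesis
    using incN N(2) fam A B C' D by (intro exI[of _ P] exI[of _ N] exI[of _ k]) auto
qed

section \<open>Continuous seminorms\<close>

definition seminorm_on :: "('k::real_or_complex \<Rightarrow> 'a::ab_group_add \<Rightarrow> 'a) \<Rightarrow> 'a set \<Rightarrow> ('a \<Rightarrow> real) \<Rightarrow> bool" where
  "seminorm_on scl V q \<longleftrightarrow>
     (\<forall>x\<in>V. \<forall>y\<in>V. q (x + y) \<le> q x + q y) \<and> (\<forall>c. \<forall>x\<in>V. q (scl c x) = norm c * q x)"

definition cts_seminorm :: "('k::real_or_complex \<Rightarrow> 'a::ab_group_add \<Rightarrow> 'a) \<Rightarrow> 'a topology \<Rightarrow> ('a \<Rightarrow> real) \<Rightarrow> bool" where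
  "cts_seminorm scl T q \<longleftrightarrow> seminorm_on scl (topspace T) q \<and> continuous_map T euclideanreal q"

locale lcs = vector_space scl
  for scl :: "'k::real_or_complex \<Rightarrow> 'a::ab_group_add \<Rightarrow> 'a" +
  fixes T :: "'a topology"
  assumes lcs: "locally_convex_space scl T"
begin

abbreviation V where "V \<equiv> topspace T"

lemma subspace_V: "subspace V"
  and Hausdorff: "Hausdorff_space T"
  and cont_plus: "continuous_map (prod_topology T T) T (\<lambda>(x, y). x + y)"
  and cont_scale: "continuous_map (prod_topology euclidean T) T (\<lambda>(c, x). scl c x)"
  using lcs by (auto simp: locally_convex_space_def topological_vector_space_def)

lemma zero_V [simp]: "0 \<in> V" using subspace_V by (rule subspace_0)
lemma add_V [simp]: "x \<in> V \<Longrightarrow> y \<in> V \<Longrightarrow> x + y \<in> V" using subspace_V by (rule subspace_add)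
lemma diff_V [simp]: "x \<in> V \<Longrightarrow> y \<in> V \<Longrightarrow> x - y \<in> V" using subspace_V by (rule subspace_diff)
lemma scale_V [simp]: "x \<in> V \<Longrightarrow> scl c x \<in> V" using subspace_V by (rule subspace_scale)
lemma neg_V [simp]: "x \<in> V \<Longrightarrow> - x \<in> V" using subspace_V by (rule subspace_neg)
lemma sum_V [simp]: "(\<And>i. i \<in> A \<Longrightarrow> f i \<in> V) \<Longrightarrow> sum f A \<in> V"
  using subspace_V by (rule subspace_sum)
lemma span_V: "F \<subseteq> V \<Longrightarrow> span F \<subseteq> V" using subspace_V by (simp add: span_minimal)

lemma cont_add:
  assumes "continuous_map Z T f" "continuous_map Z T g"
  shows "continuous_map Z T (\<lambda>x. f x + g x)"
  using continuous_map_compose[OF continuous_map_pairedI[OF assms] cont_plus] by (simp add: comp_def)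

lemma cont_scl:
  assumes "continuous_map Z euclidean f" "continuous_map Z T g"
  shows "continuous_map Z T (\<lambda>x. scl (f x) (g x))"
  using continuous_map_compose[OF continuous_map_pairedI[OF assms] cont_scale] by (simp add: comp_def)

lemma cont_translate: "x \<in> V \<Longrightarrow> continuous_map T T (\<lambda>y. y + x)"
  using cont_add[of T id "\<lambda>_. x"] by simp

lemma seminorm_add: "seminorm_on scl V q \<Longrightarrow> x \<in> V \<Longrightarrow> y \<in> V \<Longrightarrow> q (x + y) \<le> q x + q y"
  and seminorm_scale: "seminorm_on scl V q \<Longrightarrow> x \<in> V \<Longrightarrow> q (scl c x) = norm c * q x"
  by (auto simp: seminorm_on_def)

lemma seminorm_0: "seminorm_on scl V q \<Longrightarrow> q 0 = 0"
  using seminorm_scale[of q 0 0] by simp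

lemma seminorm_neg: "seminorm_on scl V q \<Longrightarrow> x \<in> V \<Longrightarrow> q (- x) = q x"
  using seminorm_scale[of q x "- 1"] by simp

lemma seminorm_nonneg: "seminorm_on scl V q \<Longrightarrow> x \<in> V \<Longrightarrow> 0 \<le> q x"
  using seminorm_add[of q x "- x"] seminorm_neg[of q x] seminorm_0[of q] by simp

lemma seminorm_diff: "seminorm_on scl V q \<Longrightarrow> x \<in> V \<Longrightarrow> y \<in> V \<Longrightarrow> q (x - y) \<le> q x + q y"
  using seminorm_add[of q x "- y"] seminorm_neg[of q y] by simp

lemma seminorm_minus_commute: "seminorm_on scl V q \<Longrightarrow> x \<in> V \<Longrightarrow> y \<in> V \<Longrightarrow> q (x - y) = q (y - x)"
  using seminorm_neg[of q "y - x"] by simp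

lemma seminorm_reverse_triangle:
  "seminorm_on scl V q \<Longrightarrow> x \<in> V \<Longrightarrow> y \<in> V \<Longrightarrow> \<bar>q x - q y\<bar> \<le> q (x - y)"
  using seminorm_add[of q "x - y" y] seminorm_add[of q "y - x" x] seminorm_minus_commute[of q x y] by simp

lemma seminorm_sum:
  assumes "seminorm_on scl V q" "finite A" "\<And>i. i \<in> A \<Longrightarrow> f i \<in> V"
  shows "q (sum f A) \<le> (\<Sum>i\<in>A. q (f i))"
  using assms(2,1,3)
proof (induction A rule: finite_induct)
  case (insert i A)
  then have "q (f i + sum f A) \<le> q (f i) + q (sum f A)" by (intro seminorm_add) auto
  then show ?case using insert by auto
qed (simp add: seminorm_0)

lemma cts_seminorm_ball:
  assumes "cts_seminorm scl T q" "x \<in> V"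
  shows "openin T {y \<in> V. q (y - x) < r}"
proof -
  have "continuous_map T euclideanreal (q \<circ> (\<lambda>y. y + - x))"
    using assms by (intro continuous_map_compose[OF cont_translate]) (auto simp: cts_seminorm_def)
  then have "openin T {y \<in> V. (q \<circ> (\<lambda>y. y + - x)) y \<in> {..<r}}"
    by (rule openin_continuous_map_preimage) simp
  then show ?thesis by simp
qed

text \<open>A bound near 0 suffices: rescaled by \<open>2 / r\<close> and translated to
  \<open>x\<close>, it makes \<open>q (y - x)\<close> at most \<open>r / 2\<close>, and the reverse
  triangle inequality does the rest.\<close>

lemma cts_seminormI:
  assumes q: "seminorm_on scl V q" and B: "openin T B" "0 \<in> B" "\<And>x. x \<in> B \<Longrightarrow> q x \<le> 1"
  shows "cts_seminorm scl T q"
proof -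
  have "openin T {x \<in> V. q x \<in> U}" if "open U" for U
  proof (subst openin_subopen, intro ballI)
    fix x assume x: "x \<in> {x \<in> V. q x \<in> U}"
    then obtain r where r: "0 < r" "ball (q x) r \<subseteq> U" using \<open>open U\<close> open_contains_ball by blast
    let ?N = "{y \<in> V. scl (of_real (2 / r)) (y + - x) \<in> B}"
    have "continuous_map T T (\<lambda>y. scl (of_real (2 / r)) (y + - x))"
      using x by (intro cont_scl cont_translate) auto
    then have "openin T ?N" using B(1) openin_continuous_map_preimage by blast
    moreover have "x \<in> ?N" using x B(2) by simp
    moreover have "?N \<subseteq> {x \<in> V. q x \<in> U}"
    proof
      fix y assume y: "y \<in> ?N"
      then have "q (scl (of_real (2 / r)) (y + - x)) \<le> 1" using B(3) by blast
      moreover have "q (scl (of_real (2 / r)) (y + - x)) = norm (of_real (2 / r) :: 'k) * q (y + - x)"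
        using x y q by (intro seminorm_scale) auto
      ultimately have "2 / r * q (y - x) \<le> 1" using r by (simp only: norm_of_real) simp
      then have "q (y - x) \<le> r / 2" using r by (simp add: field_simps)
      then have "\<bar>q y - q x\<bar> < r" using seminorm_reverse_triangle[OF q, of y x] x y r by simp
      then show "y \<in> {x \<in> V. q x \<in> U}" using r(2) y by (auto simp: dist_real_def)
    qed
    ultimately show "\<exists>N. openin T N \<and> x \<in> N \<and> N \<subseteq> {x \<in> V. q x \<in> U}" by blast
  qed
  then show ?thesis using q by (auto simp: cts_seminorm_def continuous_map_def)
qed

text \<open>The seminorm is the Minkowski functional of the balanced core \<open>W\<close> of a
  convex neighbourhood \<open>C\<close>. Local convexity is given by convex sets only; passing to
  the core makes the gauge homogeneous for all scalars, and joint continuity of scalar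
  multiplication at (0, 0) keeps the core a neighbourhood of 0.\<close>

lemma seminorm_nhds_0:
  assumes U: "openin T U" "0 \<in> U"
  shows "\<exists>q. cts_seminorm scl T q \<and> (\<forall>x\<in>V. q x < 1 \<longrightarrow> x \<in> U)"
proof -
  have "neighbourhood_base_at 0 (convex_wrt scl) T" using lcs by (simp add: locally_convex_space_def)
  from this[unfolded neighbourhood_base_at_def, rule_format, OF conjI, OF U]
  obtain G C where GC: "openin T G" "convex_wrt scl C" "0 \<in> G" "G \<subseteq> C" "C \<subseteq> U"
    by (elim exE conjE)
  define S :: "('k \<times> 'a) set" where "S = {z \<in> topspace (prod_topology euclidean T). (\<lambda>(c, x). scl c x) z \<in> G}"
  have S: "openin (prod_topology euclidean T) S"
    unfolding S_def by (rule openin_continuous_map_preimage[OF cont_scale GC(1)])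
  have "(0, 0) \<in> S" using GC(3) by (simp add: S_def)
  then have "\<exists>A B. openin euclidean A \<and> openin T B \<and> 0 \<in> A \<and> 0 \<in> B \<and> A \<times> B \<subseteq> S"
    by (rule S[unfolded openin_prod_topology_alt, rule_format])
  then obtain A B where "openin euclidean A" and AB: "openin T B" "0 \<in> A" "0 \<in> B" "A \<times> B \<subseteq> S"
    by blast
  then have "open A" "0 \<in> A" by simp_all
  then obtain d where d: "0 < d" "ball 0 d \<subseteq> A" using open_contains_ball by blast
  have small: "scl c x \<in> G" if "norm c < d" "x \<in> B" for c x
  proof -
    have "(c, x) \<in> A \<times> B" using that d(2) by auto
    then show ?thesis using AB(4) by (auto simp: S_def)
  qed
  define W where "W = {x \<in> V. \<forall>c. norm c \<le> 1 \<longrightarrow> scl c x \<in> C}"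
  \<comment> \<open>For a scalar c of modulus at most 1, c x equals (c d/2) applied to (2/d) x, and
    c d/2 has modulus below \<open>d\<close>. Hence \<open>B'\<close> lies in the core.\<close>
  define B' where "B' = {x \<in> V. scl (of_real (2 / d)) x \<in> B}"
  have "continuous_map T T (\<lambda>x. scl (of_real (2 / d)) x)"
    by (intro cont_scl) auto
  then have B'o: "openin T B'" unfolding B'_def using AB(1) by (rule openin_continuous_map_preimage)
  have B'0: "0 \<in> B'" using AB(3) by (simp add: B'_def)
  have B'W: "x \<in> W" if "x \<in> B'" for x
  proof -
    have "scl c x \<in> C" if "norm c \<le> 1" for c
    proof -
      have "norm c * (d / 2) \<le> 1 * (d / 2)" using that d(1) by (intro mult_right_mono) auto
      also have "\<dots> < d" using d(1) by simp
      finally have "norm (c * of_real (d / 2)) < d" using d(1) by (simp add: norm_mult)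
      then have "scl (c * of_real (d / 2)) (scl (of_real (2 / d)) x) \<in> G"
        using \<open>x \<in> B'\<close> unfolding B'_def by (intro small) simp_all
      moreover have "c * of_real (d / 2) * of_real (2 / d) = c"
        using d(1) by (simp flip: of_real_mult add: mult.assoc)
      ultimately show ?thesis using GC(4) by (auto simp: scale_scale)
    qed
    then show ?thesis using that by (auto simp: W_def B'_def)
  qed
  have Wbal: "scl c x \<in> W" if "x \<in> W" "norm c \<le> 1" for c x
  proof -
    have "norm (c' * c) \<le> 1" if "norm c' \<le> 1" for c'
      using mult_le_one[OF that norm_ge_zero \<open>norm c \<le> 1\<close>] by (simp add: norm_mult)
    then show ?thesis using that by (simp add: W_def)
  qed
  have Wconv: "scl (of_real u) x + scl (of_real v) y \<in> W"
    if "x \<in> W" "y \<in> W" "0 \<le> u" "0 \<le> v" "u + v = 1" for x y u v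
  proof -
    have "scl c (scl (of_real u) x + scl (of_real v) y) \<in> C" if "norm c \<le> 1" for c
    proof -
      have "scl (of_real u) (scl c x) + scl (of_real v) (scl c y) \<in> C"
        using GC(2) \<open>x \<in> W\<close> \<open>y \<in> W\<close> \<open>0 \<le> u\<close> \<open>0 \<le> v\<close> \<open>u + v = 1\<close> that
        unfolding convex_wrt_def W_def by blast
      then show ?thesis by (simp add: scale_right_distrib mult.commute)
    qed
    then show ?thesis using that by (auto simp: W_def)
  qed
  define R where "R x = {r. 0 < r \<and> scl (of_real (1 / r)) x \<in> W}" for x
  define q where "q x = Inf (R x)" for x
  have Rne: "R x \<noteq> {}" if "x \<in> V" for x
  proof -
    have "continuous_map euclidean T (\<lambda>c. scl c x)"
      using that by (intro cont_scl) auto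
    then have "open {c. scl c x \<in> B'}"
      using openin_continuous_map_preimage[of euclidean T _ B'] B'o by auto
    moreover have "0 \<in> {c. scl c x \<in> B'}" using B'0 by simp
    ultimately obtain e where e: "0 < e" "ball 0 e \<subseteq> {c. scl c x \<in> B'}"
      using open_contains_ball by blast
    have "(of_real (1 / (2 / e)) :: 'k) \<in> ball 0 e" using e(1) by simp
    then have "scl (of_real (1 / (2 / e))) x \<in> B'" using e(2) by blast
    then have "scl (of_real (1 / (2 / e))) x \<in> W" by (rule B'W)
    moreover have "0 < 2 / e" using e(1) by simp
    ultimately have "2 / e \<in> R x" unfolding R_def by (intro CollectI conjI)
    then show ?thesis by blast
  qed
  have Rbdd: "bdd_below (R x)" for x by (rule bdd_belowI[of _ 0]) (auto simp: R_def)
  have Rup: "s \<in> R x" if "r \<in> R x" "r \<le> s" for r s x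
  proof -
    have "scl (of_real (r / s)) (scl (of_real (1 / r)) x) \<in> W"
      by (rule Wbal) (use that in \<open>auto simp: R_def norm_divide\<close>)
    moreover have "r / s * (1 / r) = 1 / s" "0 < s" using that by (auto simp: R_def)
    ultimately show ?thesis unfolding R_def scale_scale of_real_mult[symmetric] by simp
  qed
  have qle: "q x \<le> r" if "r \<in> R x" for x r
    unfolding q_def using that Rbdd by (rule cInf_lower)
  have qex: "r \<in> R x" if "x \<in> V" "q x < r" for x r
    using cInf_lessD[OF Rne[OF that(1)]] that(2) Rup unfolding q_def by (meson less_imp_le)
  have q0: "0 \<le> q x" if "x \<in> V" for x
    unfolding q_def using Rne[OF that] by (rule cInf_greatest) (auto simp: R_def)
  have qadd: "q (x + y) \<le> q x + q y" if xy: "x \<in> V" "y \<in> V" for x y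
  proof (rule field_le_epsilon)
    fix e :: real assume e: "0 < e"
    define r where "r = q x + e / 2" define s where "s = q y + e / 2"
    have rs: "r \<in> R x" "s \<in> R y" using qex xy e by (auto simp: r_def s_def)
    then have pos: "0 < r" "0 < s" by (auto simp: R_def)
    have "scl (of_real (r / (r + s))) (scl (of_real (1 / r)) x) + scl (of_real (s / (r + s))) (scl (of_real (1 / s)) y) \<in> W"
      by (rule Wconv) (use rs pos in \<open>auto simp: R_def add_divide_distrib[symmetric]\<close>)
    moreover have "r / (r + s) * (1 / r) = 1 / (r + s)" "s / (r + s) * (1 / s) = 1 / (r + s)"
      using pos by auto
    ultimately have "scl (of_real (1 / (r + s))) (x + y) \<in> W"
      unfolding scale_scale of_real_mult[symmetric] scale_right_distrib by simp
    then have "r + s \<in> R (x + y)" using pos by (simp add: R_def)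
    then show "q (x + y) \<le> q x + q y + e" using qle by (fastforce simp: r_def s_def)
  qed
  have qscale_le: "q (scl c x) \<le> norm c * q x" if x: "x \<in> V" and c: "c \<noteq> 0" for c x
  proof (rule field_le_epsilon)
    fix e :: real assume e: "0 < e"
    define r where "r = q x + e / norm c"
    have r: "r \<in> R x" using qex x e c by (auto simp: r_def)
    have "scl (c / of_real (norm c)) (scl (of_real (1 / r)) x) \<in> W"
      by (rule Wbal) (use r c in \<open>auto simp: R_def norm_divide\<close>)
    moreover have "c / of_real (norm c) * of_real (1 / r) = of_real (1 / (norm c * r)) * c"
      by simp
    ultimately have "norm c * r \<in> R (scl c x)"
      using r c by (simp add: R_def scale_scale)
    then have "q (scl c x) \<le> norm c * r" by (rule qle)
    then show "q (scl c x) \<le> norm c * q x + e" using c by (simp add: r_def distrib_left)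
  qed
  have W0: "0 \<in> W" using B'W B'0 by blast
  have q00: "q 0 = 0"
  proof (rule antisym)
    show "q 0 \<le> 0"
    proof (rule field_le_epsilon)
      fix e :: real assume "0 < e"
      then have "e \<in> R 0" using W0 by (simp add: R_def)
      then show "q 0 \<le> 0 + e" using qle by simp
    qed
  qed (use q0 in simp)
  have qscale: "q (scl c x) = norm c * q x" if x: "x \<in> V" for c x
  proof (cases "c = 0")
    case False
    have "q (scl (1 / c) (scl c x)) \<le> norm (1 / c) * q (scl c x)"
      using x False by (intro qscale_le) auto
    then have "norm c * q x \<le> q (scl c x)"
      using False by (simp add: scale_scale norm_divide field_simps)
    then show ?thesis using qscale_le[OF x False] by simp
  qed (simp add: q00)
  have "cts_seminorm scl T q"
  proof (rule cts_seminormI[OF _ B'o B'0])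
    show "seminorm_on scl V q" using qadd qscale by (simp add: seminorm_on_def)
    show "q x \<le> 1" if "x \<in> B'" for x
      using B'W[OF that] by (intro qle) (simp add: R_def)
  qed
  moreover have "x \<in> U" if "x \<in> V" "q x < 1" for x
  proof -
    have "x \<in> W" using qex[OF that] by (simp add: R_def)
    then have "scl 1 x \<in> C" unfolding W_def by (metis (mono_tags, lifting) mem_Collect_eq norm_one order_refl)
    then show ?thesis using GC(5) by auto
  qed
  ultimately show ?thesis by blast
qed

lemma seminorm_nhds:
  assumes U: "openin T U" "x \<in> U"
  shows "\<exists>q. cts_seminorm scl T q \<and> (\<forall>y\<in>V. q (y - x) < 1 \<longrightarrow> y \<in> U)"
proof -
  have x: "x \<in> V" using openin_subset[OF U(1)] U(2) by blast
  have "openin T {y \<in> V. y + x \<in> U}"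
    by (rule openin_continuous_map_preimage[OF cont_translate[OF x] U(1)])
  then obtain q where "cts_seminorm scl T q" "\<forall>y\<in>V. q y < 1 \<longrightarrow> y \<in> {y \<in> V. y + x \<in> U}"
    using seminorm_nhds_0[of "{y \<in> V. y + x \<in> U}"] U x by auto
  then have "cts_seminorm scl T q" "\<And>y. y \<in> V \<Longrightarrow> q (y - x) < 1 \<Longrightarrow> y - x + x \<in> U" using x diff_V by blast+
  then show ?thesis by (intro exI[of _ q]) simp
qed

lemma cts_seminorm_scale:
  "cts_seminorm scl T q \<Longrightarrow> 0 \<le> a \<Longrightarrow> cts_seminorm scl T (\<lambda>x. a * q x)"
  unfolding cts_seminorm_def seminorm_on_def
  by (auto intro!: continuous_map_real_mult_left simp: mult_left_mono simp flip: distrib_left)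

lemma limitin_seminorm:
  assumes "limitin T f l F" "cts_seminorm scl T q" "\<And>n. f n \<in> V"
  shows "((\<lambda>n. q (f n - l)) \<longlongrightarrow> 0) F"
proof (rule order_tendstoI)
  have l: "l \<in> V" using assms(1) by (simp add: limitin_def)
  have q: "seminorm_on scl V q" using assms(2) by (simp add: cts_seminorm_def)
  fix a :: real assume "0 < a"
  then have "l \<in> {y \<in> V. q (y - l) < a}" using l q by (simp add: seminorm_0)
  then have "\<forall>\<^sub>F n in F. f n \<in> {y \<in> V. q (y - l) < a}"
    using assms(1) cts_seminorm_ball[OF assms(2) l, of a] unfolding limitin_def by blast
  then show "\<forall>\<^sub>F n in F. q (f n - l) < a" by eventually_elim simp
next
  have l: "l \<in> V" using assms(1) by (simp add: limitin_def)
  have q: "seminorm_on scl V q" using assms(2) by (simp add: cts_seminorm_def)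
  fix a :: real assume "a < 0"
  then show "\<forall>\<^sub>F n in F. a < q (f n - l)"
    using seminorm_nonneg[OF q] assms(3) l by (simp add: less_le_trans)
qed

lemma limitinI_seminorm:
  assumes "l \<in> V" "\<And>n. f n \<in> V" "\<And>q. cts_seminorm scl T q \<Longrightarrow> ((\<lambda>n. q (f n - l)) \<longlongrightarrow> 0) F"
  shows "limitin T f l F"
  unfolding limitin_def
proof (intro conjI allI impI assms(1))
  fix U assume "openin T U \<and> l \<in> U"
  then obtain q where q: "cts_seminorm scl T q" "\<forall>y\<in>V. q (y - l) < 1 \<longrightarrow> y \<in> U" using seminorm_nhds by blast
  have "\<forall>\<^sub>F n in F. q (f n - l) < 1" using order_tendstoD(2)[OF assms(3)[OF q(1)]] by simp
  then show "\<forall>\<^sub>F n in F. f n \<in> U" by eventually_elim (use q(2) assms(2) in blast)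
qed

lemma closure_of_seminorm:
  assumes "x \<in> T closure_of S" "cts_seminorm scl T q" "0 < e"
  shows "\<exists>s\<in>S \<inter> V. q (s - x) < e"
proof -
  have x: "x \<in> V" using assms(1) by (simp add: in_closure_of)
  have q: "seminorm_on scl V q" using assms(2) by (simp add: cts_seminorm_def)
  have "x \<in> {y \<in> V. q (y - x) < e}" using x assms(3) q by (simp add: seminorm_0)
  moreover have "\<forall>U. x \<in> U \<and> openin T U \<longrightarrow> (\<exists>y. y \<in> S \<and> y \<in> U)"
    using assms(1) by (simp add: in_closure_of)
  ultimately obtain y where "y \<in> S" "y \<in> {y \<in> V. q (y - x) < e}"
    using cts_seminorm_ball[OF assms(2) x, of e] by meson
  then show ?thesis by blast
qed

lemma closure_ofI_seminorm:
  assumes "x \<in> V" "S \<subseteq> V" "\<And>q. cts_seminorm scl T q \<Longrightarrow> \<exists>s\<in>S. q (s - x) < 1"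
  shows "x \<in> T closure_of S"
  unfolding in_closure_of
proof (intro conjI allI impI assms(1))
  fix U assume "x \<in> U \<and> openin T U"
  then obtain q where q: "cts_seminorm scl T q" "\<forall>y\<in>V. q (y - x) < 1 \<longrightarrow> y \<in> U" using seminorm_nhds by blast
  then show "\<exists>y. y \<in> S \<and> y \<in> U" using assms(2) assms(3)[OF q(1)] by blast
qed

section \<open>The Hahn-Banach theorem for seminorms\<close>

text \<open>The values off \<open>V\<close> are pinned to 0: left free, they could always be
  lowered, and no pointwise minimal functional would exist on a proper subspace.\<close>

definition sublinear :: "('a \<Rightarrow> real) \<Rightarrow> bool" where
  "sublinear s \<longleftrightarrow> (\<forall>x\<in>V. \<forall>y\<in>V. s (x + y) \<le> s x + s y) \<and>
     (\<forall>r\<ge>0. \<forall>x\<in>V. s (scl (of_real r) x) = r * s x) \<and> (\<forall>x. x \<notin> V \<longrightarrow> s x = 0)"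

lemma sublinearD:
  assumes "sublinear s"
  shows "x \<in> V \<Longrightarrow> y \<in> V \<Longrightarrow> s (x + y) \<le> s x + s y"
    and "0 \<le> r \<Longrightarrow> x \<in> V \<Longrightarrow> s (scl (of_real r) x) = r * s x"
    and "x \<notin> V \<Longrightarrow> s x = 0" and "s 0 = 0" and "x \<in> V \<Longrightarrow> - s (- x) \<le> s x"
proof -
  show 1: "x \<in> V \<Longrightarrow> y \<in> V \<Longrightarrow> s (x + y) \<le> s x + s y" for x y
    using assms by (simp add: sublinear_def)
  show 2: "0 \<le> r \<Longrightarrow> x \<in> V \<Longrightarrow> s (scl (of_real r) x) = r * s x" for r x
    using assms unfolding sublinear_def by blast
  show "x \<notin> V \<Longrightarrow> s x = 0" using assms by (simp add: sublinear_def)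
  show 0: "s 0 = 0" using 2[of 0 0] by simp
  show "x \<in> V \<Longrightarrow> - s (- x) \<le> s x" using 1[of x "- x"] 0 by simp
qed

text \<open>\<open>s\<close> is pushed down along \<open>y\<close> by taking the infimum of s (x + t
  y) - t s(y) over nonnegative t, which is bounded below by - s(- x). At x = - y the last clause
  yields - s(y) as an upper bound, so afterwards the direction \<open>y\<close> behaves
  linearly.\<close>

lemma sublinear_directional:
  assumes s: "sublinear s" and y: "y \<in> V"
  shows "\<exists>s'. sublinear s' \<and> (\<forall>x. s' x \<le> s x) \<and> (\<forall>x\<in>V. s' x \<le> s (x + y) - s y)"
proof -
  note S = sublinearD[OF s]
  define D where "D x = (\<lambda>t. s (x + scl (of_real t) y) - t * s y) ` {0..}" for x
  define s' where "s' x = (if x \<in> V then Inf (D x) else 0)" for x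
  have ne: "D x \<noteq> {}" for x by (auto simp: D_def)
  have bdd: "bdd_below (D x)" if "x \<in> V" for x
  proof (rule bdd_belowI)
    fix d assume "d \<in> D x"
    then obtain t where t: "0 \<le> t" "d = s (x + scl (of_real t) y) - t * s y" by (auto simp: D_def)
    have "s (scl (of_real t) y) \<le> s (x + scl (of_real t) y) + s (- x)"
      using S(1)[of "x + scl (of_real t) y" "- x"] that y by simp
    then show "- s (- x) \<le> d" using t S(2)[of t y] y by simp
  qed
  have le: "s' x \<le> s (x + scl (of_real t) y) - t * s y" if "x \<in> V" "0 \<le> t" for x t
    using that bdd by (auto simp: s'_def D_def intro!: cInf_lower)
  have ge: "a \<le> s' x" if "x \<in> V" "\<And>t. 0 \<le> t \<Longrightarrow> a \<le> s (x + scl (of_real t) y) - t * s y" for a x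
    using that ne[of x] by (auto simp: s'_def D_def intro!: cInf_greatest)
  have "s' (x + x') \<le> s' x + s' x'" if x: "x \<in> V" "x' \<in> V" for x x'
  proof -
    have "s' (x + x') - s' x' \<le> s (x + scl (of_real t) y) - t * s y" if t: "0 \<le> t" for t
    proof -
      have "s' (x + x') - (s (x + scl (of_real t) y) - t * s y) \<le> s (x' + scl (of_real t') y) - t' * s y" if t': "0 \<le> t'" for t'
      proof -
        have "s' (x + x') \<le> s (x + x' + scl (of_real (t + t')) y) - (t + t') * s y"
          using x t t' by (intro le) auto
        also have "x + x' + scl (of_real (t + t')) y = (x + scl (of_real t) y) + (x' + scl (of_real t') y)"
          by (simp add: scale_left_distrib algebra_simps)
        also have "s \<dots> \<le> s (x + scl (of_real t) y) + s (x' + scl (of_real t') y)"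
          using x y by (intro S(1)) auto
        finally show ?thesis by (simp add: algebra_simps)
      qed
      from ge[OF x(2) this] show ?thesis by simp
    qed
    from ge[OF x(1) this] show ?thesis by simp
  qed
  moreover have "s' (scl (of_real r) x) = r * s' x" if r: "0 \<le> r" and x: "x \<in> V" for r x
  proof (cases "r = 0")
    case True
    have "s' 0 = 0" using le[of 0 0] ge[of 0 0] S(2)[OF _ y] S(4) by fastforce
    then show ?thesis using True by simp
  next
    case False
    then have r: "0 < r" using r by simp
    have eq: "s (scl (of_real r) x + scl (of_real (r * t)) y) - r * t * s y = r * (s (x + scl (of_real t) y) - t * s y)" for t
    proof -
      have "scl (of_real r) x + scl (of_real (r * t)) y = scl (of_real r) (x + scl (of_real t) y)"
        by (simp add: scale_right_distrib)
      then show ?thesis using S(2)[of r "x + scl (of_real t) y"] x y r by (simp add: right_diff_distrib)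
    qed
    have "s' (scl (of_real r) x) / r \<le> s' x"
    proof (rule ge[OF x])
      fix t :: real assume t: "0 \<le> t"
      have "s' (scl (of_real r) x) \<le> s (scl (of_real r) x + scl (of_real (r * t)) y) - r * t * s y"
        using x r t by (intro le) auto
      then show "s' (scl (of_real r) x) / r \<le> s (x + scl (of_real t) y) - t * s y"
        unfolding eq using r by (simp add: pos_divide_le_eq mult.commute)
    qed
    moreover have "r * s' x \<le> s' (scl (of_real r) x)"
    proof (rule ge)
      fix t :: real assume t: "0 \<le> t"
      have "s' x \<le> s (x + scl (of_real (t / r)) y) - t / r * s y" using x r t by (intro le) auto
      then have "r * s' x \<le> r * (s (x + scl (of_real (t / r)) y) - t / r * s y)" using r by (intro mult_left_mono) auto
      then show "r * s' x \<le> s (scl (of_real r) x + scl (of_real t) y) - t * s y"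
        unfolding eq[symmetric] using r by simp
    qed (use x in simp)
    ultimately show ?thesis using r by (simp add: pos_divide_le_eq mult.commute)
  qed
  moreover have "s' x = 0" if "x \<notin> V" for x using that by (simp add: s'_def)
  ultimately have "sublinear s'" unfolding sublinear_def by blast
  moreover have "s' x \<le> s x" for x
    using le[of x 0] S(3)[of x] by (cases "x \<in> V") (auto simp: s'_def)
  moreover have "s' x \<le> s (x + y) - s y" if "x \<in> V" for x
    using le[OF that, of 1] by simp
  ultimately show ?thesis by blast
qed

text \<open>A minimal sublinear functional coincides with all its directional modifications, hence is linear.\<close>

lemma sublinear_minimal:
  assumes p: "sublinear p"
  shows "\<exists>s. sublinear s \<and> (\<forall>x. s x \<le> p x) \<and> (\<forall>s'. sublinear s' \<and> (\<forall>x. s' x \<le> s x) \<longrightarrow> s' = s)"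
proof -
  define A where "A = {s. sublinear s \<and> (\<forall>x. s x \<le> p x)}"
  define P where "P s s' \<longleftrightarrow> (\<forall>x. s' x \<le> (s x :: real))" for s s' :: "'a \<Rightarrow> real"
  have "\<exists>m\<in>A. \<forall>a\<in>A. P m a \<longrightarrow> a = m"
  proof (rule predicate_Zorn)
    show "partial_order_on A (relation_of P A)"
      by (rule partial_order_on_relation_ofI) (auto simp: P_def fun_eq_iff intro: order_trans antisym)
  next
    fix C assume C: "C \<in> Chains (relation_of P A)"
    have CA: "C \<subseteq> A" by (rule Chains_relation_of[OF C])
    have tot: "(\<forall>x. s' x \<le> s x) \<or> (\<forall>x. s x \<le> s' x)" if "s \<in> C" "s' \<in> C" for s s'
      using C that by (auto simp: Chains_def relation_of_def P_def)
    show "\<exists>u\<in>A. \<forall>a\<in>C. P a u"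
    proof (cases "C = {}")
      case True
      then show ?thesis using p by (auto simp: A_def)
    next
      case ne: False
      define u where "u x = Inf ((\<lambda>s. s x) ` C)" for x
      have lin: "sublinear s" "s x \<le> p x" if "s \<in> C" for s x using that CA by (auto simp: A_def)
      \<comment> \<open>A lower bound common to the whole chain, which makes its pointwise infimum
        finite.\<close>
      have lb: "- p (- x) \<le> s x" if "s \<in> C" for s x
      proof (cases "x \<in> V")
        case True
        then show ?thesis using sublinearD(5)[OF lin(1)[OF that] True] lin(2)[OF that, of "- x"] by simp
      next
        case False
        then have "- x \<notin> V" using neg_V by fastforce
        then show ?thesis using False sublinearD(3)[OF lin(1)[OF that]] sublinearD(3)[OF p] by simp
      qed
      have le: "u x \<le> s x" if "s \<in> C" for s x
        unfolding u_def using that lb by (intro cInf_lower bdd_belowI[of _ "- p (- x)"]) auto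
      have ge: "a \<le> u x" if "\<And>s. s \<in> C \<Longrightarrow> a \<le> s x" for a x
        unfolding u_def using that ne by (intro cInf_greatest) auto
      have "u (x + y) \<le> u x + u y" if xy: "x \<in> V" "y \<in> V" for x y
      proof -
        have "u (x + y) - s' y \<le> u x" if s': "s' \<in> C" for s'
        proof (rule ge)
          fix s assume s: "s \<in> C"
          \<comment> \<open>Subadditivity of the infimum needs a single functional that is good at
            both points; totality of the chain provides it.\<close>
          obtain r where r: "r \<in> C" "\<forall>x. r x \<le> s x" "\<forall>x. r x \<le> s' x"
            using tot[OF s s'] s s' by blast
          have "u (x + y) \<le> r x + r y"
            using le[OF r(1)] sublinearD(1)[OF lin(1)[OF r(1)] xy] by (meson order_trans)
          also have "\<dots> \<le> s x + s' y" using r by (intro add_mono) auto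
          finally show "u (x + y) - s' y \<le> s x" by simp
        qed
        then have "u (x + y) - u x \<le> s' y" if "s' \<in> C" for s' using that by (simp add: algebra_simps)
        then have "u (x + y) - u x \<le> u y" by (rule ge)
        then show ?thesis by simp
      qed
      moreover have "u (scl (of_real r) x) = r * u x" if r: "0 \<le> r" and x: "x \<in> V" for r x
      proof (rule antisym)
        show "r * u x \<le> u (scl (of_real r) x)"
        proof (rule ge)
          fix s assume s: "s \<in> C"
          show "r * u x \<le> s (scl (of_real r) x)"
            using sublinearD(2)[OF lin(1)[OF s] r x] le[OF s] r by (simp add: mult_left_mono)
        qed
        show "u (scl (of_real r) x) \<le> r * u x"
        proof (cases "r = 0")
          case True
          obtain s where "s \<in> C" using ne by blast
          then show ?thesis using le[of s 0] sublinearD(4)[OF lin(1), of s] True by simp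
        next
          case False
          then have r: "0 < r" using r by simp
          have "u (scl (of_real r) x) / r \<le> u x"
          proof (rule ge)
            fix s assume s: "s \<in> C"
            have "u (scl (of_real r) x) \<le> r * s x"
              using sublinearD(2)[OF lin(1)[OF s], of r x] x r le[OF s, of "scl (of_real r) x"] by simp
            then show "u (scl (of_real r) x) / r \<le> s x" using r by (simp add: pos_divide_le_eq mult.commute)
          qed
          then show ?thesis using r by (simp add: pos_divide_le_eq mult.commute)
        qed
      qed
      moreover have "u x = 0" if "x \<notin> V" for x
      proof -
        have "(\<lambda>s. s x) ` C = (\<lambda>_. 0) ` C"
          using sublinearD(3)[OF lin(1) that] by (intro image_cong) auto
        then show ?thesis using ne by (simp add: u_def image_constant_conv)
      qed
      ultimately have "sublinear u" unfolding sublinear_def by blast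
      moreover have "u x \<le> p x" for x
        using ne le lin(2) by (meson all_not_in_conv order_trans)
      ultimately show ?thesis using le by (auto simp: A_def P_def)
    qed
  qed
  then obtain s where s: "s \<in> A" "\<And>s'. s' \<in> A \<Longrightarrow> P s s' \<Longrightarrow> s' = s" by blast
  have "s' = s" if "sublinear s'" "\<forall>x. s' x \<le> s x" for s'
  proof (rule s(2))
    have "s' x \<le> p x" for x
      using order_trans[OF that(2)[rule_format, of x]] s(1) unfolding A_def by blast
    then show "s' \<in> A" using that by (simp add: A_def)
    show "P s s'" using that by (simp add: P_def)
  qed
  then show ?thesis using s(1) by (intro exI[of _ s]) (auto simp: A_def)
qed

text \<open>Instead of extending from a line, \<open>p\<close> is first pushed down along
  \<open>z\<close> and then replaced by a minimal sublinear functional below. Minimality against its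
  own directional modifications makes it additive, and the first push forces the value at
  \<open>- z\<close> down to \<open>- p z\<close>.\<close>

lemma Hahn_Banach_real:
  assumes p: "sublinear p" and z: "z \<in> V"
  shows "\<exists>g. (\<forall>x\<in>V. \<forall>y\<in>V. g (x + y) = g x + g y) \<and> (\<forall>r. \<forall>x\<in>V. g (scl (of_real r) x) = r * g x) \<and>
    (\<forall>x\<in>V. g x \<le> p x) \<and> p z \<le> g z"
proof -
  obtain p' where p': "sublinear p'" "\<And>x. p' x \<le> p x" "\<And>x. x \<in> V \<Longrightarrow> p' x \<le> p (x + z) - p z"
    using sublinear_directional[OF p z] by blast
  obtain g where g: "sublinear g" "\<And>x. g x \<le> p' x" "\<And>s'. sublinear s' \<Longrightarrow> (\<forall>x. s' x \<le> g x) \<Longrightarrow> s' = g"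
    using sublinear_minimal[OF p'(1)] by blast
  note G = sublinearD[OF g(1)]
  have add: "g (x + y) = g x + g y" if xy: "x \<in> V" "y \<in> V" for x y
  proof -
    obtain s' where s': "sublinear s'" "\<forall>x. s' x \<le> g x" "\<forall>x\<in>V. s' x \<le> g (x + y) - g y"
      using sublinear_directional[OF g(1) xy(2)] by blast
    then have "g x \<le> g (x + y) - g y" using g(3) xy by blast
    then show ?thesis using G(1)[OF xy] by simp
  qed
  have neg: "g (- x) = - g x" if "x \<in> V" for x
    using add[OF that neg_V[OF that]] G(4) by simp
  have "g (scl (of_real r) x) = r * g x" if "x \<in> V" for r x
  proof (cases "0 \<le> r")
    case False
    then have "g (- scl (of_real r) x) = - r * g x" using G(2)[of "- r" x] that by simp
    then show ?thesis using neg[of "scl (of_real r) x"] that by simp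
  qed (use G(2) that in blast)
  moreover have "g x \<le> p x" for x using g(2) p'(2) by (rule order_trans)
  moreover have "p z \<le> g z"
  proof -
    have "g (- z) \<le> p (- z + z) - p z" using g(2) p'(3) z by (meson neg_V order_trans)
    then show ?thesis using neg[OF z] sublinearD(4)[OF p] by simp
  qed
  ultimately show ?thesis using add by blast
qed

text \<open>In the complex case the real functional \<open>g\<close> is complexified as g(x) - i g(i
  x). The factor 2 is the crude triangle estimate of this expression; domination up to a constant
  and a nonzero value at \<open>z\<close> are all that the biorthogonal construction asks
  for.\<close>

lemma Hahn_Banach_seminorm:
  assumes p: "seminorm_on scl V p" and z: "z \<in> V"
  shows "\<exists>f. linear_between scl (*) V f \<and> (\<forall>x\<in>V. norm (f x) \<le> 2 * p x) \<and> (0 < p z \<longrightarrow> f z \<noteq> 0)"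
proof -
  define p' where "p' x = (if x \<in> V then p x else 0)" for x
  have "sublinear p'"
    using seminorm_add[OF p] seminorm_scale[OF p] by (simp add: sublinear_def p'_def)
  from Hahn_Banach_real[OF this z] obtain g where
    g: "\<forall>x\<in>V. \<forall>y\<in>V. g (x + y) = g x + g y" "\<forall>r. \<forall>x\<in>V. g (scl (of_real r) x) = r * g x"
      "\<forall>x\<in>V. g x \<le> p' x" and "p' z \<le> g z"
    by (elim exE conjE)
  then have gz: "p z \<le> g z" using z by (simp add: p'_def)
  have add: "g (x + y) = g x + g y" if "x \<in> V" "y \<in> V" for x y using g(1) that by blast
  have scale: "g (scl (of_real r) x) = r * g x" if "x \<in> V" for r x using g(2) that by blast
  have le: "g x \<le> p x" if "x \<in> V" for x using g(3) that by (simp add: p'_def)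
  have abs: "\<bar>g x\<bar> \<le> p x" if "x \<in> V" for x
    using le[OF that] le[OF neg_V[OF that]] scale[OF that, of "- 1"] seminorm_neg[OF p that] by simp
  consider "\<forall>x::'k. \<exists>a. x = a *\<^sub>R 1"
    | i :: 'k where "i * i = - 1" "\<forall>x. \<exists>a b. x = a *\<^sub>R 1 + b *\<^sub>R i"
    using real_or_complex by blast
  then show ?thesis
  proof cases
    case 1
    have "linear_between scl (*) V (\<lambda>x. of_real (g x))"
      unfolding linear_between_def
    proof (intro conjI ballI allI)
      fix c :: 'k and x assume "x \<in> V"
      obtain a where "c = a *\<^sub>R 1" using 1 by blast
      then have "c = of_real a" by (simp add: of_real_def)
      then show "of_real (g (scl c x)) = c * of_real (g x)" using scale[OF \<open>x \<in> V\<close>] by simp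
    qed (simp add: add)
    moreover have "norm (of_real (g x) :: 'k) \<le> 2 * p x" if "x \<in> V" for x
      using abs[OF that] by simp
    ultimately show ?thesis using gz by (intro exI[of _ "\<lambda>x. of_real (g x)"]) auto
  next
    case (2 i)
    define f where "f x = of_real (g x) - i * of_real (g (scl i x))" for x
    have ni: "norm i = 1" by (rule real_or_complex_norm_unit[OF 2(1)])
    have ii: "scl i (scl i x) = - x" for x using 2(1) by (simp add: scale_scale)
    have fadd: "f (x + y) = f x + f y" if "x \<in> V" "y \<in> V" for x y
      using that by (simp add: f_def add scale_right_distrib algebra_simps)
    have fr: "f (scl (of_real a) x) = of_real a * f x" if "x \<in> V" for a x
    proof -
      have "scl i (scl (of_real a) x) = scl (of_real a) (scl i x)" by (simp add: mult.commute)
      then show ?thesis using that by (simp add: f_def scale right_diff_distrib mult.left_commute del: scale_scale)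
    qed
    have fi: "f (scl i x) = i * f x" if "x \<in> V" for x
    proof -
      have "g (- x) = - g x" using scale[OF that, of "- 1"] by simp
      then show ?thesis unfolding f_def ii
        using 2(1) by (simp add: right_diff_distrib mult.assoc[symmetric])
    qed
    have "f (scl c x) = c * f x" if "x \<in> V" for c x
    proof -
      obtain a b where "c = a *\<^sub>R 1 + b *\<^sub>R i" using 2(2) by blast
      then have c: "c = of_real a + of_real b * i" by (simp add: scaleR_conv_of_real)
      have "scl c x = scl (of_real a) x + scl (of_real b) (scl i x)"
        by (simp add: c scale_left_distrib)
      then have "f (scl c x) = of_real a * f x + of_real b * (i * f x)"
        using that by (simp add: fadd fr fi del: scale_scale)
      then show ?thesis by (simp add: c algebra_simps)
    qed
    then have "linear_between scl (*) V f" using fadd by (simp add: linear_between_def)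
    moreover have "norm (f x) \<le> 2 * p x" if "x \<in> V" for x
    proof -
      have "norm (f x) \<le> \<bar>g x\<bar> + \<bar>g (scl i x)\<bar>"
        unfolding f_def by (rule order_trans[OF norm_triangle_ineq4]) (simp add: norm_mult ni)
      also have "\<dots> \<le> p x + p (scl i x)" using that by (intro add_mono abs) auto
      finally show ?thesis using seminorm_scale[OF p that] ni by simp
    qed
    moreover have "f z \<noteq> 0" if "0 < p z"
    proof
      assume "f z = 0"
      moreover have "f z = g z *\<^sub>R 1 + (- g (scl i z)) *\<^sub>R i" by (simp add: f_def scaleR_conv_of_real mult.commute)
      ultimately have "(\<bar>g z\<bar> + \<bar>- g (scl i z)\<bar>) / 2 \<le> 0"
        using real_or_complex_norm_ge[OF 2(1), of "g z" "- g (scl i z)"] by simp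
      then show False using gz that by simp
    qed
    ultimately show ?thesis by blast
  qed
qed

section \<open>Biorthogonal systems\<close>

abbreviation functional :: "('a \<Rightarrow> 'k) \<Rightarrow> bool" where
  "functional \<equiv> linear_between scl (*) V"

lemma functionalD:
  assumes "functional f"
  shows "x \<in> V \<Longrightarrow> y \<in> V \<Longrightarrow> f (x + y) = f x + f y"
    and "x \<in> V \<Longrightarrow> f (scl c x) = c * f x"
    and "f 0 = 0"
    and "x \<in> V \<Longrightarrow> y \<in> V \<Longrightarrow> f (x - y) = f x - f y"
proof -
  show 1: "x \<in> V \<Longrightarrow> y \<in> V \<Longrightarrow> f (x + y) = f x + f y" for x y
    using assms by (simp add: linear_between_def)
  show 2: "x \<in> V \<Longrightarrow> f (scl c x) = c * f x" for x c
    using assms by (simp add: linear_between_def)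
  show "f 0 = 0" using 2[of 0 0] by simp
  show "x \<in> V \<Longrightarrow> y \<in> V \<Longrightarrow> f (x - y) = f x - f y"
    using 1[of x "- y"] 2[of y "- 1"] by simp
qed

lemma functional_sum:
  assumes f: "functional f" and "finite A" "\<And>i. i \<in> A \<Longrightarrow> u i \<in> V"
  shows "f (sum u A) = (\<Sum>i\<in>A. f (u i))"
  using assms(2,3)
proof (induction A rule: finite_induct)
  case (insert i A)
  then have "f (u i + sum u A) = f (u i) + f (sum u A)" by (intro functionalD(1)[OF f]) auto
  then show ?case using insert by simp
qed (simp add: functionalD(3)[OF f])

lemma functional_continuous:
  assumes f: "functional f" and p: "cts_seminorm scl T p" and le: "\<And>x. x \<in> V \<Longrightarrow> norm (f x) \<le> C * p x"
  shows "continuous_map T euclidean f"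
proof -
  have q: "cts_seminorm scl T (\<lambda>x. \<bar>C\<bar> * p x)" by (rule cts_seminorm_scale[OF p]) simp
  have p0: "0 \<le> p x" if "x \<in> V" for x using p that seminorm_nonneg by (simp add: cts_seminorm_def)
  have "openin T {x \<in> V. f x \<in> U}" if "open U" for U
  proof (subst openin_subopen, intro ballI)
    fix x assume x: "x \<in> {x \<in> V. f x \<in> U}"
    then obtain r where r: "0 < r" "ball (f x) r \<subseteq> U" using \<open>open U\<close> open_contains_ball by blast
    have "{y \<in> V. \<bar>C\<bar> * p (y - x) < r} \<subseteq> {x \<in> V. f x \<in> U}"
    proof
      fix y assume y: "y \<in> {y \<in> V. \<bar>C\<bar> * p (y - x) < r}"
      have "norm (f (y - x)) \<le> C * p (y - x)" using x y by (intro le) auto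
      also have "\<dots> \<le> \<bar>C\<bar> * p (y - x)" using x y p0 by (intro mult_right_mono) auto
      also have "\<dots> < r" using y by simp
      finally have "dist (f x) (f y) < r"
        using x y by (simp add: functionalD(4)[OF f] dist_norm norm_minus_commute)
      then show "y \<in> {x \<in> V. f x \<in> U}" using r(2) y by auto
    qed
    moreover have "openin T {y \<in> V. \<bar>C\<bar> * p (y - x) < r}"
      using cts_seminorm_ball[OF q] x by blast
    moreover have "x \<in> {y \<in> V. \<bar>C\<bar> * p (y - x) < r}"
      using x r seminorm_0[of p] p by (simp add: cts_seminorm_def)
    ultimately show "\<exists>N. openin T N \<and> x \<in> N \<and> N \<subseteq> {x \<in> V. f x \<in> U}" by blast
  qed
  then show ?thesis by (simp add: continuous_map_def)
qed

text \<open>If every continuous seminorm were dominated by a finite weighted sum of moduli of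
  continuous functionals, then the space of all continuous functionals, which separates points by
  Hahn-Banach, would already generate the topology.\<close>

lemma not_weak_seminorm:
  assumes "\<not> has_weak_topology scl T"
  shows "\<exists>p. cts_seminorm scl T p \<and> (\<forall>(n::nat) f c.
    (\<forall>i<n. functional (f i) \<and> continuous_map T euclidean (f i)) \<longrightarrow>
    (\<exists>x\<in>V. (\<Sum>i<n. c i * norm (f i x)) < p x))"
proof (rule ccontr)
  assume neg: "\<not> ?thesis"
  define Y where "Y = {f. functional f \<and> continuous_map T euclidean f}"
  have dom: "\<exists>(n::nat) f c. (\<forall>i<n. f i \<in> Y) \<and> (\<forall>x\<in>V. p x \<le> (\<Sum>i<n. c i * norm (f i x)))"
    if "cts_seminorm scl T p" for p
    using neg that unfolding Y_def by (simp add: not_less)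
  have "functional_space scl V Y"
    unfolding functional_space_def Y_def
    by (auto simp: linear_between_def algebra_simps intro!: continuous_map_add
        intro: continuous_map_compose[of T euclidean _ euclidean "\<lambda>z. c * z" for c, unfolded comp_def]
        continuous_intros)
  moreover have "separates_points Y V"
    unfolding separates_points_def
  proof (intro ballI impI)
    fix x y assume xy: "x \<in> V" "y \<in> V" "x \<noteq> y"
    obtain U U' where U: "openin T U" "x \<in> U" "y \<notin> U"
      using Hausdorff xy unfolding Hausdorff_space_def disjnt_iff by metis
    obtain q where q: "cts_seminorm scl T q" "\<forall>y\<in>V. q (y - x) < 1 \<longrightarrow> y \<in> U"
      using seminorm_nhds[OF U(1,2)] by blast
    have sn: "seminorm_on scl V q" using q(1) by (simp add: cts_seminorm_def)
    have pos: "0 < q (y - x)" using q(2) xy U(3) by force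
    obtain f where f: "functional f" "\<forall>x\<in>V. norm (f x) \<le> 2 * q x" "f (y - x) \<noteq> 0"
      using Hahn_Banach_seminorm[OF sn, of "y - x"] xy pos by auto
    have "f \<in> Y" using f(1,2) functional_continuous[OF f(1) q(1), of 2] by (simp add: Y_def)
    moreover have "f x \<noteq> f y" using f(3) functionalD(4)[OF f(1)] xy by auto
    ultimately show "\<exists>f\<in>Y. f x \<noteq> f y" by blast
  qed
  moreover have "coarser T T'" if T': "topspace T' = V" "\<forall>f\<in>Y. continuous_map T' euclidean f" for T'
    unfolding coarser_def
  proof (intro conjI allI impI)
    fix U assume U: "openin T U"
    show "openin T' U"
    proof (subst openin_subopen, intro ballI)
      fix x assume x: "x \<in> U"
      then have xV: "x \<in> V" using openin_subset[OF U] by blast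
      obtain p where p: "cts_seminorm scl T p" "\<forall>y\<in>V. p (y - x) < 1 \<longrightarrow> y \<in> U"
        using seminorm_nhds[OF U x] by blast
      obtain n :: nat and f c where f: "\<forall>i<n. f i \<in> Y" "\<forall>x\<in>V. p x \<le> (\<Sum>i<n. c i * norm (f i x))"
        using dom[OF p(1)] by blast
      define h where "h y = (\<Sum>i<n. c i * norm (f i y - f i x))" for y
      have "continuous_map T' euclideanreal (\<lambda>y. c i * norm (f i y - f i x))" if "i < n" for i
        using T'(2) f(1) that by (intro continuous_intros) auto
      then have h: "continuous_map T' euclideanreal h"
        unfolding h_def by (intro continuous_map_sum) auto
      have "openin T' {y \<in> V. h y \<in> {..<1}}"
        using openin_continuous_map_preimage[OF h, of "{..<1}"] T'(1) by simp
      moreover have "x \<in> {y \<in> V. h y \<in> {..<1}}" using xV by (simp add: h_def)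
      moreover have "{y \<in> V. h y \<in> {..<1}} \<subseteq> U"
      proof
        fix y assume y: "y \<in> {y \<in> V. h y \<in> {..<1}}"
        have "p (y - x) \<le> (\<Sum>i<n. c i * norm (f i (y - x)))" using f(2) y xV by simp
        also have "\<dots> = h y"
          unfolding h_def
        proof (intro sum.cong refl)
          fix i assume "i \<in> {..<n}"
          then have "functional (f i)" using f(1) by (simp add: Y_def)
          then show "c i * norm (f i (y - x)) = c i * norm (f i y - f i x)"
            using functionalD(4) y xV by simp
        qed
        finally show "y \<in> U" using p(2) y by simp
      qed
      ultimately show "\<exists>N. openin T' N \<and> x \<in> N \<and> N \<subseteq> U" by blast
    qed
  qed (use T' in simp)
  moreover have "\<forall>f\<in>Y. continuous_map T euclidean f" by (simp add: Y_def)
  ultimately have "has_weak_topology scl T" unfolding has_weak_topology_def by blast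
  then show False using assms by blast
qed

text \<open>\<open>\<Phi> a\<close> stands for the sum of the series with terms \<open>scl (a n) (x n)\<close>; only its values at
  absolutely summable \<open>a\<close> matter.\<close>

definition l1_map :: "(nat \<Rightarrow> 'a) \<Rightarrow> ((nat \<Rightarrow> 'k) \<Rightarrow> 'a) \<Rightarrow> bool" where
  "l1_map x \<Phi> \<longleftrightarrow> (\<forall>a. l1 a \<longrightarrow> \<Phi> a \<in> V) \<and>
     (\<forall>a b. l1 a \<longrightarrow> l1 b \<longrightarrow> \<Phi> (\<lambda>n. a n + b n) = \<Phi> a + \<Phi> b) \<and>
     (\<forall>c a. l1 a \<longrightarrow> \<Phi> (\<lambda>n. c * a n) = scl c (\<Phi> a)) \<and>
     (\<forall>i. \<Phi> (\<lambda>n. if n = i then 1 else 0) = x i) \<and>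
     (\<forall>q. cts_seminorm scl T q \<longrightarrow> (\<exists>C\<ge>0. \<forall>a. l1 a \<longrightarrow> q (\<Phi> a) \<le> C * l1_norm a))"

text \<open>The chosen limits depend linearly on the coefficients because limits in a Hausdorff
  space are unique. The estimate holds because \<open>q (x n)\<close> tends to 0 and is therefore
  bounded: its bound serves all partial sums and passes to the limit.\<close>

lemma l1_sequence_l1_map:
  assumes "l1_sequence scl T x"
  shows "\<exists>\<Phi>. l1_map x \<Phi>"
proof -
  have xV: "x n \<in> V" for n using assms by (auto simp: l1_sequence_def)
  have x0: "limitin T x 0 sequentially" using assms by (simp add: l1_sequence_def)
  define S where "S a N = (\<Sum>n<N. scl (a n) (x n))" for a N
  define \<Phi> where "\<Phi> a = (SOME s. limitin T (S a) s sequentially)" for a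
  have SV: "S a N \<in> V" for a N using xV by (simp add: S_def)
  have lim: "limitin T (S a) (\<Phi> a) sequentially" if "l1 a" for a
  proof -
    have "S a = (\<lambda>N. \<Sum>n<N. scl (a n) (x n))" by (simp add: S_def fun_eq_iff)
    then have "\<exists>s. limitin T (S a) s sequentially" using assms that by (simp add: l1_sequence_def)
    then show ?thesis unfolding \<Phi>_def by (rule someI_ex)
  qed
  have \<Phi>V: "\<Phi> a \<in> V" if "l1 a" for a using lim[OF that] by (simp add: limitin_def)
  have uniq: "\<Phi> a = s" if "l1 a" "limitin T (S a) s sequentially" for a s
    using limitin_Hausdorff_unique[OF lim[OF that(1)] that(2) _ Hausdorff] by simp
  have "\<Phi> (\<lambda>n. a n + b n) = \<Phi> a + \<Phi> b" if ab: "l1 a" "l1 b" for a b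
  proof (rule uniq[OF l1_add[OF ab]], rule limitinI_seminorm)
    fix q assume q: "cts_seminorm scl T q"
    then have sn: "seminorm_on scl V q" by (simp add: cts_seminorm_def)
    have L: "(\<lambda>N. q (S a N - \<Phi> a) + q (S b N - \<Phi> b)) \<longlonglongrightarrow> 0 + 0"
      using ab q SV by (intro tendsto_add limitin_seminorm lim)
    have ub: "q (S (\<lambda>n. a n + b n) N - (\<Phi> a + \<Phi> b)) \<le> q (S a N - \<Phi> a) + q (S b N - \<Phi> b)" for N
    proof -
      have "S (\<lambda>n. a n + b n) N - (\<Phi> a + \<Phi> b) = (S a N - \<Phi> a) + (S b N - \<Phi> b)"
        by (simp add: S_def scale_left_distrib sum.distrib)
      also have "q \<dots> \<le> q (S a N - \<Phi> a) + q (S b N - \<Phi> b)"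
        using SV \<Phi>V ab by (intro seminorm_add[OF sn]) auto
      finally show ?thesis .
    qed
    have lb: "0 \<le> q (S (\<lambda>n. a n + b n) N - (\<Phi> a + \<Phi> b))" for N
      using SV \<Phi>V ab by (intro seminorm_nonneg[OF sn]) auto
    show "(\<lambda>N. q (S (\<lambda>n. a n + b n) N - (\<Phi> a + \<Phi> b))) \<longlonglongrightarrow> 0"
      by (rule Lim_null_comparison[OF always_eventually L[simplified]]) (use lb ub in simp)
  qed (use SV \<Phi>V ab in auto)
  moreover have "\<Phi> (\<lambda>n. c * a n) = scl c (\<Phi> a)" if a: "l1 a" for c a
  proof (rule uniq[OF l1_mult[OF a]], rule limitinI_seminorm)
    fix q assume q: "cts_seminorm scl T q"
    then have sn: "seminorm_on scl V q" by (simp add: cts_seminorm_def)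
    have "q (S (\<lambda>n. c * a n) N - scl c (\<Phi> a)) = norm c * q (S a N - \<Phi> a)" for N
    proof -
      have "S (\<lambda>n. c * a n) N - scl c (\<Phi> a) = scl c (S a N - \<Phi> a)"
        by (simp add: S_def scale_right_diff_distrib scale_sum_right)
      then show ?thesis using seminorm_scale[OF sn, of "S a N - \<Phi> a"] SV \<Phi>V a by simp
    qed
    then show "(\<lambda>N. q (S (\<lambda>n. c * a n) N - scl c (\<Phi> a))) \<longlonglongrightarrow> 0"
      using limitin_seminorm[OF lim[OF a] q SV] by (simp add: tendsto_mult_right_zero)
  qed (use SV \<Phi>V a in auto)
  moreover have "\<Phi> (\<lambda>n. if n = i then 1 else 0) = x i" for i
  proof (rule uniq, rule l1_finite, simp, rule limitinI_seminorm)
    fix q assume "cts_seminorm scl T q"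
    then have q0: "q 0 = 0" using seminorm_0 by (simp add: cts_seminorm_def)
    have *: "S (\<lambda>n. if n = i then 1 else 0) N = x i" if "i < N" for N
    proof -
      have "S (\<lambda>n. if n = i then 1 else 0) N = (\<Sum>n<N. if n = i then x n else 0)"
        unfolding S_def by (intro sum.cong) auto
      then show ?thesis using that by simp
    qed
    have "\<forall>\<^sub>F N in sequentially. q (S (\<lambda>n. if n = i then 1 else 0) N - x i) = 0"
      by (rule eventually_mono[OF eventually_gt_at_top[of i]]) (simp add: q0 *)
    then show "(\<lambda>N. q (S (\<lambda>n. if n = i then 1 else 0) N - x i)) \<longlonglongrightarrow> 0" by (rule tendsto_eventually)
  qed (use SV xV in auto)
  moreover have "\<exists>C\<ge>0. \<forall>a. l1 a \<longrightarrow> q (\<Phi> a) \<le> C * l1_norm a" if q: "cts_seminorm scl T q" for q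
  proof -
    have sn: "seminorm_on scl V q" using q by (simp add: cts_seminorm_def)
    have "(\<lambda>n. q (x n)) \<longlonglongrightarrow> 0" using limitin_seminorm[OF x0 q xV] by simp
    then have "Bseq (\<lambda>n. q (x n))" by (intro convergent_imp_Bseq) (auto simp: convergent_def)
    then obtain C where C: "0 < C" "\<And>n. norm (q (x n)) \<le> C" unfolding Bseq_def by blast
    have "q (\<Phi> a) \<le> C * l1_norm a" if a: "l1 a" for a
    proof (rule field_le_epsilon)
      fix e :: real assume "0 < e"
      then obtain N where N: "q (S a N - \<Phi> a) < e"
        using order_tendstoD(2)[OF limitin_seminorm[OF lim[OF a] q SV], of e]
          eventually_happens'[OF sequentially_bot] by blast
      have "q (S a N) \<le> (\<Sum>n<N. q (scl (a n) (x n)))"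
        unfolding S_def using xV by (intro seminorm_sum[OF sn]) auto
      also have "\<dots> = (\<Sum>n<N. norm (a n) * q (x n))" using seminorm_scale[OF sn xV] by simp
      also have "\<dots> \<le> (\<Sum>n<N. norm (a n) * C)"
        using C(2) by (intro sum_mono mult_left_mono) (auto intro: order_trans[OF abs_ge_self])
      also have "\<dots> = C * (\<Sum>n<N. norm (a n))" by (simp add: sum_distrib_left mult.commute)
      also have "\<dots> \<le> C * l1_norm a"
        using C(1) a sum_le_suminf[OF a, of "{..<N}"] by (simp add: l1_norm_def)
      finally have "q (S a N) \<le> C * l1_norm a" .
      moreover have "q (\<Phi> a) \<le> q (S a N) + q (S a N - \<Phi> a)"
        using seminorm_diff[OF sn, of "S a N" "S a N - \<Phi> a"] SV \<Phi>V[OF a] by simp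
      ultimately show "q (\<Phi> a) \<le> C * l1_norm a + e" using N by simp
    qed
    then show ?thesis using C(1) by (intro exI[of _ C]) auto
  qed
  ultimately have "l1_map x \<Phi>" using \<Phi>V unfolding l1_map_def by blast
  then show ?thesis by (rule exI[of "l1_map x"])
qed

section \<open>Distance to a span, and the Gram-Schmidt construction\<close>

definition quotient_seminorm :: "('a \<Rightarrow> real) \<Rightarrow> 'a set \<Rightarrow> 'a \<Rightarrow> real" where
  "quotient_seminorm p F x = Inf ((\<lambda>v. p (x - v)) ` span F)"

text \<open>A functional dominated by this distance is dominated by \<open>p\<close> and also
  annihilates \<open>F\<close>. Hahn-Banach applied to it thus yields the next functional of the
  system, already orthogonal to the earlier vectors.\<close>

lemma quotient_seminorm:
  assumes p: "seminorm_on scl V p" and F: "F \<subseteq> V"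
  shows "seminorm_on scl V (quotient_seminorm p F)"
    and "x \<in> V \<Longrightarrow> quotient_seminorm p F x \<le> p x"
    and "v \<in> span F \<Longrightarrow> quotient_seminorm p F v = 0"
    and "x \<in> V \<Longrightarrow> quotient_seminorm p F x < r \<Longrightarrow> \<exists>v\<in>span F. p (x - v) < r"
proof -
  let ?d = "quotient_seminorm p F"
  have sV: "v \<in> V" if "v \<in> span F" for v using span_V[OF F] that by blast
  have bdd: "bdd_below ((\<lambda>v. p (x - v)) ` span F)" if "x \<in> V" for x
    using seminorm_nonneg[OF p] sV that by (intro bdd_belowI[of _ 0]) auto
  have ne: "(\<lambda>v. p (x - v)) ` span F \<noteq> {}" for x using span_zero by blast
  have le: "?d x \<le> p (x - v)" if "x \<in> V" "v \<in> span F" for x v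
    unfolding quotient_seminorm_def using that bdd by (intro cInf_lower) auto
  have ge: "a \<le> ?d x" if "\<And>v. v \<in> span F \<Longrightarrow> a \<le> p (x - v)" for a x
    unfolding quotient_seminorm_def using that ne by (intro cInf_greatest) auto
  show small: "\<exists>v\<in>span F. p (x - v) < r" if "x \<in> V" "?d x < r" for x r
    using cInf_lessD[OF ne] that(2) unfolding quotient_seminorm_def by blast
  have nn: "0 \<le> ?d x" if "x \<in> V" for x using seminorm_nonneg[OF p] sV that by (intro ge) auto
  show "?d x \<le> p x" if "x \<in> V" for x using le[OF that span_zero] by simp
  show zero: "?d v = 0" if "v \<in> span F" for v
    using le[OF sV[OF that] that] nn[OF sV[OF that]] seminorm_0[OF p] by simp
  have add: "?d (x + y) \<le> ?d x + ?d y" if xy: "x \<in> V" "y \<in> V" for x y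
  proof -
    have "?d (x + y) - ?d y \<le> p (x - v)" if v: "v \<in> span F" for v
    proof -
      have "?d (x + y) - p (x - v) \<le> p (y - w)" if w: "w \<in> span F" for w
      proof -
        have "?d (x + y) \<le> p (x + y - (v + w))" using xy v w by (intro le span_add) auto
        also have "x + y - (v + w) = (x - v) + (y - w)" by simp
        also have "p \<dots> \<le> p (x - v) + p (y - w)" using xy v w sV by (intro seminorm_add[OF p]) auto
        finally show ?thesis by simp
      qed
      then have "?d (x + y) - p (x - v) \<le> ?d y" by (rule ge)
      then show ?thesis by simp
    qed
    then have "?d (x + y) - ?d y \<le> ?d x" by (rule ge)
    then show ?thesis by simp
  qed
  have scale_le: "?d (scl c x) \<le> norm c * ?d x" if "x \<in> V" "c \<noteq> 0" for c x
  proof -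
    have "?d (scl c x) / norm c \<le> ?d x"
    proof (rule ge)
      fix v assume v: "v \<in> span F"
      have "?d (scl c x) \<le> p (scl c x - scl c v)" using that v by (intro le span_scale) auto
      also have "\<dots> = norm c * p (x - v)"
        using seminorm_scale[OF p, of "x - v" c] that sV[OF v] by (simp add: scale_right_diff_distrib)
      finally show "?d (scl c x) / norm c \<le> p (x - v)" using that by (simp add: field_simps)
    qed
    then show ?thesis using that by (simp add: field_simps)
  qed
  have "?d (scl c x) = norm c * ?d x" if x: "x \<in> V" for c x
  proof (cases "c = 0")
    case False
    have "?d (scl (1 / c) (scl c x)) \<le> norm (1 / c) * ?d (scl c x)" using x False by (intro scale_le) auto
    then have "norm c * ?d x \<le> ?d (scl c x)" using False by (simp add: norm_divide field_simps)
    then show ?thesis using scale_le[OF x False] by simp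
  qed (simp add: zero[OF span_zero])
  then show "seminorm_on scl V ?d" using add by (simp add: seminorm_on_def)
qed

lemma l1_mapD:
  assumes "l1_map x \<Phi>"
  shows "l1 a \<Longrightarrow> \<Phi> a \<in> V"
    and "l1 a \<Longrightarrow> l1 b \<Longrightarrow> \<Phi> (\<lambda>n. a n + b n) = \<Phi> a + \<Phi> b"
    and "l1 a \<Longrightarrow> \<Phi> (\<lambda>n. c * a n) = scl c (\<Phi> a)"
    and "\<Phi> (\<lambda>n. if n = i then 1 else 0) = x i"
    and "cts_seminorm scl T q \<Longrightarrow> \<exists>C\<ge>0. \<forall>a. l1 a \<longrightarrow> q (\<Phi> a) \<le> C * l1_norm a"
  using assms by (auto simp: l1_map_def)

lemma l1_unit: "l1 (\<lambda>n. if n = i then 1 else 0 :: 'k)"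
  by (rule l1_finite) simp

lemma l1_map_in_V: "l1_map x \<Phi> \<Longrightarrow> x i \<in> V"
  using l1_mapD(1)[OF _ l1_unit] l1_mapD(4) by metis

lemma l1_map_bounded:
  assumes "l1_map x \<Phi>" "cts_seminorm scl T q"
  shows "\<exists>C\<ge>0. \<forall>i. q (x i) \<le> C"
proof -
  obtain C where C: "0 \<le> C" "\<And>a. l1 a \<Longrightarrow> q (\<Phi> a) \<le> C * l1_norm a"
    using l1_mapD(5)[OF assms] by blast
  have "q (x i) \<le> C" for i
  proof -
    have "l1_norm (\<lambda>n. if n = i then 1 else 0 :: 'k) = (\<Sum>n\<in>{i}. norm (if n = i then 1 else 0 :: 'k))"
      unfolding l1_norm_def by (rule suminf_finite) auto
    then show ?thesis using C(2)[OF l1_unit[of i]] l1_mapD(4)[OF assms(1)] by simp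
  qed
  then show ?thesis using C(1) by blast
qed

lemma span_l1_map:
  assumes "l1_map x \<Phi>" "y \<in> span (range x)"
  shows "\<exists>a. l1 a \<and> y = \<Phi> a"
  using assms(2)
proof (induction rule: span_induct_alt)
  case base
  have "\<Phi> (\<lambda>n. 0 * 0) = scl 0 (\<Phi> (\<lambda>_. 0))" by (rule l1_mapD(3)[OF assms(1)]) simp
  then show ?case by (intro exI[of _ "\<lambda>_. 0"]) simp
next
  case (step c u y)
  then obtain a i where a: "l1 a" "y = \<Phi> a" "u = x i" by blast
  let ?u = "\<lambda>n. if n = i then 1 else 0 :: 'k"
  have u: "l1 ?u" by (rule l1_unit)
  have "\<Phi> (\<lambda>n. c * ?u n + a n) = scl c u + y"
    using l1_mapD(2)[OF assms(1) l1_mult[OF u] a(1)] l1_mapD(3)[OF assms(1) u] l1_mapD(4)[OF assms(1)] a by simp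
  then show ?case using l1_add[OF l1_mult[OF u] a(1), of c]
    by (intro exI[of _ "\<lambda>n. c * ?u n + a n"]) simp
qed

text \<open>The vector \<open>x n\<close> may lie in the kernel of \<open>p\<close> modulo the vectors found so far, and then no
  functional dominated by \<open>p\<close> can detect it. A small multiple of some detectable \<open>x m\<close> is
  therefore added; letting every \<open>n\<close> return with smaller and smaller \<open>\<epsilon>\<close> keeps the span dense.\<close>

lemma biorthogonal_step:
  fixes G :: "nat \<Rightarrow> 'a" and F :: "nat \<Rightarrow> 'a \<Rightarrow> 'k" and C :: "nat \<Rightarrow> real"
  assumes \<Phi>: "l1_map x \<Phi>" and dense: "T closure_of span (range x) = V"
    and p: "cts_seminorm scl T p"
    and big: "\<And>(n::nat) f c. (\<And>i. i < n \<Longrightarrow> functional (f i) \<and> continuous_map T euclidean (f i)) \<Longrightarrow>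
       \<exists>x\<in>V. (\<Sum>i<n. c i * norm (f i x)) < p x"
    and G: "\<And>i. i < k \<Longrightarrow> G i \<in> span (range x)" and F: "\<And>i. i < k \<Longrightarrow> functional (F i)"
    and C: "\<And>i z. i < k \<Longrightarrow> z \<in> V \<Longrightarrow> norm (F i z) \<le> C i * p z"
    and FG: "\<And>i j. i < k \<Longrightarrow> j < k \<Longrightarrow> F i (G j) = (if i = j then 1 else 0)"
    and eps: "0 < \<epsilon>"
  shows "\<exists>\<gamma> f c m \<delta>. l1 \<gamma> \<and> l1_norm \<gamma> \<le> 1 \<and> \<Phi> \<gamma> \<in> span (range x) \<and> functional f \<and> 0 \<le> c \<and>
    (\<forall>z\<in>V. norm (f z) \<le> c * p z) \<and> f (\<Phi> \<gamma>) = 1 \<and> (\<forall>i<k. f (G i) = 0 \<and> F i (\<Phi> \<gamma>) = 0) \<and>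
    norm \<delta> \<le> \<epsilon> \<and> x n + scl \<delta> (x m) \<in> span (insert (\<Phi> \<gamma>) (G ` {..<k}))"
proof -
  have sn: "seminorm_on scl V p" using p by (simp add: cts_seminorm_def)
  have xV: "x i \<in> V" for i by (rule l1_map_in_V[OF \<Phi>])
  have sxV: "span (range x) \<subseteq> V" using xV by (intro span_V) auto
  have GV: "G i \<in> V" if "i < k" for i using G[OF that] sxV by blast
  let ?G = "G ` {..<k}"
  have GsV: "?G \<subseteq> V" using GV by auto
  define d where "d = quotient_seminorm p ?G"
  note Q = quotient_seminorm[OF sn GsV, folded d_def]
  note dsn = Q(1) and dle = Q(2) and dspan = Q(3) and dless = Q(4)
  define proj where "proj y = (\<Sum>i<k. scl (F i y) (G i))" for y
  have projV: "proj y \<in> V" for y unfolding proj_def using GV by (intro sum_V) auto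
  have projspan: "proj y \<in> span ?G" for y
    unfolding proj_def by (intro span_sum span_scale span_base) auto
  have Fproj: "F i (proj y) = F i y" if i: "i < k" for i y
  proof -
    have "F i (proj y) = (\<Sum>j<k. F i (scl (F j y) (G j)))"
      unfolding proj_def using GV by (intro functional_sum[OF F[OF i]]) auto
    also have "\<dots> = (\<Sum>j<k. if j = i then F i y else 0)"
      using functionalD(2)[OF F[OF i] GV] FG[OF i] by (intro sum.cong) auto
    finally show ?thesis using i by simp
  qed
  have proj_id: "proj v = v" if "v \<in> span ?G" for v
    using that
  proof (induction rule: span_induct_alt)
    case base
    show ?case using functionalD(3)[OF F] by (simp add: proj_def)
  next
    case (step c u v)
    then obtain j where j: "j < k" "u = G j" by blast
    have vV: "v \<in> V" using step(2) projV[of v] by simp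
    have "proj (scl c u + v) = (\<Sum>i<k. scl (c * F i u + F i v) (G i))"
      unfolding proj_def using functionalD(1,2)[OF F] j GV vV by (intro sum.cong) auto
    also have "\<dots> = scl c (\<Sum>i<k. scl (F i u) (G i)) + proj v"
      by (simp add: scale_left_distrib sum.distrib proj_def scale_sum_right)
    also have "(\<Sum>i<k. scl (F i u) (G i)) = (\<Sum>i<k. if i = j then u else 0)"
      using FG j by (intro sum.cong) auto
    finally show ?case using step(2) j by simp
  qed
  \<comment> \<open>Non-weakness enters here, through a \<open>y\<close> at which \<open>p\<close>
    exceeds the sum of \<open>p (G i) * norm (F i y)\<close>. At distance 0 from the span,
    \<open>y\<close> would satisfy \<open>p (y - proj y) = 0\<close>, and \<open>p y\<close> would
    be at most that sum.\<close>
  have "\<exists>y\<in>V. 0 < d y"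
  proof -
    have "functional (F i) \<and> continuous_map T euclidean (F i)" if "i < k" for i
      using functional_continuous[OF F[OF that] p C[OF that]] F[OF that] by simp
    from big[of k F "\<lambda>i. p (G i)", OF this]
    obtain y where y: "y \<in> V" "(\<Sum>i<k. p (G i) * norm (F i y)) < p y" by blast
    have "0 < d y"
    proof (rule ccontr)
      assume "\<not> 0 < d y"
      \<comment> \<open>A bound for \<open>id - proj\<close> with respect to \<open>p\<close>. As
        this map kills the span, \<open>p (y - proj y)\<close> is at most \<open>K\<close> times
        \<open>p (y - v)\<close> for every \<open>v\<close> in the span.\<close>
      define K where "K = 1 + (\<Sum>i<k. C i * p (G i))"
      have p0: "0 \<le> p z" if "z \<in> V" for z using seminorm_nonneg[OF sn that] .
      have pproj: "p (proj z) \<le> (\<Sum>i<k. p (G i) * norm (F i z))" for z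
      proof -
        have "p (proj z) \<le> (\<Sum>i<k. p (scl (F i z) (G i)))"
          unfolding proj_def using GV by (intro seminorm_sum[OF sn]) auto
        also have "\<dots> = (\<Sum>i<k. p (G i) * norm (F i z))"
          using seminorm_scale[OF sn GV] by (intro sum.cong) (auto simp: mult.commute)
        finally show ?thesis .
      qed
      have pproj': "p (proj z) \<le> (K - 1) * p z" if "z \<in> V" for z
      proof -
        have "p (proj z) \<le> (\<Sum>i<k. p (G i) * norm (F i z))" by (rule pproj)
        also have "\<dots> \<le> (\<Sum>i<k. p (G i) * (C i * p z))"
          using C that p0 GV by (intro sum_mono mult_left_mono) auto
        also have "\<dots> = (K - 1) * p z" by (simp add: K_def sum_distrib_left sum_distrib_right mult_ac)
        finally show ?thesis .
      qed
      have diff: "proj (y - v) = proj y - proj v" if "v \<in> V" for v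
        unfolding proj_def sum_subtractf[symmetric]
        using functionalD(4)[OF F] y(1) that by (intro sum.cong) (auto simp: scale_left_diff_distrib)
      have bound: "p (y - proj y) \<le> e * \<bar>K\<bar>" if e: "0 < e" for e
      proof -
        have "d y < e" using \<open>\<not> 0 < d y\<close> e by simp
        then obtain v where v: "v \<in> span ?G" "p (y - v) < e" using dless[OF y(1)] by blast
        have vV: "v \<in> V" using v(1) span_V[OF GsV] by blast
        have "y - proj y = (y - v) - proj (y - v)" using diff[OF vV] proj_id[OF v(1)] by simp
        moreover have "p ((y - v) - proj (y - v)) \<le> p (y - v) + p (proj (y - v))"
          using y(1) vV projV by (intro seminorm_diff[OF sn]) auto
        ultimately have "p (y - proj y) \<le> p (y - v) + p (proj (y - v))" by (simp only:)
        also have "\<dots> \<le> K * p (y - v)" using pproj'[of "y - v"] y(1) vV by (simp add: algebra_simps)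
        also have "\<dots> \<le> \<bar>K\<bar> * p (y - v)" using p0[of "y - v"] y(1) vV by (intro mult_right_mono) auto
        also have "\<dots> \<le> \<bar>K\<bar> * e" using v(2) by (intro mult_left_mono) auto
        finally show ?thesis by (simp add: mult.commute)
      qed
      have "p (y - proj y) \<le> 0 + e" if e: "0 < e" for e
      proof -
        have "0 < e / (\<bar>K\<bar> + 1)" using e by (intro divide_pos_pos) auto
        from bound[OF this] have "p (y - proj y) \<le> e / (\<bar>K\<bar> + 1) * \<bar>K\<bar>" .
        also have "\<dots> \<le> e" using e by (simp add: field_simps)
        finally show ?thesis by simp
      qed
      then have "p (y - proj y) \<le> 0" by (rule field_le_epsilon)
      moreover have "p y \<le> p (y - proj y) + p (proj y)"
        using seminorm_add[OF sn, of "y - proj y" "proj y"] y(1) projV by simp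
      ultimately show False using y(2) pproj[of y] by simp
    qed
    then show ?thesis using y(1) by blast
  qed
  then obtain y where y: "y \<in> V" "0 < d y" by blast
  \<comment> \<open>Otherwise \<open>d\<close> would vanish on the span of the \<open>x m\<close>
    and, being dominated by the continuous \<open>p\<close>, on its closure, which contains
    \<open>y\<close>.\<close>
  have "\<exists>m. 0 < d (x m)"
  proof (rule ccontr)
    assume "\<nexists>m. 0 < d (x m)"
    then have dx: "d (x m) = 0" for m using seminorm_nonneg[OF dsn xV[of m]] by (simp add: not_less antisym)
    have ds: "d s = 0 \<and> s \<in> V" if "s \<in> span (range x)" for s
      using that
    proof (induction rule: span_induct_alt)
      case base
      then show ?case using seminorm_0[OF dsn] by simp
    next
      case (step c u v)
      then have "d (scl c u + v) \<le> 0"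
        using seminorm_add[OF dsn, of "scl c u" v] seminorm_scale[OF dsn, of u c] dx xV by auto
      then show ?case using step seminorm_nonneg[OF dsn, of "scl c u + v"] xV by auto
    qed
    have "y \<in> T closure_of span (range x)" using y(1) dense by simp
    from closure_of_seminorm[OF this p y(2)]
    obtain s where s: "s \<in> span (range x)" "p (s - y) < d y" by blast
    have "d y \<le> d s + d (y - s)"
      using seminorm_add[OF dsn, of s "y - s"] ds[OF s(1)] y(1) by simp
    also have "\<dots> \<le> p (y - s)" using ds[OF s(1)] dle[of "y - s"] y(1) by simp
    also have "\<dots> = p (s - y)" using seminorm_minus_commute[OF sn] ds[OF s(1)] y(1) by simp
    finally show False using s(2) by simp
  qed
  then obtain m where m: "0 < d (x m)" by blast
  obtain f where f: "functional f" "\<And>z. z \<in> V \<Longrightarrow> norm (f z) \<le> 2 * d z" "f (x m) \<noteq> 0"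
    using Hahn_Banach_seminorm[OF dsn xV, of m] m by blast
  define \<delta> :: 'k where "\<delta> = (if f (x n) = 0 then of_real \<epsilon> else 0)"
  define y where "y = x n + scl \<delta> (x m)"
  have yV: "y \<in> V" using xV by (simp add: y_def)
  have fy: "f y \<noteq> 0"
    using functionalD(1,2)[OF f(1)] xV f(3) eps by (auto simp: y_def \<delta>_def)
  have fspan: "f v = 0" if "v \<in> span ?G" for v
    using f(2)[of v] dspan[OF that] span_V[OF GsV] that by auto
  \<comment> \<open>Subtracting the projection makes the earlier functionals vanish at the new
    vector and leaves the value of \<open>f\<close> unchanged, because \<open>f\<close> annihilates
    the earlier vectors.\<close>
  define h where "h = y - proj y"
  have hV: "h \<in> V" using yV projV by (simp add: h_def)
  have fh: "f h = f y" using functionalD(4)[OF f(1) yV projV] fspan[OF projspan] by (simp add: h_def)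
  have Fh: "F i h = 0" if "i < k" for i
    using functionalD(4)[OF F[OF that] yV projV] Fproj[OF that] by (simp add: h_def)
  have projx: "proj y \<in> span (range x)"
    unfolding proj_def using G by (intro span_sum span_scale) auto
  have "y \<in> span (range x)" unfolding y_def by (intro span_add span_scale span_base) auto
  then have hx: "h \<in> span (range x)" unfolding h_def using projx by (intro span_diff)
  then obtain \<gamma>0 where \<gamma>0: "l1 \<gamma>0" "h = \<Phi> \<gamma>0" using span_l1_map[OF \<Phi>] by blast
  \<comment> \<open>Shrinks the coefficient sequence into the unit ball of l1; \<open>f\<close> is
    rescaled inversely, so the pairing with the new vector is 1.\<close>
  define \<eta> where "\<eta> = 1 / (1 + l1_norm \<gamma>0)"
  have n0: "0 \<le> l1_norm \<gamma>0" using \<gamma>0(1) by (simp add: l1_norm_def suminf_nonneg)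
  have \<eta>: "0 < \<eta>" using n0 by (simp add: \<eta>_def)
  define \<gamma> where "\<gamma> l = of_real \<eta> * \<gamma>0 l" for l
  have g: "\<Phi> \<gamma> = scl (of_real \<eta>) h" unfolding \<gamma>_def \<gamma>0(2) by (rule l1_mapD(3)[OF \<Phi> \<gamma>0(1)])
  have \<gamma>1: "l1 \<gamma>" unfolding \<gamma>_def by (rule l1_mult[OF \<gamma>0(1)])
  have "l1_norm \<gamma> = \<eta> * l1_norm \<gamma>0"
    unfolding \<gamma>_def using l1_norm_mult[OF \<gamma>0(1), of "of_real \<eta>"] \<eta> by simp
  also have "\<dots> \<le> 1" using n0 by (simp add: \<eta>_def field_simps)
  finally have \<gamma>2: "l1_norm \<gamma> \<le> 1" .
  define f' where "f' z = inverse (f y * of_real \<eta>) * f z" for z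
  have f'1: "functional f'"
    using functionalD(1,2)[OF f(1)] by (simp add: linear_between_def f'_def algebra_simps)
  have f'2: "norm (f' z) \<le> 2 * norm (inverse (f y * of_real \<eta>)) * p z" if "z \<in> V" for z
  proof -
    have "norm (f' z) \<le> norm (inverse (f y * of_real \<eta>)) * (2 * d z)"
      unfolding f'_def norm_mult[of _ "f z"] by (intro mult_left_mono f(2) that) auto
    also have "\<dots> \<le> norm (inverse (f y * of_real \<eta>)) * (2 * p z)"
      using dle[OF that] by (intro mult_left_mono) auto
    finally show ?thesis by (simp add: mult_ac)
  qed
  have f'3: "f' (\<Phi> \<gamma>) = 1"
    unfolding f'_def g using functionalD(2)[OF f(1) hV] fh fy \<eta> by (simp add: field_simps)
  have f'4: "f' (G i) = 0 \<and> F i (\<Phi> \<gamma>) = 0" if "i < k" for i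
    using fspan[OF span_base, of "G i"] that functionalD(2)[OF F[OF that] hV] Fh[OF that] by (auto simp: f'_def g)
  have yspan: "y \<in> span (insert (\<Phi> \<gamma>) ?G)"
  proof -
    have "y = scl (of_real (1 / \<eta>)) (\<Phi> \<gamma>) + proj y" using \<eta> by (simp add: g h_def)
    moreover have "proj y \<in> span (insert (\<Phi> \<gamma>) ?G)" using projspan span_mono[of ?G "insert (\<Phi> \<gamma>) ?G"] by blast
    moreover have "scl (of_real (1 / \<eta>)) (\<Phi> \<gamma>) \<in> span (insert (\<Phi> \<gamma>) ?G)"
      by (intro span_scale span_base) simp
    ultimately show ?thesis using span_add by metis
  qed
  have "\<Phi> \<gamma> \<in> span (range x)" unfolding g by (rule span_scale[OF hx])
  moreover have "norm \<delta> \<le> \<epsilon>" using eps by (simp add: \<delta>_def)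
  ultimately show ?thesis
    using \<gamma>1 \<gamma>2 f'1 f'2 f'3 f'4 yspan[unfolded y_def]
    by (intro exI[of _ \<gamma>] exI[of _ f'] exI[of _ "2 * norm (inverse (f y * of_real \<eta>))"] exI[of _ m] exI[of _ \<delta>]) auto
qed

definition biorthogonal ::
  "('a \<Rightarrow> real) \<Rightarrow> (nat \<Rightarrow> 'a) \<Rightarrow> (nat \<Rightarrow> 'a \<Rightarrow> 'k) \<Rightarrow> (nat \<Rightarrow> real) \<Rightarrow> ((nat \<Rightarrow> 'k) \<Rightarrow> 'a) \<Rightarrow> bool" where
  "biorthogonal p g f C \<Phi> \<longleftrightarrow> cts_seminorm scl T p \<and> l1_map g \<Phi> \<and>
     T closure_of span (range g) = V \<and>
     (\<forall>i. functional (f i) \<and> 0 \<le> C i \<and> (\<forall>z\<in>V. norm (f i z) \<le> C i * p z)) \<and>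
     (\<forall>i j. f i (g j) = (if i = j then 1 else 0))"

text \<open>The matrix with rows in the unit ball of l1 maps l1 into itself with norm at most 1, and
  \<open>\<Phi>\<close> is applied after it. The new vectors need not tend to 0, so
  \<open>l1_map\<close>, and not \<open>l1_sequence\<close>, is the property that survives the
  passage to the biorthogonal system.\<close>

lemma l1_map_compose:
  assumes \<Phi>: "l1_map x \<Phi>" and \<gamma>: "\<And>k. l1 (\<gamma> k)" "\<And>k. l1_norm (\<gamma> k) \<le> 1"
  shows "l1_map (\<lambda>k. \<Phi> (\<gamma> k)) (\<lambda>a. \<Phi> (\<lambda>l. suminf (\<lambda>k. a k * \<gamma> k l)))"
proof -
  have *: "summable (\<lambda>k. a k * \<gamma> k l)" "l1 (\<lambda>l. suminf (\<lambda>k. a k * \<gamma> k l))"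
    "l1_norm (\<lambda>l. suminf (\<lambda>k. a k * \<gamma> k l)) \<le> l1_norm a" if a: "l1 a" for a :: "nat \<Rightarrow> 'k" and l
  proof -
    have "l1 (\<lambda>l. a k * \<gamma> k l)" for k by (rule l1_mult[OF \<gamma>(1)])
    moreover have "l1_norm (\<lambda>l. a k * \<gamma> k l) \<le> norm (a k)" for k
      using l1_norm_mult[OF \<gamma>(1), of "a k" k] mult_left_mono[OF \<gamma>(2)[of k], of "norm (a k)"] by simp
    ultimately show "summable (\<lambda>k. a k * \<gamma> k l)" "l1 (\<lambda>l. suminf (\<lambda>k. a k * \<gamma> k l))"
      "l1_norm (\<lambda>l. suminf (\<lambda>k. a k * \<gamma> k l)) \<le> l1_norm a"
      using l1_series[of "\<lambda>k l. a k * \<gamma> k l" "\<lambda>k. norm (a k)"] a by (auto simp: l1_norm_def[of a])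
  qed
  show ?thesis
    unfolding l1_map_def
  proof (intro conjI allI impI)
    fix a :: "nat \<Rightarrow> 'k" assume "l1 a"
    then show "\<Phi> (\<lambda>l. suminf (\<lambda>k. a k * \<gamma> k l)) \<in> V" using * by (intro l1_mapD(1)[OF \<Phi>])
  next
    fix a b :: "nat \<Rightarrow> 'k" assume a: "l1 a" and b: "l1 b"
    have "(\<lambda>l. suminf (\<lambda>k. (a k + b k) * \<gamma> k l)) = (\<lambda>l. suminf (\<lambda>k. a k * \<gamma> k l) + suminf (\<lambda>k. b k * \<gamma> k l))"
      using suminf_add[OF *(1)[OF a] *(1)[OF b]] by (simp add: distrib_right)
    then show "\<Phi> (\<lambda>l. suminf (\<lambda>k. (a k + b k) * \<gamma> k l)) =
        \<Phi> (\<lambda>l. suminf (\<lambda>k. a k * \<gamma> k l)) + \<Phi> (\<lambda>l. suminf (\<lambda>k. b k * \<gamma> k l))"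
      using l1_mapD(2)[OF \<Phi> *(2)[OF a] *(2)[OF b]] by simp
  next
    fix c and a :: "nat \<Rightarrow> 'k" assume a: "l1 a"
    have "(\<lambda>l. suminf (\<lambda>k. c * a k * \<gamma> k l)) = (\<lambda>l. c * suminf (\<lambda>k. a k * \<gamma> k l))"
      using suminf_mult[OF *(1)[OF a]] by (simp add: mult.assoc)
    then show "\<Phi> (\<lambda>l. suminf (\<lambda>k. c * a k * \<gamma> k l)) = scl c (\<Phi> (\<lambda>l. suminf (\<lambda>k. a k * \<gamma> k l)))"
      using l1_mapD(3)[OF \<Phi> *(2)[OF a]] by simp
  next
    fix i
    have "suminf (\<lambda>k. (if k = i then 1 else 0) * \<gamma> k l) = \<gamma> i l" for l
    proof -
      have "suminf (\<lambda>k. (if k = i then 1 else 0) * \<gamma> k l) = (\<Sum>k\<in>{i}. (if k = i then 1 else 0) * \<gamma> k l)"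
        by (rule suminf_finite) auto
      then show ?thesis by simp
    qed
    then show "\<Phi> (\<lambda>l. suminf (\<lambda>k. (if k = i then 1 else 0) * \<gamma> k l)) = \<Phi> (\<gamma> i)" by simp
  next
    fix q assume "cts_seminorm scl T q"
    then obtain C where C: "0 \<le> C" "\<And>a. l1 a \<Longrightarrow> q (\<Phi> a) \<le> C * l1_norm a"
      using l1_mapD(5)[OF \<Phi>] by blast
    have "q (\<Phi> (\<lambda>l. suminf (\<lambda>k. a k * \<gamma> k l))) \<le> C * l1_norm a" if "l1 a" for a
      using C(2)[OF *(2)[OF that]] mult_left_mono[OF *(3)[OF that] C(1)] by linarith
    then show "\<exists>C\<ge>0. \<forall>a. l1 a \<longrightarrow> q (\<Phi> (\<lambda>l. suminf (\<lambda>k. a k * \<gamma> k l))) \<le> C * l1_norm a"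
      using C(1) by blast
  qed
qed

lemma biorthogonal_exists:
  assumes nw: "\<not> has_weak_topology scl T" and l1x: "l1_sequence scl T x"
    and dense: "T closure_of span (range x) = V"
  shows "\<exists>p g f C \<Phi>. biorthogonal p g f C \<Phi>"
proof -
  obtain \<Phi> where \<Phi>: "l1_map x \<Phi>" using l1_sequence_l1_map[OF l1x] by blast
  obtain p where p: "cts_seminorm scl T p" and big: "\<And>(n::nat) f c.
    (\<And>i. i < n \<Longrightarrow> functional (f i) \<and> continuous_map T euclidean (f i)) \<Longrightarrow>
       \<exists>x\<in>V. (\<Sum>i<n. c i * norm (f i x)) < p x"
    using not_weak_seminorm[OF nw] by blast
  have xV: "x i \<in> V" for i by (rule l1_map_in_V[OF \<Phi>])
  define R where "R s k r \<longleftrightarrow> (case r of (\<gamma>, f, c) \<Rightarrow> l1 \<gamma> \<and> l1_norm \<gamma> \<le> 1 \<and> \<Phi> \<gamma> \<in> span (range x) \<and>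
      functional f \<and> 0 \<le> c \<and> (\<forall>z\<in>V. norm (f z) \<le> c * p z) \<and> f (\<Phi> \<gamma>) = 1 \<and>
      (\<forall>i<k. f (\<Phi> (fst (s i))) = 0 \<and> fst (snd (s i)) (\<Phi> \<gamma>) = 0) \<and>
      (\<exists>m \<delta>. norm \<delta> \<le> (1/2)^k \<and> x (fst (prod_decode k)) + scl \<delta> (x m) \<in>
         span (insert (\<Phi> \<gamma>) ((\<lambda>i. \<Phi> (fst (s i))) ` {..<k}))))"
    for s :: "nat \<Rightarrow> (nat \<Rightarrow> 'k) \<times> ('a \<Rightarrow> 'k) \<times> real" and k r
  have "\<exists>s. \<forall>k. R s k (s k)"
  \<comment> \<open>A stage refers to all earlier choices and not only to the last one, hence the
    well-founded form; its first obligation is that \<open>R\<close> reads \<open>s\<close> only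
    below \<open>k\<close>.\<close>
  proof (rule dependent_wf_choice[OF wf_less])
    fix s s' :: "nat \<Rightarrow> (nat \<Rightarrow> 'k) \<times> ('a \<Rightarrow> 'k) \<times> real" and k r
    assume "\<And>z. (z, k) \<in> {(x, y). x < y} \<Longrightarrow> s z = s' z"
    then have eq: "s i = s' i" if "i < k" for i using that by simp
    have "(\<lambda>i. \<Phi> (fst (s i))) ` {..<k} = (\<lambda>i. \<Phi> (fst (s' i))) ` {..<k}"
      using eq by (intro image_cong) auto
    then show "R s k r = R s' k r" using eq by (auto simp: R_def)
  next
    fix k and s :: "nat \<Rightarrow> (nat \<Rightarrow> 'k) \<times> ('a \<Rightarrow> 'k) \<times> real"
    assume "\<And>i. (i, k) \<in> {(x, y). x < y} \<Longrightarrow> R s i (s i)"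
    then have s: "R s i (s i)" if "i < k" for i using that by simp
    define G where "G i = \<Phi> (fst (s i))" for i
    define F where "F i = fst (snd (s i))" for i
    define C where "C i = snd (snd (s i))" for i
    have si: "s i = (fst (s i), F i, C i)" for i by (simp add: F_def C_def)
    have *: "G i \<in> span (range x) \<and> functional (F i) \<and> (\<forall>z\<in>V. norm (F i z) \<le> C i * p z) \<and> F i (G i) = 1 \<and>
        (\<forall>j<i. F i (G j) = 0 \<and> F j (G i) = 0)" if "i < k" for i
      using s[OF that] unfolding R_def by (subst (asm) (4) si) (auto simp: G_def F_def)
    have FG: "F i (G j) = (if i = j then 1 else 0)" if "i < k" "j < k" for i j
      using *[OF that(1)] *[OF that(2)] by (cases i j rule: linorder_cases) auto
    obtain \<gamma> f c m \<delta> where "l1 \<gamma> \<and> l1_norm \<gamma> \<le> 1 \<and> \<Phi> \<gamma> \<in> span (range x) \<and> functional f \<and> 0 \<le> c \<and>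
      (\<forall>z\<in>V. norm (f z) \<le> c * p z) \<and> f (\<Phi> \<gamma>) = 1 \<and> (\<forall>i<k. f (G i) = 0 \<and> F i (\<Phi> \<gamma>) = 0) \<and>
      norm \<delta> \<le> (1/2)^k \<and> x (fst (prod_decode k)) + scl \<delta> (x m) \<in> span (insert (\<Phi> \<gamma>) (G ` {..<k}))"
      using biorthogonal_step[OF \<Phi> dense p big, of k G F C "(1/2)^k" "fst (prod_decode k)"] * FG by auto
    then have "R s k (\<gamma>, f, c)" unfolding R_def G_def F_def by auto
    then show "\<exists>r. R s k r" ..
  qed
  then obtain s where s: "\<And>k. R s k (s k)" by blast
  define \<gamma> where "\<gamma> k = fst (s k)" for k
  define g where "g k = \<Phi> (\<gamma> k)" for k
  define f where "f k = fst (snd (s k))" for k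
  define C where "C k = snd (snd (s k))" for k
  have "s k = (\<gamma> k, f k, C k)" for k by (simp add: \<gamma>_def f_def C_def)
  then have "R s k (\<gamma> k, f k, C k)" for k using s[of k] by simp
  then have R: "l1 (\<gamma> k) \<and> l1_norm (\<gamma> k) \<le> 1 \<and> g k \<in> span (range x) \<and>
      functional (f k) \<and> 0 \<le> C k \<and> (\<forall>z\<in>V. norm (f k z) \<le> C k * p z) \<and> f k (g k) = 1 \<and>
      (\<forall>i<k. f k (g i) = 0 \<and> f i (g k) = 0) \<and>
      (\<exists>m \<delta>. norm \<delta> \<le> (1/2)^k \<and> x (fst (prod_decode k)) + scl \<delta> (x m) \<in> span (insert (g k) (g ` {..<k})))" for k
    unfolding R_def g_def \<gamma>_def f_def by simp
  have fg: "f i (g j) = (if i = j then 1 else 0)" for i j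
    using R[of i] R[of j] by (cases i j rule: linorder_cases) auto
  have \<Psi>: "l1_map g (\<lambda>a. \<Phi> (\<lambda>l. suminf (\<lambda>k. a k * \<gamma> k l)))"
    unfolding g_def using R by (intro l1_map_compose[OF \<Phi>]) auto
  have gV: "g k \<in> V" for k by (rule l1_map_in_V[OF \<Psi>])
  have sgV: "span (range g) \<subseteq> V" using gV by (intro span_V) auto
  have "v \<in> T closure_of span (range g)" if v: "v \<in> V" for v
  proof (rule closure_ofI_seminorm[OF v sgV])
    fix q assume q: "cts_seminorm scl T q"
    then have sn: "seminorm_on scl V q" by (simp add: cts_seminorm_def)
    obtain B where B: "0 \<le> B" "\<And>i. q (x i) \<le> B" using l1_map_bounded[OF \<Phi> q] by blast
    have xn: "\<exists>t\<in>span (range g). q (t - x n) < e" if e: "0 < e" for n e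
    proof -
      have "(\<lambda>j. (1/2)^j * B) \<longlonglongrightarrow> 0"
        by (intro tendsto_mult_left_zero LIMSEQ_power_zero) simp
      then obtain j where j: "(1/2)^j * B < e"
        using order_tendstoD(2)[OF _ e] eventually_happens'[OF sequentially_bot] by blast
      \<comment> \<open>Among the stages that treat \<open>n\<close>, one with \<open>k\<close> at
        least \<open>j\<close>, so that its tolerance is small enough for the seminorm at
        hand.\<close>
      define k where "k = prod_encode (n, j)"
      obtain m \<delta> where m: "norm \<delta> \<le> (1/2)^k" "x n + scl \<delta> (x m) \<in> span (insert (g k) (g ` {..<k}))"
        using R[of k] by (auto simp: k_def)
      have "q (x n + scl \<delta> (x m) - x n) = norm \<delta> * q (x m)" using seminorm_scale[OF sn xV] by simp
      also have "\<dots> \<le> (1/2)^k * B"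
        using m(1) B seminorm_nonneg[OF sn xV] by (intro mult_mono) auto
      also have "\<dots> \<le> (1/2)^j * B"
        using B(1) le_prod_encode_2[of j n] by (intro mult_right_mono power_decreasing) (auto simp: k_def)
      also note j
      finally have "q (x n + scl \<delta> (x m) - x n) < e" .
      moreover have "x n + scl \<delta> (x m) \<in> span (range g)"
        using m(2) span_mono[of "insert (g k) (g ` {..<k})" "range g"] by auto
      ultimately show ?thesis by blast
    qed
    have approx: "u \<in> V \<and> (\<forall>e>0. \<exists>t\<in>span (range g). q (t - u) < e)" if "u \<in> span (range x)" for u
      using that
    proof (induction rule: span_induct_alt)
      case base
      then show ?case using span_zero seminorm_0[OF sn] by (auto intro!: bexI[of _ 0])
    next
      case (step c u w)
      then obtain n where n: "u = x n" by blast
      have "\<exists>t\<in>span (range g). q (t - (scl c u + w)) < e" if e: "0 < e" for e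
      proof -
        have "0 < e / 2 / (norm c + 1)" using e by (intro divide_pos_pos add_nonneg_pos) auto
        from xn[OF this, of n] obtain t where t: "t \<in> span (range g)" "q (t - u) < e / 2 / (norm c + 1)" using n by blast
        obtain t' where t': "t' \<in> span (range g)" "q (t' - w) < e / 2" using step e half_gt_zero by blast
        have tV: "t \<in> V" "t' \<in> V" "u \<in> V" "w \<in> V" using t t' sgV n xV step by auto
        have "scl c t + t' - (scl c u + w) = scl c (t - u) + (t' - w)"
          by (simp add: scale_right_diff_distrib)
        also have "q \<dots> \<le> norm c * q (t - u) + q (t' - w)"
          using seminorm_add[OF sn, of "scl c (t - u)" "t' - w"] seminorm_scale[OF sn, of "t - u" c] tV by simp
        also have "norm c * q (t - u) \<le> (norm c + 1) * q (t - u)"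
          using seminorm_nonneg[OF sn, of "t - u"] tV by (intro mult_right_mono) auto
        also have "(norm c + 1) * q (t - u) < e / 2"
          using t(2) by (subst (asm) pos_less_divide_eq) (auto intro: add_nonneg_pos simp: mult.commute)
        also note t'(2)
        finally have "q (scl c t + t' - (scl c u + w)) < e" by simp
        then show ?thesis using span_add[OF span_scale[OF t(1)] t'(1)] by blast
      qed
      then show ?case using step n xV by auto
    qed
    have "v \<in> T closure_of span (range x)" using dense v by simp
    from closure_of_seminorm[OF this q, of "1/2"] obtain u where u: "u \<in> span (range x)" "q (u - v) < 1/2" by auto
    obtain t where t: "t \<in> span (range g)" "q (t - u) < 1/2" using approx[OF u(1)] by (meson half_gt_zero zero_less_one)
    have "q (t - v) \<le> q (t - u) + q (u - v)"
      using seminorm_add[OF sn, of "t - u" "u - v"] t(1) sgV approx[OF u(1)] v by auto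
    then show "\<exists>t\<in>span (range g). q (t - v) < 1" using t u by force
  qed
  then have "T closure_of span (range g) = V"
    using closure_of_subset_topspace[of T] by blast
  then have "biorthogonal p g f C (\<lambda>a. \<Phi> (\<lambda>l. suminf (\<lambda>k. a k * \<gamma> k l)))"
    unfolding biorthogonal_def using p \<Psi> R fg by auto
  then show ?thesis by blast
qed

end

section \<open>Operators on the direct sum\<close>

locale lc_direct_sum =
  fixes scl :: "'k::real_or_complex \<Rightarrow> 'a::ab_group_add \<Rightarrow> 'a"
    and X :: "nat \<Rightarrow> 'a topology" and D :: "(nat \<Rightarrow>\<^sub>0 'a) topology"
  assumes lcsX: "\<And>n. locally_convex_space scl (X n)"
    and direct_sum: "locally_convex_direct_sum scl X D"
begin

abbreviation dscl where "dscl \<equiv> direct_sum_scale scl :: 'k \<Rightarrow> (nat \<Rightarrow>\<^sub>0 'a) \<Rightarrow> _"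
abbreviation emb where "emb \<equiv> Poly_Mapping.single :: nat \<Rightarrow> 'a \<Rightarrow> (nat \<Rightarrow>\<^sub>0 'a)"
abbreviation coord where "coord \<equiv> Poly_Mapping.lookup :: (nat \<Rightarrow>\<^sub>0 'a) \<Rightarrow> nat \<Rightarrow> 'a"

lemma candidate_D: "direct_sum_candidate scl X D"
  using direct_sum by (simp add: locally_convex_direct_sum_def)

lemma topspace_D: "topspace D = direct_sum_carrier X"
  using candidate_D by (simp add: direct_sum_candidate_def)

lemma lcs_X: "lcs scl (X n)"
  using lcsX[of n] by (simp add: lcs_def lcs_axioms_def locally_convex_space_def topological_vector_space_def)

lemma lcs_D: "lcs dscl D"
proof -
  have "locally_convex_space dscl D" using candidate_D unfolding direct_sum_candidate_def by blast
  then show ?thesis by (simp add: lcs_def lcs_axioms_def locally_convex_space_def topological_vector_space_def)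
qed

sublocale X: lcs scl "X n" for n by (rule lcs_X)
sublocale D: lcs dscl D by (rule lcs_D)

lemma coord_dscl [simp]: "coord (dscl c f) i = scl c (coord f i)"
  by (rule lookup_direct_sum_scale[OF X.vector_space_axioms])

lemma coord_in_X [simp]: "z \<in> topspace D \<Longrightarrow> coord z n \<in> topspace (X n)"
  unfolding topspace_D direct_sum_carrier_def by blast

lemma in_D: "(\<And>n. coord z n \<in> topspace (X n)) \<Longrightarrow> z \<in> topspace D"
  unfolding topspace_D direct_sum_carrier_def by blast

lemma emb_in_D [simp]: "x \<in> topspace (X n) \<Longrightarrow> emb n x \<in> topspace D"
  by (rule in_D) (auto simp: lookup_single when_def)

lemma emb_add: "emb n (x + y) = emb n x + emb n y"
  by (rule single_add)

lemma emb_scale: "emb n (scl c x) = dscl c (emb n x)"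
  by (rule poly_mapping_eqI) (simp add: lookup_single when_def)

lemma emb_diff: "emb n (x - y) = emb n x - emb n y"
  by (rule single_diff)

lemma emb_sum: "emb n (sum f A) = (\<Sum>i\<in>A. emb n (f i))"
  by (induction A rule: infinite_finite_induct) (auto simp: single_add)

lemma emb_continuous: "continuous_map (X n) D (emb n)"
  using candidate_D
  by (auto simp: direct_sum_candidate_def embedding_map_def homeomorphic_eq_everything_map
      continuous_map_in_subtopology)

lemma sum_emb: "z = (\<Sum>n\<in>Poly_Mapping.keys z. emb n (coord z n))"
proof (rule poly_mapping_eqI)
  fix m
  have "coord (\<Sum>n\<in>Poly_Mapping.keys z. emb n (coord z n)) m = (\<Sum>n\<in>Poly_Mapping.keys z. if n = m then coord z m else 0)"
    unfolding lookup_sum by (intro sum.cong) (auto simp: lookup_single when_def)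
  then show "coord z m = coord (\<Sum>n\<in>Poly_Mapping.keys z. emb n (coord z n)) m"
    by (simp add: in_keys_iff)
qed

lemma seminorm_emb:
  assumes "cts_seminorm dscl D q"
  shows "cts_seminorm scl (X n) (\<lambda>x. q (emb n x))"
proof -
  have q: "seminorm_on dscl (topspace D) q" "continuous_map D euclideanreal q"
    using assms by (auto simp: cts_seminorm_def)
  have "continuous_map (X n) euclideanreal (q \<circ> emb n)"
    by (rule continuous_map_compose[OF emb_continuous q(2)])
  then show ?thesis
    using D.seminorm_add[OF q(1)] D.seminorm_scale[OF q(1)]
    by (simp add: cts_seminorm_def seminorm_on_def emb_add emb_scale comp_def)
qed

text \<open>The initial topology of the identity and \<open>S\<close> is a candidate for the direct sum topology,
  hence is coarser than \<open>D\<close>.\<close>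

lemma linear_continuous:
  assumes lin: "linear_between dscl dscl (topspace D) S" and S: "\<And>z. z \<in> topspace D \<Longrightarrow> S z \<in> topspace D"
    and cont: "\<And>n. continuous_map (X n) D (\<lambda>x. S (emb n x))"
  shows "continuous_map D D S"
proof -
  let ?C = "topspace D"
  define P where "P = pullback_topology ?C (\<lambda>z. (z, S z)) (prod_topology D D)"
  have add: "S (x + y) = S x + S y" if "x \<in> ?C" "y \<in> ?C" for x y
    using lin that by (simp add: linear_between_def)
  have scale: "S (dscl c x) = dscl c (S x)" if "x \<in> ?C" for c x
    using lin that by (simp add: linear_between_def)
  have S0: "S 0 = 0" using scale[of 0 0] by simp
  have topP: "topspace P = ?C"
    using S by (auto simp: P_def topspace_pullback_topology)
  have contP: "continuous_map Z P g"
    if "continuous_map Z D g" "continuous_map Z D (\<lambda>x. S (g x))" for g and Z :: "'c topology"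
    unfolding P_def
    by (rule continuous_map_pullback')
      (use that continuous_map_image_subset_topspace[OF that(1)] in \<open>auto simp: continuous_map_pairwise comp_def\<close>)
  have "continuous_map P (prod_topology D D) ((\<lambda>z. z) \<circ> (\<lambda>z. (z, S z)))"
    unfolding P_def by (rule continuous_map_pullback) simp
  then have idP: "continuous_map P D (\<lambda>z. z)" and SP: "continuous_map P D S"
    by (auto simp: continuous_map_pairwise comp_def)
  have "Hausdorff_space P"
    using Hausdorff_space_injective_preimage[OF D.Hausdorff idP] by (simp add: inj_on_def)
  moreover have "continuous_map (prod_topology P P) P (\<lambda>(x, y). x + y)"
  proof (rule contP)
    have fst: "continuous_map (prod_topology P P) P fst" and snd: "continuous_map (prod_topology P P) P snd"
      by (auto simp: continuous_map_fst continuous_map_snd)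
    have "continuous_map (prod_topology P P) D (\<lambda>z. fst z + snd z)"
      using continuous_map_compose[OF fst idP] continuous_map_compose[OF snd idP]
      by (intro D.cont_add) (simp_all add: comp_def)
    then show "continuous_map (prod_topology P P) D (\<lambda>(x, y). x + y)" by (simp add: case_prod_unfold)
    have "continuous_map (prod_topology P P) D (\<lambda>z. S (fst z) + S (snd z))"
      using continuous_map_compose[OF fst SP] continuous_map_compose[OF snd SP]
      by (intro D.cont_add) (simp_all add: comp_def)
    then show "continuous_map (prod_topology P P) D (\<lambda>z. S (case z of (x, y) \<Rightarrow> x + y))"
      by (rule continuous_map_eq) (auto simp: topP add)
  qed
  moreover have "continuous_map (prod_topology euclidean P) P (\<lambda>(c, x). dscl c x)"
  proof (rule contP)
    have fst: "continuous_map (prod_topology euclidean P) euclidean (fst :: 'k \<times> _ \<Rightarrow> _)"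
      and snd: "continuous_map (prod_topology (euclidean :: 'k topology) P) P snd"
      by (auto simp: continuous_map_fst continuous_map_snd)
    have "continuous_map (prod_topology euclidean P) D (\<lambda>z. dscl (fst z) (snd z))"
      using continuous_map_compose[OF snd idP] fst
      by (intro D.cont_scl) (simp_all add: comp_def)
    then show "continuous_map (prod_topology euclidean P) D (\<lambda>(c, x). dscl c x)" by (simp add: case_prod_unfold)
    have "continuous_map (prod_topology euclidean P) D (\<lambda>z. dscl (fst z) (S (snd z)))"
      using continuous_map_compose[OF snd SP] fst
      by (intro D.cont_scl) (simp_all add: comp_def)
    then show "continuous_map (prod_topology euclidean P) D (\<lambda>z. S (case z of (c, x) \<Rightarrow> dscl c x))"
      by (rule continuous_map_eq) (auto simp: topP scale)
  qed
  moreover have "neighbourhood_base_at 0 (convex_wrt dscl) P"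
    unfolding neighbourhood_base_at_def
  proof (intro allI impI, elim conjE)
    fix A assume A: "openin P A" "0 \<in> A"
    then obtain A' where A': "openin (prod_topology D D) A'" "A = (\<lambda>z. (z, S z)) -` A' \<inter> ?C"
      unfolding P_def openin_pullback_topology by blast
    have "(0, 0) \<in> A'" using A(2) A'(2) S0 by simp
    then have "\<exists>U V. openin D U \<and> openin D V \<and> 0 \<in> U \<and> 0 \<in> V \<and> U \<times> V \<subseteq> A'"
      by (rule A'(1)[unfolded openin_prod_topology_alt, rule_format])
    then obtain U V where UV: "openin D U" "openin D V" "0 \<in> U" "0 \<in> V" "U \<times> V \<subseteq> A'" by blast
    have base: "\<exists>G H. openin D G \<and> convex_wrt dscl H \<and> 0 \<in> G \<and> G \<subseteq> H \<and> H \<subseteq> U" if "openin D U" "0 \<in> U" for U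
      using D.lcs that unfolding locally_convex_space_def neighbourhood_base_at_def by simp
    from base[OF UV(1,3)] obtain G H where GH: "openin D G" "convex_wrt dscl H" "0 \<in> G" "G \<subseteq> H" "H \<subseteq> U" by blast
    from base[OF UV(2,4)] obtain G' H' where GH': "openin D G'" "convex_wrt dscl H'" "0 \<in> G'" "G' \<subseteq> H'" "H' \<subseteq> V" by blast
    let ?G = "{z \<in> topspace P. z \<in> G} \<inter> {z \<in> topspace P. S z \<in> G'}"
    let ?H = "{z \<in> ?C. z \<in> H \<and> S z \<in> H'}"
    have "openin P ?G"
      using openin_continuous_map_preimage[OF idP GH(1)] openin_continuous_map_preimage[OF SP GH'(1)] by blast
    moreover have "convex_wrt dscl ?H"
      using GH(2) GH'(2) unfolding convex_wrt_def by (simp add: add scale)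
    moreover have "0 \<in> ?G" using GH(3) GH'(3) S0 by (simp add: topP)
    moreover have "?G \<subseteq> ?H" using GH(4) GH'(4) by (auto simp: topP)
    moreover have "?H \<subseteq> A" using subsetD[OF GH(5)] subsetD[OF GH'(5)] subsetD[OF UV(5)] A'(2) by simp blast
    ultimately show "\<exists>U V. openin P U \<and> convex_wrt dscl V \<and> 0 \<in> U \<and> U \<subseteq> V \<and> V \<subseteq> A" by meson
  qed
  moreover have "embedding_map (X n) P (emb n)" for n
  proof -
    have cP: "continuous_map (X n) P (emb n)" by (rule contP[OF emb_continuous cont])
    have "embedding_map (X n) D (emb n)" using candidate_D by (simp add: direct_sum_candidate_def)
    then obtain g where g: "homeomorphic_maps (X n) (subtopology D (emb n ` topspace (X n))) (emb n) g"
      unfolding embedding_map_def homeomorphic_map_maps by blast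
    \<comment> \<open>\<open>P\<close> is finer than \<open>D\<close>, so the inverse of the
      embedding remains continuous; only continuity into \<open>P\<close> had to be checked
      anew.\<close>
    have "continuous_map (subtopology P A) (subtopology D A) id" for A
      using idP by (auto simp: continuous_map_in_subtopology continuous_map_from_subtopology id_def)
    then have "continuous_map (subtopology P (emb n ` topspace (X n))) (X n) (g \<circ> id)"
      using g by (intro continuous_map_compose) (auto simp: homeomorphic_maps_def)
    with g cP have "homeomorphic_maps (X n) (subtopology P (emb n ` topspace (X n))) (emb n) g"
      by (auto simp: homeomorphic_maps_def continuous_map_in_subtopology topP)
    then show ?thesis unfolding embedding_map_def homeomorphic_map_maps by blast
  qed
  moreover have "?C \<noteq> {0}"
    using D.lcs by (simp add: locally_convex_space_def topological_vector_space_def)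
  ultimately have "direct_sum_candidate scl X P"
    unfolding direct_sum_candidate_def locally_convex_space_def topological_vector_space_def topP
    using D.subspace_V D.vector_space_axioms topspace_D by blast
  then have finer: "openin P U \<Longrightarrow> openin D U" for U
    using direct_sum unfolding locally_convex_direct_sum_def coarser_def by blast
  show ?thesis
    using SP finer S unfolding continuous_map_def topP by blast
qed

end

text \<open>The basis vectors of all summands are arranged in chains. The entry \<open>(c, j)\<close> of chain
  \<open>c\<close> lives in the summand \<open>chain_level c - j\<close>, with truncated subtraction: read against the
  direction of the shift, chain \<open>c\<close> descends to the summand 0 and stays there. There are
  infinitely many chains starting at each level.\<close>

definition chain_level :: "nat \<Rightarrow> nat" where
  "chain_level c = fst (prod_decode c)"

definition level_set :: "nat \<Rightarrow> (nat \<times> nat) set" where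
  "level_set n = {(c, j). chain_level c - j = n}"

text \<open>The heads of the chains starting at level \<open>n\<close> suffice. Infinitude makes the
  enumeration of a level a bijection with the naturals, so that each basis vector of each summand
  occupies exactly one place in exactly one chain.\<close>

lemma infinite_level_set: "infinite (level_set n)"
proof -
  have "inj (\<lambda>b. (prod_encode (n, b), 0::nat))" by (auto simp: inj_on_def)
  moreover have "range (\<lambda>b. (prod_encode (n, b), 0::nat)) \<subseteq> level_set n"
    by (auto simp: level_set_def chain_level_def)
  ultimately show ?thesis using finite_subset range_inj_infinite by blast
qed

definition entry :: "nat \<Rightarrow> nat \<Rightarrow> nat \<times> nat" where
  "entry n = from_nat_into (level_set n)"

definition index :: "nat \<Rightarrow> nat \<times> nat \<Rightarrow> nat" where
  "index n = to_nat_on (level_set n)"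

lemma entry_in: "entry n i \<in> level_set n"
  unfolding entry_def using infinite_level_set[of n] by (intro from_nat_into) auto

lemma index_entry [simp]: "index n (entry n i) = i"
  by (simp add: index_def entry_def infinite_level_set)

lemma entry_index: "e \<in> level_set n \<Longrightarrow> entry n (index n e) = e"
  by (simp add: index_def entry_def)

lemma index_eq_iff: "e \<in> level_set n \<Longrightarrow> e' \<in> level_set n \<Longrightarrow> index n e = index n e' \<longleftrightarrow> e = e'"
  by (metis entry_index)

lemma in_level_set: "(c, j) \<in> level_set (chain_level c - j)"
  by (simp add: level_set_def)

lemma level_set_Suc: "(c, j) \<in> level_set n \<Longrightarrow> (c, Suc j) \<in> level_set (n - 1)"
  by (auto simp: level_set_def)

section \<open>The weighted shift and its continuity\<close>

locale framed_sum = lc_direct_sum scl X D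
  for scl :: "'k::real_or_complex \<Rightarrow> 'a::ab_group_add \<Rightarrow> 'a"
    and X :: "nat \<Rightarrow> 'a topology" and D :: "(nat \<Rightarrow>\<^sub>0 'a) topology" +
  fixes p :: "nat \<Rightarrow> 'a \<Rightarrow> real" and g :: "nat \<Rightarrow> nat \<Rightarrow> 'a" and f :: "nat \<Rightarrow> nat \<Rightarrow> 'a \<Rightarrow> 'k"
    and C :: "nat \<Rightarrow> nat \<Rightarrow> real" and \<Phi> :: "nat \<Rightarrow> (nat \<Rightarrow> 'k) \<Rightarrow> 'a"
  assumes frame: "\<And>n. X.biorthogonal n (p n) (g n) (f n) (C n) (\<Phi> n)"
begin

lemma cts_p: "cts_seminorm scl (X n) (p n)"
  and l1_map: "X.l1_map n (g n) (\<Phi> n)"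
  and dense: "X n closure_of X.span (range (g n)) = topspace (X n)"
  and functional: "X.functional n (f n i)"
  and C: "0 \<le> C n i"
  and f_le: "z \<in> topspace (X n) \<Longrightarrow> norm (f n i z) \<le> C n i * p n z"
  and fg: "f n i (g n j) = (if i = j then 1 else 0)"
  using frame[of n] by (auto simp: X.biorthogonal_def)

lemma seminorm_p: "seminorm_on scl (topspace (X n)) (p n)"
  using cts_p by (simp add: cts_seminorm_def)

lemma g_in_X [simp]: "g n i \<in> topspace (X n)"
  by (rule X.l1_map_in_V[OF l1_map])

text \<open>Coordinate \<open>i\<close> of the summand \<open>m\<close> is fed from the next deeper
  entry of its chain, which lies in the summand \<open>m - 1\<close>. For \<open>m = 0\<close>
  truncated subtraction makes this the summand 0 again.\<close>

definition source :: "nat \<Rightarrow> nat \<Rightarrow> nat" where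
  "source m i = index (m - 1) (fst (entry m i), Suc (snd (entry m i)))"

text \<open>The power of 1/2 makes the coefficients summable, and the denominator absorbs the bound
  of the functional that is read.\<close>

definition weight :: "nat \<Rightarrow> nat \<Rightarrow> real" where
  "weight m i = (1/2) ^ i / (1 + C (m - 1) (source m i))"

lemma weight_pos: "0 < weight m i"
  using C by (auto simp: weight_def intro!: divide_pos_pos add_pos_nonneg)

definition coeffs :: "nat \<Rightarrow> 'a \<Rightarrow> nat \<Rightarrow> 'k" where
  "coeffs m z i = of_real (weight m i) * f (m - 1) (source m i) z"

lemma coeffs_le:
  assumes z: "z \<in> topspace (X (m - 1))"
  shows "norm (coeffs m z i) \<le> (1/2) ^ i * p (m - 1) z"
proof -
  let ?C = "C (m - 1) (source m i)"
  have pz: "0 \<le> p (m - 1) z" by (rule X.seminorm_nonneg[OF seminorm_p z])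
  have C0: "0 \<le> ?C" by (rule C)
  have "norm (coeffs m z i) = weight m i * norm (f (m - 1) (source m i) z)"
    using weight_pos[of m i] by (simp add: coeffs_def norm_mult)
  also have "\<dots> \<le> weight m i * (?C * p (m - 1) z)"
    using f_le[OF z] weight_pos[of m i] by (intro mult_left_mono) auto
  also have "\<dots> = (1/2) ^ i * p (m - 1) z * (?C / (1 + ?C))" by (simp add: weight_def)
  also have "\<dots> \<le> (1/2) ^ i * p (m - 1) z * 1"
    using pz C0 by (intro mult_left_mono) auto
  finally show ?thesis by simp
qed

lemma coeffs_l1:
  assumes z: "z \<in> topspace (X (m - 1))"
  shows "l1 (coeffs m z)" and "l1_norm (coeffs m z) \<le> 2 * p (m - 1) z"
proof -
  have s: "(\<lambda>i. (1/2) ^ i * p (m - 1) z) sums (2 * p (m - 1) z)"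
    using sums_mult2[OF geometric_sums[of "1/2 :: real"], of "p (m - 1) z"] by simp
  show l: "l1 (coeffs m z)"
    by (rule summable_comparison_test'[OF sums_summable[OF s], where N = 0])
      (simp only: real_norm_def abs_norm_cancel coeffs_le[OF z])
  have "l1_norm (coeffs m z) \<le> suminf (\<lambda>i. (1/2) ^ i * p (m - 1) z)"
    unfolding l1_norm_def by (intro suminf_le coeffs_le z l sums_summable[OF s])
  then show "l1_norm (coeffs m z) \<le> 2 * p (m - 1) z" using sums_unique[OF s] by simp
qed

definition step :: "nat \<Rightarrow> 'a \<Rightarrow> 'a" where
  "step m z = \<Phi> m (coeffs m z)"

lemma step_in_X [simp]: "z \<in> topspace (X (m - 1)) \<Longrightarrow> step m z \<in> topspace (X m)"
  unfolding step_def by (intro X.l1_mapD(1)[OF l1_map] coeffs_l1)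

lemma step_add:
  assumes "x \<in> topspace (X (m - 1))" "y \<in> topspace (X (m - 1))"
  shows "step m (x + y) = step m x + step m y"
proof -
  have "coeffs m (x + y) = (\<lambda>i. coeffs m x i + coeffs m y i)"
    using X.functionalD(1)[OF functional assms] by (simp add: coeffs_def fun_eq_iff distrib_left)
  then show ?thesis
    using X.l1_mapD(2)[OF l1_map coeffs_l1(1)[OF assms(1)] coeffs_l1(1)[OF assms(2)]] by (simp add: step_def)
qed

lemma step_scale:
  assumes "x \<in> topspace (X (m - 1))"
  shows "step m (scl c x) = scl c (step m x)"
proof -
  have "coeffs m (scl c x) = (\<lambda>i. c * coeffs m x i)"
    using X.functionalD(2)[OF functional assms] by (simp add: coeffs_def fun_eq_iff)
  then show ?thesis
    using X.l1_mapD(3)[OF l1_map coeffs_l1(1)[OF assms]] by (simp add: step_def)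
qed

lemma step_0 [simp]: "step m 0 = 0"
  using step_scale[of 0 m 0] by simp

text \<open>Each continuous \<open>q\<close> on the target, composed with the map, is at most a
  multiple of the one seminorm \<open>p (m - 1)\<close>, because that seminorm dominates all the
  functionals involved and hence the l1 norm of the coefficients.\<close>

lemma continuous_step: "continuous_map (X (m - 1)) (X m) (step m)"
proof -
  have "openin (X (m - 1)) {x \<in> topspace (X (m - 1)). step m x \<in> U}" if U: "openin (X m) U" for U
  proof (subst openin_subopen, intro ballI)
    fix x assume x: "x \<in> {x \<in> topspace (X (m - 1)). step m x \<in> U}"
    then obtain q where q: "cts_seminorm scl (X m) q" "\<forall>y\<in>topspace (X m). q (y - step m x) < 1 \<longrightarrow> y \<in> U"
      using X.seminorm_nhds[OF U] by blast
    obtain K where K: "0 \<le> K" "\<And>a. l1 a \<Longrightarrow> q (\<Phi> m a) \<le> K * l1_norm a"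
      using X.l1_mapD(5)[OF l1_map q(1)] by blast
    let ?q = "\<lambda>y. 2 * K * p (m - 1) y"
    have q': "cts_seminorm scl (X (m - 1)) ?q" using K(1) by (intro X.cts_seminorm_scale cts_p) auto
    let ?N = "{y \<in> topspace (X (m - 1)). ?q (y - x) < 1}"
    have "openin (X (m - 1)) ?N" using X.cts_seminorm_ball[OF q'] x by blast
    moreover have "x \<in> ?N" using x X.seminorm_0[OF seminorm_p] by simp
    moreover have "?N \<subseteq> {x \<in> topspace (X (m - 1)). step m x \<in> U}"
    proof
      fix y assume y: "y \<in> ?N"
      then have yx: "y - x \<in> topspace (X (m - 1))" using x by auto
      have "q (step m (y - x)) \<le> K * l1_norm (coeffs m (y - x))"
        unfolding step_def by (intro K(2) coeffs_l1 yx)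
      also have "\<dots> \<le> K * (2 * p (m - 1) (y - x))" by (intro mult_left_mono coeffs_l1 yx K)
      also have "\<dots> < 1" using y by (simp add: mult_ac)
      also have "step m (y - x) = step m y - step m x"
        using step_add[OF yx, of x] x by simp
      finally show "y \<in> {x \<in> topspace (X (m - 1)). step m x \<in> U}" using q(2) y by auto
    qed
    ultimately show "\<exists>N. openin (X (m - 1)) N \<and> x \<in> N \<and> N \<subseteq> {x \<in> topspace (X (m - 1)). step m x \<in> U}" by blast
  qed
  then show ?thesis by (simp add: continuous_map_def)
qed

text \<open>By truncated subtraction the coordinate 0 feeds both the coordinate 1 and, through
  \<open>step 0\<close>, itself: chains either leave the summand 0 or run on inside it.\<close>

definition shift :: "(nat \<Rightarrow>\<^sub>0 'a) \<Rightarrow> (nat \<Rightarrow>\<^sub>0 'a)" where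
  "shift z = Abs_poly_mapping (\<lambda>m. step m (coord z (m - 1)))"

lemma coord_shift [simp]: "coord (shift z) m = step m (coord z (m - 1))"
proof -
  have "{m. step m (coord z (m - 1)) \<noteq> 0} \<subseteq> insert 0 (Suc ` Poly_Mapping.keys z)"
  proof
    fix m assume "m \<in> {m. step m (coord z (m - 1)) \<noteq> 0}"
    then have "coord z (m - 1) \<noteq> 0" by auto
    then show "m \<in> insert 0 (Suc ` Poly_Mapping.keys z)"
      by (cases m) (auto simp: in_keys_iff)
  qed
  then have "finite {m. step m (coord z (m - 1)) \<noteq> 0}" by (rule finite_subset) simp
  then show ?thesis by (simp add: shift_def)
qed

lemma shift_in_D [simp]: "z \<in> topspace D \<Longrightarrow> shift z \<in> topspace D"
  by (rule in_D) simp

lemma shift_add: "x \<in> topspace D \<Longrightarrow> y \<in> topspace D \<Longrightarrow> shift (x + y) = shift x + shift y"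
  by (rule poly_mapping_eqI) (simp add: lookup_add step_add)

lemma shift_scale: "x \<in> topspace D \<Longrightarrow> shift (dscl c x) = dscl c (shift x)"
  by (rule poly_mapping_eqI) (simp add: step_scale)

lemma shift_emb:
  "shift (emb n x) = emb (Suc n) (step (Suc n) x) + (if n = 0 then emb 0 (step 0 x) else 0)"
proof (rule poly_mapping_eqI)
  fix m
  show "coord (shift (emb n x)) m = coord (emb (Suc n) (step (Suc n) x) + (if n = 0 then emb 0 (step 0 x) else 0)) m"
    by (cases m) (auto simp: lookup_add lookup_single when_def)
qed

definition oper :: "(nat \<Rightarrow>\<^sub>0 'a) \<Rightarrow> (nat \<Rightarrow>\<^sub>0 'a)" where
  "oper z = z + shift z"

lemma oper_in_D [simp]: "z \<in> topspace D \<Longrightarrow> oper z \<in> topspace D"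
  by (simp add: oper_def)

lemma oper_add: "x \<in> topspace D \<Longrightarrow> y \<in> topspace D \<Longrightarrow> oper (x + y) = oper x + oper y"
  by (simp add: oper_def shift_add add_ac)

lemma oper_scale: "x \<in> topspace D \<Longrightarrow> oper (dscl c x) = dscl c (oper x)"
  by (simp add: oper_def shift_scale D.scale_right_distrib)

lemma linear_oper: "linear_between dscl dscl (topspace D) oper"
  by (simp add: linear_between_def oper_add oper_scale)

lemma oper_0 [simp]: "oper 0 = 0"
  using oper_scale[of 0 0] by simp

lemma oper_sum: "(\<And>i. i \<in> A \<Longrightarrow> u i \<in> topspace D) \<Longrightarrow> oper (sum u A) = (\<Sum>i\<in>A. oper (u i))"
  by (induction A rule: infinite_finite_induct) (auto simp: oper_add)

lemma continuous_oper: "continuous_map D D oper"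
proof (rule linear_continuous[OF linear_oper])
  fix n
  have s: "continuous_map (X n) D (\<lambda>x. emb (Suc n) (step (Suc n) x))"
    using continuous_map_compose[OF _ emb_continuous, of "X n" "Suc n"] continuous_step[of "Suc n"]
    by (simp add: comp_def)
  show "continuous_map (X n) D (\<lambda>x. oper (emb n x))"
  proof (cases "n = 0")
    case True
    have "continuous_map (X 0) D (\<lambda>x. emb 0 (step 0 x))"
      using continuous_map_compose[OF _ emb_continuous, of "X 0" 0] continuous_step[of 0]
      by (simp add: comp_def)
    then show ?thesis
      unfolding oper_def shift_emb using True s
      by (intro D.cont_add emb_continuous) auto
  next
    case False
    then show ?thesis
      unfolding oper_def shift_emb using s by (intro D.cont_add emb_continuous) auto
  qed
qed simp

section \<open>The chain basis and the action of the operator in it\<close>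

abbreviation lev where "lev c j \<equiv> chain_level c - j"

definition G :: "nat \<Rightarrow> nat \<Rightarrow> 'a" where
  "G c j = g (lev c j) (index (lev c j) (c, j))"

lemma G_in_X [simp]: "G c j \<in> topspace (X (lev c j))"
  by (simp add: G_def)

text \<open>By biorthogonality only the coefficient whose \<open>source\<close> is the given entry
  survives, and \<open>source\<close> determines its target. If \<open>lev c j = 0\<close>, both
  \<open>m = 0\<close> and \<open>m = 1\<close> satisfy the premise, but at most one of them is the
  level of the preceding entry; the inner case distinction picks it.\<close>

lemma step_G:
  assumes "m - 1 = lev c j"
  shows "step m (G c j) = (case j of 0 \<Rightarrow> 0 | Suc i \<Rightarrow>
    if m = lev c i then scl (of_real (weight m (index m (c, i)))) (G c i) else 0)"
proof -
  have src: "source m l = index (m - 1) (c, j) \<longleftrightarrow> (\<exists>i. j = Suc i \<and> m = lev c i \<and> l = index m (c, i))" for l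
  proof -
    obtain c' j' where e: "entry m l = (c', j')" by fastforce
    have mem: "(c', j') \<in> level_set m" using entry_in[of m l] e by simp
    have "source m l = index (m - 1) (c, j) \<longleftrightarrow> (c', Suc j') = (c, j)"
      unfolding source_def e using level_set_Suc[OF mem] in_level_set[of c j] assms
      by (simp add: index_eq_iff)
    also have "\<dots> \<longleftrightarrow> (\<exists>i. j = Suc i \<and> (c', j') = (c, i))" by auto
    also have "\<dots> \<longleftrightarrow> (\<exists>i. j = Suc i \<and> m = lev c i \<and> l = index m (c, i))"
    proof (intro iff_exI conj_cong refl)
      fix i
      show "(c', j') = (c, i) \<longleftrightarrow> m = lev c i \<and> l = index m (c, i)"
      proof
        assume "(c', j') = (c, i)"
        then show "m = lev c i \<and> l = index m (c, i)"
          using mem index_entry[of m l] unfolding e by (simp add: level_set_def)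
      next
        assume "m = lev c i \<and> l = index m (c, i)"
        then have "(c, i) \<in> level_set m" and l: "l = index m (c, i)" by (simp_all add: level_set_def)
        then show "(c', j') = (c, i)" using entry_index[of "(c, i)" m] unfolding e[symmetric] l by simp
      qed
    qed
    finally show ?thesis .
  qed
  have co: "coeffs m (G c j) l = (if \<exists>i. j = Suc i \<and> m = lev c i \<and> l = index m (c, i) then of_real (weight m l) else 0)" for l
    unfolding coeffs_def G_def assms[symmetric] fg src
    by (cases "\<exists>i. j = Suc i \<and> m = lev c i \<and> l = index m (c, i)") (simp_all only: if_True if_False mult_1_right mult_zero_right)
  show ?thesis
  proof (cases "\<exists>i. j = Suc i \<and> m = lev c i")
    case False
    have "l1 (\<lambda>_. 0 :: 'k)" by simp
    from X.l1_mapD(3)[OF l1_map this, of m 0] have "\<Phi> m (\<lambda>_. 0) = 0" by simp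
    moreover have "coeffs m (G c j) = (\<lambda>_. 0)" using False co by (auto simp: fun_eq_iff)
    ultimately show ?thesis using False by (auto simp: step_def split: nat.split)
  next
    case True
    then obtain i where i: "j = Suc i" "m = lev c i" by blast
    let ?l = "index m (c, i)"
    have "coeffs m (G c j) = (\<lambda>l. of_real (weight m ?l) * (if l = ?l then 1 else 0))"
      using co i by (auto simp: fun_eq_iff)
    then have "step m (G c j) = scl (of_real (weight m ?l)) (g m ?l)"
      using X.l1_mapD(3)[OF l1_map X.l1_unit[of ?l]] X.l1_mapD(4)[OF l1_map] by (simp add: step_def)
    then show ?thesis using i by (simp add: G_def)
  qed
qed

text \<open>The scaling cancels the weights along a chain, so that \<open>shift\<close> maps
  \<open>H c (Suc j)\<close> exactly to \<open>H c j\<close>. However fast it grows in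
  \<open>j\<close> does no harm, since all smallness is measured by \<open>jet_norm\<close> with
  these very factors.\<close>

fun W :: "nat \<Rightarrow> nat \<Rightarrow> real" where
  "W c 0 = 1"
| "W c (Suc j) = W c j / weight (lev c j) (index (lev c j) (c, j))"

lemma W_pos: "0 < W c j"
  by (induction j) (auto simp: weight_pos)

definition H :: "nat \<Rightarrow> nat \<Rightarrow> (nat \<Rightarrow>\<^sub>0 'a)" where
  "H c j = emb (lev c j) (scl (of_real (W c j)) (G c j))"

lemma H_in_D [simp]: "H c j \<in> topspace D"
  by (simp add: H_def)

lemma shift_H: "shift (H c j) = (case j of 0 \<Rightarrow> 0 | Suc i \<Rightarrow> H c i)"
proof (rule poly_mapping_eqI)
  fix m
  show "coord (shift (H c j)) m = coord (case j of 0 \<Rightarrow> 0 | Suc i \<Rightarrow> H c i) m"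
  proof (cases "m - 1 = lev c j")
    case True
    have "coord (shift (H c j)) m = scl (of_real (W c j)) (step m (G c j))"
      unfolding coord_shift H_def using True by (simp add: step_scale)
    also have "\<dots> = coord (case j of 0 \<Rightarrow> 0 | Suc i \<Rightarrow> H c i) m"
    proof (cases j)
      case (Suc i)
      have "W c (Suc i) * weight (lev c i) (index (lev c i) (c, i)) = W c i"
        using weight_pos[of "lev c i" "index (lev c i) (c, i)"] by simp
      then show ?thesis
        using step_G[OF True] Suc
        by (auto simp: H_def lookup_single when_def simp del: W.simps of_real_mult simp flip: of_real_mult)
    next
      case 0
      then show ?thesis using step_G[OF True] by simp
    qed
    finally show ?thesis .
  next
    case False
    then have "coord (shift (H c j)) m = 0" unfolding coord_shift H_def by (simp add: lookup_single when_def)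
    moreover have "coord (H c i) m = 0" if "j = Suc i" for i
      using False that by (auto simp: H_def lookup_single when_def)
    ultimately show ?thesis by (auto split: nat.split)
  qed
qed

definition vec :: "nat \<Rightarrow> (nat \<Rightarrow> int \<Rightarrow> 'k) \<Rightarrow> int \<Rightarrow> (nat \<Rightarrow>\<^sub>0 'a)" where
  "vec N P t = (\<Sum>c<N. \<Sum>j<N. dscl ((fwd_diff ^^ j) (P c) t) (H c j))"

lemma vec_in_D [simp]: "vec N P t \<in> topspace D"
  unfolding vec_def by (intro D.sum_V D.scale_V H_in_D)

lemma vec_add: "vec N (\<lambda>c t. P c t + Q c t) t = vec N P t + vec N Q t"
  by (simp add: vec_def fwd_diff_pow_add D.scale_left_distrib sum.distrib)

lemma vec_diff: "vec N (\<lambda>c t. P c t - Q c t) t = vec N P t - vec N Q t"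
  by (simp add: vec_def fwd_diff_pow_diff D.scale_left_diff_distrib sum_subtractf)

lemma vec_shift: "vec N (\<lambda>c t. P c (t + k)) t = vec N P (t + k)"
  by (simp add: vec_def fwd_diff_pow_shift)

text \<open>The operator adds the coefficient of \<open>H c (Suc j)\<close> to that of
  \<open>H c j\<close>, and the sum of the differences of order j and j + 1 at \<open>t\<close> is
  the difference of order j at \<open>t + 1\<close>. Nothing is lost at the edge of the square
  because differences of order \<open>N\<close> vanish.\<close>

lemma oper_vec:
  assumes "poly_family N P"
  shows "oper (vec N P t) = vec N P (t + 1)"
proof -
  have tele: "(\<Sum>j<M. oper (dscl (a j) (H c j))) =
      (\<Sum>j<M. dscl (a j) (H c j)) + (\<Sum>j<M - 1. dscl (a (Suc j)) (H c j))" for a c M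
  proof (induction M)
    case (Suc M)
    have "oper (dscl (a M) (H c M)) = dscl (a M) (H c M) + (case M of 0 \<Rightarrow> 0 | Suc i \<Rightarrow> dscl (a M) (H c i))"
      by (simp add: oper_def shift_scale shift_H split: nat.split)
    then show ?case using Suc by (cases M) (auto simp: algebra_simps)
  qed simp
  have *: "(\<Sum>j<N. oper (dscl ((fwd_diff ^^ j) (P c) t) (H c j))) =
      (\<Sum>j<N. dscl ((fwd_diff ^^ j) (P c) t) (H c j)) + (\<Sum>j<N - 1. dscl ((fwd_diff ^^ Suc j) (P c) t) (H c j))" for c
    by (rule tele[where a = "\<lambda>j. (fwd_diff ^^ j) (P c) t"])
  have "oper (vec N P t) = (\<Sum>c<N. \<Sum>j<N. oper (dscl ((fwd_diff ^^ j) (P c) t) (H c j)))"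
    unfolding vec_def by (subst oper_sum, intro D.sum_V D.scale_V H_in_D, intro sum.cong refl oper_sum D.scale_V H_in_D)
  also have "\<dots> = (\<Sum>c<N. \<Sum>j<N. dscl ((fwd_diff ^^ j) (P c) (t + 1)) (H c j))"
    unfolding *
  proof (intro sum.cong refl)
    fix c
    have "(\<Sum>j<N - 1. dscl ((fwd_diff ^^ Suc j) (P c) t) (H c j)) = (\<Sum>j<N. dscl ((fwd_diff ^^ Suc j) (P c) t) (H c j))"
      using poly_family_fwd_diff_eq_0[OF assms, of c N t] by (cases N) auto
    moreover have "(fwd_diff ^^ j) (P c) (t + 1) = (fwd_diff ^^ j) (P c) t + (fwd_diff ^^ Suc j) (P c) t" for j
      unfolding fwd_diff_pow_Suc by simp
    ultimately show "(\<Sum>j<N. dscl ((fwd_diff ^^ j) (P c) t) (H c j)) + (\<Sum>j<N - 1. dscl ((fwd_diff ^^ Suc j) (P c) t) (H c j))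
        = (\<Sum>j<N. dscl ((fwd_diff ^^ j) (P c) (t + 1)) (H c j))"
      by (simp only: D.scale_left_distrib sum.distrib)
  qed
  finally show ?thesis by (simp add: vec_def)
qed

lemma oper_pow_vec: "poly_family N P \<Longrightarrow> (oper ^^ k) (vec N P 0) = vec N P (int k)"
  by (induction k) (simp_all add: oper_vec add.commute)

lemma continuous_oper_pow: "continuous_map D D (oper ^^ k)"
  by (induction k) (simp_all only: funpow.simps continuous_map_id continuous_map_compose[OF _ continuous_oper])

lemma oper_pow_in_D: "x \<in> topspace D \<Longrightarrow> (oper ^^ k) x \<in> topspace D"
  by (induction k) auto

text \<open>In one summand the basis vectors are bounded for every continuous seminorm. The
  constants of different summands are unrelated, so uniformity is available only over finitely many
  levels.\<close>

lemma H_bound: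
  assumes q: "cts_seminorm dscl D q"
  shows "\<exists>B\<ge>0. \<forall>c j. lev c j \<le> m \<longrightarrow> q (H c j) \<le> B * W c j"
proof -
  have "\<forall>n. \<exists>B\<ge>0. \<forall>i. q (emb n (g n i)) \<le> B"
    using X.l1_map_bounded[OF l1_map seminorm_emb[OF q]] by blast
  from choice[OF this] obtain B where B: "\<And>n. 0 \<le> B n" "\<And>n i. q (emb n (g n i)) \<le> B n" by blast
  have "q (H c j) \<le> (\<Sum>n\<le>m. B n) * W c j" if "lev c j \<le> m" for c j
  proof -
    have "q (H c j) = W c j * q (emb (lev c j) (G c j))"
      unfolding H_def emb_scale using q W_pos[of c j] by (simp add: D.seminorm_scale cts_seminorm_def)
    also have "\<dots> \<le> W c j * (\<Sum>n\<le>m. B n)"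
    proof (intro mult_left_mono)
      have "q (emb (lev c j) (G c j)) \<le> B (lev c j)" unfolding G_def by (rule B)
      also have "\<dots> \<le> (\<Sum>n\<le>m. B n)" using that B(1) by (intro member_le_sum) auto
      finally show "q (emb (lev c j) (G c j)) \<le> (\<Sum>n\<le>m. B n)" .
    qed (use W_pos[of c j] in simp)
    finally show ?thesis by (simp add: mult.commute)
  qed
  then show ?thesis using B(1) by (intro exI[of _ "\<Sum>n\<le>m. B n"]) (auto intro: sum_nonneg)
qed

lemma vec_bound:
  assumes q: "cts_seminorm dscl D q" and B: "\<And>c j. lev c j \<le> m \<Longrightarrow> q (H c j) \<le> B * W c j"
    and zero: "\<And>c j. m < lev c j \<Longrightarrow> (fwd_diff ^^ j) (F c) t = 0"
  shows "q (vec N F t) \<le> B * jet_norm W N F t"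
proof -
  have sn: "seminorm_on dscl (topspace D) q" using q by (simp add: cts_seminorm_def)
  have "q (vec N F t) \<le> (\<Sum>c<N. q (\<Sum>j<N. dscl ((fwd_diff ^^ j) (F c) t) (H c j)))"
    unfolding vec_def by (intro D.seminorm_sum[OF sn]) auto
  also have "\<dots> \<le> (\<Sum>c<N. \<Sum>j<N. q (dscl ((fwd_diff ^^ j) (F c) t) (H c j)))"
    by (intro sum_mono D.seminorm_sum[OF sn]) auto
  also have "\<dots> \<le> (\<Sum>c<N. \<Sum>j<N. B * (W c j * norm ((fwd_diff ^^ j) (F c) t)))"
  proof (intro sum_mono)
    fix c j
    show "q (dscl ((fwd_diff ^^ j) (F c) t) (H c j)) \<le> B * (W c j * norm ((fwd_diff ^^ j) (F c) t))"
    proof (cases "lev c j \<le> m")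
      case True
      have "q (dscl ((fwd_diff ^^ j) (F c) t) (H c j)) = norm ((fwd_diff ^^ j) (F c) t) * q (H c j)"
        by (rule D.seminorm_scale[OF sn H_in_D])
      also have "\<dots> \<le> norm ((fwd_diff ^^ j) (F c) t) * (B * W c j)"
        by (intro mult_left_mono B True) auto
      finally show ?thesis by (simp add: mult_ac)
    next
      case False
      then show ?thesis using zero[of c j] D.seminorm_0[OF sn] by simp
    qed
  qed
  finally show ?thesis by (simp add: jet_norm_def sum_distrib_left)
qed

end

section \<open>A dense orbit\<close>

lemma fwd_diff_gbinomial:
  "fwd_diff (\<lambda>t. (of_int t gchoose Suc k) :: 'k::field_char_0) = (\<lambda>t. of_int t gchoose k)"
  by (simp add: fwd_diff_def fun_eq_iff gbinomial_Suc_Suc)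

text \<open>At 0 these differences form a Kronecker delta. The function
  \<open>of_int t gchoose j\<close> on chain \<open>c\<close> therefore represents the single vector
  \<open>H c j\<close> at time 0.\<close>

lemma fwd_diff_pow_gbinomial:
  "(fwd_diff ^^ i) (\<lambda>t. (of_int t gchoose k) :: 'k::field_char_0) =
     (if i \<le> k then (\<lambda>t. of_int t gchoose (k - i)) else (\<lambda>_. 0))"
proof (induction i)
  case (Suc i)
  show ?case
  proof (cases "i < k")
    case True
    then obtain m where "k - i = Suc m" "k - Suc i = m" by (metis Suc_diff_Suc)
    then show ?thesis using Suc True by (simp add: fwd_diff_gbinomial)
  next
    case False
    then show ?thesis using Suc by (cases "i = k") (auto simp: fwd_diff_def fun_eq_iff)
  qed
qed simp

section \<open>Countably many targets and the coefficients of the starting vector\<close>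

context framed_sum
begin

text \<open>A list of triples (chain, depth, index of a scalar) codes a finite combination of the
  \<open>H c j\<close> with coefficients from the countable dense set \<open>r\<close>. Lists are
  countable, which allows \<open>from_nat\<close> to enumerate the targets; repeated entries simply
  add up.\<close>

fun target_poly :: "(nat \<Rightarrow> 'k) \<Rightarrow> (nat \<times> nat \<times> nat) list \<Rightarrow> nat \<Rightarrow> int \<Rightarrow> 'k" where
  "target_poly r [] = (\<lambda>_ _. 0)"
| "target_poly r ((c, j, a) # L) =
     (\<lambda>c' t. (if c' = c then r a * (of_int t gchoose j) else 0) + target_poly r L c' t)"

fun target :: "(nat \<Rightarrow> 'k) \<Rightarrow> (nat \<times> nat \<times> nat) list \<Rightarrow> (nat \<Rightarrow>\<^sub>0 'a)" where
  "target r [] = 0"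
| "target r ((c, j, a) # L) = dscl (r a) (H c j) + target r L"

lemma target_in_D [simp]: "target r L \<in> topspace D"
  by (induction r L rule: target.induct) auto

lemma target_append: "target r (L @ L') = target r L + target r L'"
  by (induction r L rule: target.induct) (auto simp: add.assoc)

lemma target_poly:
  "\<exists>N0. \<forall>N\<ge>N0. poly_family N (target_poly r L) \<and> vec N (target_poly r L) 0 = target r L"
proof (induction r L rule: target.induct)
  case (1 r)
  then show ?case by (auto simp: poly_family_zero vec_def)
next
  case (2 r c j a L)
  then obtain N0 where N0: "\<And>N. N0 \<le> N \<Longrightarrow> poly_family N (target_poly r L) \<and> vec N (target_poly r L) 0 = target r L"
    by blast
  let ?F = "\<lambda>c' t. if c' = c then r a * (of_int t gchoose j) else (0 :: 'k)"
  have F: "?F c' = (if c' = c then (\<lambda>t. r a * (of_int t gchoose j)) else (\<lambda>_. 0))" for c' by auto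
  have fam: "poly_family N ?F" if "c < N" "j < N" for N
    unfolding poly_family_def F using that
    by (auto simp: poly_fun_def fwd_diff_pow_cmult fwd_diff_pow_gbinomial)
  have v: "vec N ?F 0 = dscl (r a) (H c j)" if "c < N" "j < N" for N
  proof -
    have "(fwd_diff ^^ i) (?F c') 0 = (if c' = c \<and> i = j then r a else 0)" for c' i
      unfolding F by (auto simp: fwd_diff_pow_cmult fwd_diff_pow_gbinomial gbinomial_0_left)
    then have "vec N ?F 0 = (\<Sum>c'<N. \<Sum>i<N. if c' = c \<and> i = j then dscl (r a) (H c j) else 0)"
      unfolding vec_def by (intro sum.cong refl) auto
    also have "\<dots> = (\<Sum>c'<N. if c' = c then (\<Sum>i<N. if i = j then dscl (r a) (H c j) else 0) else 0)"
      by (intro sum.cong refl) auto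
    finally show ?thesis using that by simp
  qed
  have "poly_family N (target_poly r ((c, j, a) # L)) \<and> vec N (target_poly r ((c, j, a) # L)) 0 = target r ((c, j, a) # L)"
    if N: "max N0 (Suc (max c j)) \<le> N" for N
  proof -
    have N': "N0 \<le> N" "c < N" "j < N" using N by auto
    have "poly_family N (\<lambda>c' t. ?F c' t + target_poly r L c' t)"
      using fam[OF N'(2,3)] N0[OF N'(1)] unfolding poly_family_def by (simp add: poly_fun_add)
    then show ?thesis using vec_add[of N ?F "target_poly r L" 0] v[OF N'(2,3)] N0[OF N'(1)] by simp
  qed
  then show ?case by blast
qed

text \<open>For a fixed \<open>q\<close>, the set of approximable vectors is closed under sums and
  contains all multiples of the \<open>H i j\<close>. Together these yield the spans of the bases,
  by density the whole of each summand, and finitely supported vectors are finite sums of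
  such.\<close>

lemma target_dense:
  assumes r: "\<And>x e. 0 < e \<Longrightarrow> \<exists>n. norm (x - r n) < e"
    and q: "cts_seminorm dscl D q" and z: "z \<in> topspace D" and e: "0 < e"
  shows "\<exists>L. q (target r L - z) < e"
proof -
  have sn: "seminorm_on dscl (topspace D) q" using q by (simp add: cts_seminorm_def)
  define Z where "Z = {z \<in> topspace D. \<forall>e>0. \<exists>L. q (target r L - z) < e}"
  have Z0: "0 \<in> Z"
    unfolding Z_def using D.seminorm_0[OF sn] by (auto intro!: exI[of _ "[]"])
  have Zadd: "x + y \<in> Z" if "x \<in> Z" "y \<in> Z" for x y
  proof -
    have xy: "x \<in> topspace D" "y \<in> topspace D" using that by (auto simp: Z_def)
    have "\<exists>L. q (target r L - (x + y)) < e" if e: "0 < e" for e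
    proof -
      obtain L L' where L: "q (target r L - x) < e / 2" "q (target r L' - y) < e / 2"
        using \<open>x \<in> Z\<close> \<open>y \<in> Z\<close> half_gt_zero[OF e] unfolding Z_def by blast
      have "target r (L @ L') - (x + y) = (target r L - x) + (target r L' - y)"
        by (simp add: target_append)
      also have "q \<dots> \<le> q (target r L - x) + q (target r L' - y)"
        using xy by (intro D.seminorm_add[OF sn]) auto
      finally have "q (target r (L @ L') - (x + y)) \<le> q (target r L - x) + q (target r L' - y)" .
      then show ?thesis using L by (intro exI[of _ "L @ L'"]) simp
    qed
    then show ?thesis using xy by (simp add: Z_def)
  qed
  have ZH: "dscl c (H i j) \<in> Z" for c i j
  proof -
    have "\<exists>L. q (target r L - dscl c (H i j)) < e" if e: "0 < e" for e
    proof -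
      have h0: "0 \<le> q (H i j)" by (rule D.seminorm_nonneg[OF sn H_in_D])
      then have "0 < e / (q (H i j) + 1)" using e by (intro divide_pos_pos) auto
      from r[OF this] obtain n where n: "norm (c - r n) < e / (q (H i j) + 1)" by blast
      have "target r [(i, j, n)] - dscl c (H i j) = dscl (r n - c) (H i j)"
        by (simp add: D.scale_left_diff_distrib)
      then have "q (target r [(i, j, n)] - dscl c (H i j)) = norm (c - r n) * q (H i j)"
        using D.seminorm_scale[OF sn H_in_D] by (simp only: norm_minus_commute)
      also have "\<dots> \<le> norm (c - r n) * (q (H i j) + 1)" by (intro mult_left_mono) auto
      also have "\<dots> < e" using n h0 by (subst (asm) pos_less_divide_eq) auto
      finally show ?thesis by blast
    qed
    then show ?thesis by (simp add: Z_def)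
  qed
  have Zsum: "sum u A \<in> Z" if "\<And>i. i \<in> A \<Longrightarrow> u i \<in> Z" for u and A :: "nat set"
    using that by (induction A rule: infinite_finite_induct) (auto intro: Zadd Z0)
  have Zspan: "emb n u \<in> Z" if "u \<in> X.span (range (g n))" for n u
    using that
  proof (induction rule: X.span_induct_alt)
    case base
    then show ?case by (simp add: Z0)
  next
    case (step c u v)
    then obtain i where u: "u = g n i" by blast
    \<comment> \<open>Every basis vector is a place in some chain, hence a nonzero multiple of some
      \<open>H c' j\<close>.\<close>
    obtain c' j where cj: "entry n i = (c', j)" by fastforce
    then have lev: "n = lev c' j" using entry_in[of n i] by (simp add: level_set_def)
    have "index n (c', j) = i" using index_entry[of n i] cj by simp
    then have "H c' j = emb n (scl (of_real (W c' j)) u)" unfolding H_def G_def lev[symmetric] u by simp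
    then have "emb n (scl c u) = dscl (c / of_real (W c' j)) (H c' j)"
      using W_pos[of c' j] by (simp add: emb_scale[symmetric])
    then show ?case using Zadd[OF ZH[of "c / of_real (W c' j)" c' j] step(2)] by (simp add: emb_add)
  qed
  have Zemb: "emb n y \<in> Z" if y: "y \<in> topspace (X n)" for n y
  proof -
    have "\<exists>L. q (target r L - emb n y) < e" if e: "0 < e" for e
    proof -
      have "y \<in> X n closure_of X.span (range (g n))" using y dense by simp
      from X.closure_of_seminorm[OF this seminorm_emb[OF q], of "e / 2"] e
      obtain u where u: "u \<in> X.span (range (g n))" "u \<in> topspace (X n)" "q (emb n (u - y)) < e / 2" by auto
      obtain L where L: "q (target r L - emb n u) < e / 2"
        using Zspan[OF u(1)] half_gt_zero[OF e] unfolding Z_def by blast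
      have "target r L - emb n y = (target r L - emb n u) + emb n (u - y)" by (simp add: emb_diff)
      also have "q \<dots> \<le> q (target r L - emb n u) + q (emb n (u - y))"
        using u y by (intro D.seminorm_add[OF sn]) auto
      finally have "q (target r L - emb n y) \<le> q (target r L - emb n u) + q (emb n (u - y))" .
      then show ?thesis using L u by (intro exI[of _ L]) simp
    qed
    then show ?thesis using y by (simp add: Z_def)
  qed
  have "z \<in> Z" using Zsum[of "Poly_Mapping.keys z" "\<lambda>n. emb n (coord z n)"] Zemb z sum_emb[of z] by simp
  then show ?thesis using e by (simp add: Z_def)
qed

text \<open>The part of the vector at time 0 that lies in the summand 0, expressed in the basis
  \<open>g 0\<close>; the factor \<open>W c j\<close> undoes the scaling in \<open>H c j\<close>. In
  this form it is an l1 sequence, to which \<open>\<Phi> 0\<close> applies even after passing to a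
  limit.\<close>

definition level0_coeffs :: "(nat \<Rightarrow> int \<Rightarrow> 'k) \<Rightarrow> nat \<Rightarrow> 'k" where
  "level0_coeffs P i = (case entry 0 i of (c, j) \<Rightarrow> of_real (W c j) * (fwd_diff ^^ j) (P c) 0)"

lemma l1_map_finite:
  assumes "finite A" "\<And>i. i \<notin> A \<Longrightarrow> a i = 0"
  shows "\<Phi> n a = (\<Sum>i\<in>A. scl (a i) (g n i))"
  using assms
proof (induction A arbitrary: a rule: finite_induct)
  case empty
  then have "a = (\<lambda>_. 0)" by (simp add: fun_eq_iff)
  moreover have "l1 (\<lambda>_. 0 :: 'k)" by simp
  then have "\<Phi> n (\<lambda>_. 0) = 0" using X.l1_mapD(3)[OF l1_map, of "\<lambda>_. 0" n 0] by simp
  ultimately show ?case by simp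
next
  case (insert k A)
  let ?b = "\<lambda>i. if i = k then 0 else a i"
  let ?u = "\<lambda>i. if i = k then 1 else 0 :: 'k"
  have b0: "?b i = 0" if "i \<notin> A" for i using insert.prems[of i] that by auto
  have sub: "{i. ?b i \<noteq> 0} \<subseteq> A" using b0 by blast
  have b: "l1 ?b" by (rule l1_finite[OF finite_subset[OF sub insert.hyps(1)]])
  have "a = (\<lambda>i. a k * ?u i + ?b i)" by (auto simp: fun_eq_iff)
  then have "\<Phi> n a = scl (a k) (g n k) + \<Phi> n ?b"
    using X.l1_mapD(2)[OF l1_map l1_mult[OF X.l1_unit[of k]] b, of n "a k"]
      X.l1_mapD(3)[OF l1_map X.l1_unit[of k], of n "a k"] X.l1_mapD(4)[OF l1_map, of n k] by simp
  moreover have "\<Phi> n ?b = (\<Sum>i\<in>A. scl (?b i) (g n i))" using b0 by (rule insert.IH)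
  moreover have "\<dots> = (\<Sum>i\<in>A. scl (a i) (g n i))" using insert.hyps(2) by (intro sum.cong) auto
  ultimately show ?case using insert.hyps by simp
qed

text \<open>The entry (c, j) has level 0 exactly when \<open>j\<close> is at least
  \<open>chain_level c\<close>. If the differences of lower order vanish, the whole vector thus sits
  in the summand 0 and is recovered from these coefficients alone.\<close>

lemma level0_coeffs:
  assumes P: "poly_family N P"
  shows "l1 (level0_coeffs P)" and "l1_norm (level0_coeffs P) \<le> jet_norm W N P 0"
    and "(\<And>c j. j < chain_level c \<Longrightarrow> (fwd_diff ^^ j) (P c) 0 = 0) \<Longrightarrow> emb 0 (\<Phi> 0 (level0_coeffs P)) = vec N P 0"
proof -
  define A where "A = ({..<N} \<times> {..<N}) \<inter> level_set 0"
  define I where "I = index 0 ` A"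
  have fin: "finite I" "finite A" by (auto simp: I_def A_def)
  have inj: "inj_on (index 0) A" by (rule inj_onI) (simp add: A_def index_eq_iff)
  have at: "level0_coeffs P (index 0 (c, j)) = of_real (W c j) * (fwd_diff ^^ j) (P c) 0" if "(c, j) \<in> A" for c j
    using that entry_index[of "(c, j)" 0] by (simp add: level0_coeffs_def A_def)
  have zero: "level0_coeffs P i = 0" if "i \<notin> I" for i
  proof -
    obtain c j where e: "entry 0 i = (c, j)" by fastforce
    have "(c, j) \<notin> A"
    proof
      assume "(c, j) \<in> A"
      then have "index 0 (entry 0 i) \<in> I" unfolding e I_def by (rule imageI)
      then show False using that by simp
    qed
    then have "N \<le> c \<or> N \<le> j" using entry_in[of 0 i] e by (auto simp: A_def)
    then show ?thesis using poly_family_fwd_diff_eq_0[OF P] e by (simp add: level0_coeffs_def)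
  qed
  show "l1 (level0_coeffs P)" using zero by (intro l1_finite finite_subset[OF _ fin(1)] subsetI) blast
  have "l1_norm (level0_coeffs P) = (\<Sum>i\<in>I. norm (level0_coeffs P i))"
    unfolding l1_norm_def using zero fin by (intro suminf_finite) auto
  also have "\<dots> = (\<Sum>(c, j)\<in>A. W c j * norm ((fwd_diff ^^ j) (P c) 0))"
    unfolding I_def sum.reindex[OF inj] comp_def using at W_pos
    by (intro sum.cong) (auto simp: norm_mult abs_of_pos)
  also have "\<dots> \<le> (\<Sum>(c, j)\<in>{..<N} \<times> {..<N}. W c j * norm ((fwd_diff ^^ j) (P c) 0))"
    using W_pos by (intro sum_mono2) (auto simp: A_def less_imp_le)
  finally show "l1_norm (level0_coeffs P) \<le> jet_norm W N P 0"
    by (simp add: jet_norm_def sum.cartesian_product)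
  assume low: "\<And>c j. j < chain_level c \<Longrightarrow> (fwd_diff ^^ j) (P c) 0 = 0"
  have low': "chain_level c \<le> j" if "(fwd_diff ^^ j) (P c) 0 \<noteq> 0" for c j
    using low[of j c] that by (meson not_le)
  have "emb 0 (\<Phi> 0 (level0_coeffs P)) = (\<Sum>i\<in>I. emb 0 (scl (level0_coeffs P i) (g 0 i)))"
    using l1_map_finite[OF fin(1) zero, where n = 0] by (simp add: emb_sum)
  also have "\<dots> = (\<Sum>(c, j)\<in>A. dscl ((fwd_diff ^^ j) (P c) 0) (H c j))"
    unfolding I_def sum.reindex[OF inj] comp_def
  proof (intro sum.cong refl, clarify)
    fix c j assume cj: "(c, j) \<in> A"
    then have "lev c j = 0" by (simp add: A_def level_set_def)
    then show "emb 0 (scl (level0_coeffs P (index 0 (c, j))) (g 0 (index 0 (c, j)))) = dscl ((fwd_diff ^^ j) (P c) 0) (H c j)"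
      unfolding H_def G_def by (simp add: at[OF cj] emb_scale[symmetric] mult.commute)
  qed
  also have "\<dots> = (\<Sum>(c, j)\<in>{..<N} \<times> {..<N}. dscl ((fwd_diff ^^ j) (P c) 0) (H c j))"
    using low' by (intro sum.mono_neutral_left) (auto simp: A_def level_set_def)
  finally show "emb 0 (\<Phi> 0 (level0_coeffs P)) = vec N P 0"
    by (simp add: vec_def sum.cartesian_product)
qed

lemma level0_coeffs_diff:
  "level0_coeffs (\<lambda>c t. P c t - Q c t) = (\<lambda>i. level0_coeffs P i - level0_coeffs Q i)"
  by (simp add: level0_coeffs_def fwd_diff_pow_diff fun_eq_iff right_diff_distrib split: prod.split)

theorem hypercyclic_oper: "hypercyclic_operator dscl D oper"
proof -
  obtain r :: "nat \<Rightarrow> 'k" where r: "\<And>x e. 0 < e \<Longrightarrow> \<exists>n. norm (x - r n) < e"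
    using real_or_complex_dense_sequence by blast
  \<comment> \<open>Every list occurs at infinitely many stages: the error at stage n is of order
    \<open>(1/2) ^ n\<close>, and it must beat a constant that depends on the list and on the
    seminorm.\<close>
  define L :: "nat \<Rightarrow> (nat \<times> nat \<times> nat) list" where "L s = from_nat (fst (prod_decode s))" for s
  have "\<forall>l. \<exists>N0. \<forall>N\<ge>N0. poly_family N (target_poly r l) \<and> vec N (target_poly r l) 0 = target r l"
    using target_poly by blast
  from choice[OF this] obtain bd where
    bd: "\<And>l N. bd l \<le> N \<Longrightarrow> poly_family N (target_poly r l) \<and> vec N (target_poly r l) 0 = target r l" by blast
  define e where "e s = target_poly r (L s)" for s
  define M where "M s = bd (L s)" for s
  have e: "poly_family (M s) (e s)" for s using bd[of "L s" "M s"] by (simp add: e_def M_def)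
  from poly_family_sequence[of W M e chain_level, OF less_imp_le[OF W_pos] e]
  obtain P N k where seq: "incseq N" "\<forall>s. M s \<le> N (Suc s) \<and> poly_family (N s) (P s)"
    "\<forall>s c. \<forall>i<chain_level c. P s c (int i) = 0"
    "\<forall>s. jet_norm W (N (Suc s)) (\<lambda>c t. P (Suc s) c t - P s c t) 0 \<le> (1/2) ^ s"
    "\<forall>n. \<forall>s>n. jet_norm W (N s) (\<lambda>c t. P s c (t + int (k n)) - e n c t) 0 \<le> 2 * (1/2) ^ n"
    "\<forall>n. \<forall>s>n. \<forall>c. e n c = (\<lambda>_. 0) \<longrightarrow> (\<forall>i<chain_level c. P s c (int (k n) + int i) = 0)"
    by (elim exE conjE)
  note incN = seq(1)
  have MN: "M s \<le> N (Suc s)" and fam: "poly_family (N s) (P s)" for s using seq(2) by simp_all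
  have low: "P s c (int i) = 0" if "i < chain_level c" for s c i using seq(3) that by simp
  have step: "jet_norm W (N (Suc s)) (\<lambda>c t. P (Suc s) c t - P s c t) 0 \<le> (1/2) ^ s" for s
    using seq(4) by simp
  have near: "jet_norm W (N s) (\<lambda>c t. P s c (t + int (k n)) - e n c t) 0 \<le> 2 * (1/2) ^ n" if "n < s" for n s
    using seq(5) that by simp
  have zero: "P s c (int (k n) + int i) = 0" if "n < s" "e n c = (\<lambda>_. 0)" "i < chain_level c" for n s c i
    using seq(6) that by simp
  define b where "b s = level0_coeffs (P s)" for s
  define v where "v s = (\<lambda>i. b (Suc s) i - b s i)" for s
  have v: "l1 (v s)" "l1_norm (v s) \<le> (1/2) ^ s" for s
  proof -
    have fd: "poly_family (N (Suc s)) (\<lambda>c t. P (Suc s) c t - P s c t)"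
      using fam poly_family_mono[OF incseqD[OF incN, of s "Suc s"] fam] by (intro poly_family_diff) auto
    have eq: "v s = level0_coeffs (\<lambda>c t. P (Suc s) c t - P s c t)"
      by (simp add: v_def b_def level0_coeffs_diff)
    show "l1 (v s)" unfolding eq by (rule level0_coeffs(1)[OF fd])
    show "l1_norm (v s) \<le> (1/2) ^ s"
      unfolding eq using level0_coeffs(2)[OF fd] step[of s] by (rule order_trans)
  qed
  \<comment> \<open>The sum of all corrections from stage \<open>s\<close> on. Writing the limit
    sequence as \<open>b s\<close> plus this tail, for every \<open>s\<close>, turns the l1 estimate
    into the distance of the approximants from \<open>x\<close> in any continuous seminorm.\<close>
  define \<rho> where "\<rho> s = (\<lambda>i. suminf (\<lambda>n. v (n + s) i))" for s
  have gs: "(\<lambda>n. (1/2 :: real) ^ (n + s)) sums (2 * (1/2) ^ s)" for s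
    using sums_mult2[OF geometric_sums[of "1/2 :: real"], of "(1/2) ^ s"] by (simp add: power_add)
  have \<rho>: "summable (\<lambda>n. v (n + s) i)" "l1 (\<rho> s)" "l1_norm (\<rho> s) \<le> 2 * (1/2) ^ s" for s i
    using l1_series[of "\<lambda>n. v (n + s)" "\<lambda>n. (1/2) ^ (n + s)", OF v sums_summable[OF gs]] sums_unique[OF gs[of s]]
    by (auto simp: \<rho>_def)
  define \<beta> where "\<beta> = (\<lambda>i. b 0 i + \<rho> 0 i)"
  have \<beta>: "\<beta> = (\<lambda>i. b s i + \<rho> s i)" for s
  proof (induction s)
    case (Suc s)
    have "\<rho> (Suc s) i = \<rho> s i - v s i" for i
      using suminf_split_head[OF \<rho>(1)[of s i]] by (simp add: \<rho>_def)
    then show ?case using Suc by (simp add: v_def add.commute)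
  qed (simp add: \<beta>_def)
  have bl: "l1 (b s)" for s unfolding b_def by (rule level0_coeffs(1)[OF fam])
  define x where "x = emb 0 (\<Phi> 0 \<beta>)"
  have xD: "x \<in> topspace D"
    unfolding x_def \<beta>_def by (intro emb_in_D X.l1_mapD(1)[OF l1_map] l1_add bl \<rho>)
  have x: "x = vec (N s) (P s) 0 + emb 0 (\<Phi> 0 (\<rho> s))" for s
  proof -
    have "emb 0 (\<Phi> 0 (b s)) = vec (N s) (P s) 0"
      unfolding b_def using low by (intro level0_coeffs(3)[OF fam] fwd_diff_pow_eq_0) simp
    then show ?thesis
      unfolding x_def \<beta>[of s] using X.l1_mapD(2)[OF l1_map bl \<rho>(2), of 0 s s] by (simp add: emb_add)
  qed
  have lim: "limitin D (\<lambda>s. vec (N s) (P s) 0) x sequentially"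
  proof (rule D.limitinI_seminorm[OF xD vec_in_D])
    fix q assume q: "cts_seminorm dscl D q"
    then have sn: "seminorm_on dscl (topspace D) q" by (simp add: cts_seminorm_def)
    obtain K where K: "0 \<le> K" "\<And>a. l1 a \<Longrightarrow> q (emb 0 (\<Phi> 0 a)) \<le> K * l1_norm a"
      using X.l1_mapD(5)[OF l1_map seminorm_emb[OF q]] by blast
    have le: "q (vec (N s) (P s) 0 - x) \<le> K * (2 * (1/2) ^ s)" for s
    proof -
      have "q (vec (N s) (P s) 0 - x) = q (x - vec (N s) (P s) 0)"
        by (rule D.seminorm_minus_commute[OF sn vec_in_D xD])
      also have "x - vec (N s) (P s) 0 = emb 0 (\<Phi> 0 (\<rho> s))" using x[of s] by simp
      also have "q \<dots> \<le> K * l1_norm (\<rho> s)" by (rule K(2)[OF \<rho>(2)])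
      also have "\<dots> \<le> K * (2 * (1/2) ^ s)" by (intro mult_left_mono \<rho>(3) K(1))
      finally show ?thesis .
    qed
    have "(\<lambda>s. K * (2 * (1/2 :: real) ^ s)) \<longlonglongrightarrow> 0"
      by (intro tendsto_mult_right_zero LIMSEQ_power_zero) simp
    moreover have "norm (q (vec (N s) (P s) 0 - x)) \<le> K * (2 * (1/2) ^ s)" for s
      using le[of s] D.seminorm_nonneg[OF sn D.diff_V[OF vec_in_D xD]] by simp
    ultimately show "(\<lambda>s. q (vec (N s) (P s) 0 - x)) \<longlonglongrightarrow> 0"
      by (rule Lim_null_comparison[OF always_eventually[OF allI], rotated])
  qed
  have orbit: "\<exists>n. q ((oper ^^ n) x - target r l) < \<epsilon>" if q: "cts_seminorm dscl D q" and \<epsilon>: "0 < \<epsilon>" for q l \<epsilon>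
  proof -
    have sn: "seminorm_on dscl (topspace D) q" using q by (simp add: cts_seminorm_def)
    \<comment> \<open>No chain that the target may use starts above this level. All other chains
      have target 0 and hence exact zeros at the return time, so only levels up to \<open>m\<close>
      contribute. Thus \<open>B\<close> is fixed by \<open>l\<close> and \<open>q\<close> before the
      occurrence \<open>n\<close> of \<open>l\<close> is chosen.\<close>
    define m where "m = (\<Sum>c<bd l. chain_level c)"
    have m: "chain_level c \<le> m" if "c < bd l" for c
      unfolding m_def using that by (intro member_le_sum) auto
    obtain B where B: "0 \<le> B" "\<And>c j. lev c j \<le> m \<Longrightarrow> q (H c j) \<le> B * W c j" using H_bound[OF q, of m] by blast
    have "(\<lambda>i. B * (2 * (1/2 :: real) ^ i)) \<longlonglongrightarrow> 0"
      by (intro tendsto_mult_right_zero LIMSEQ_power_zero) simp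
    from order_tendstoD(2)[OF this, of "\<epsilon> / 2"] \<epsilon> obtain i where i: "B * (2 * (1/2) ^ i) < \<epsilon> / 2"
      using eventually_happens'[OF sequentially_bot] by fastforce
    define n where "n = prod_encode (to_nat l, i)"
    have Ln: "L n = l" by (simp add: L_def n_def)
    have "B * (2 * (1/2) ^ n) \<le> B * (2 * (1/2) ^ i)"
      using B(1) le_prod_encode_2[of i "to_nat l"] by (intro mult_left_mono power_decreasing) (auto simp: n_def)
    then have small: "B * (2 * (1/2) ^ n) < \<epsilon> / 2" using i by simp
    \<comment> \<open>For the fixed exponent \<open>k n\<close> the power is continuous, so the
      orbit point is the limit of the polynomial vectors at time \<open>k n\<close>, and one
      sufficiently late \<open>s\<close> settles the estimate.\<close>
    have "limitin D ((oper ^^ k n) \<circ> (\<lambda>s. vec (N s) (P s) 0)) ((oper ^^ k n) x) sequentially"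
      by (rule continuous_map_limit[OF continuous_oper_pow lim])
    then have "limitin D (\<lambda>s. vec (N s) (P s) (int (k n))) ((oper ^^ k n) x) sequentially"
      using oper_pow_vec[OF fam] by (simp add: comp_def)
    from order_tendstoD(2)[OF D.limitin_seminorm[OF this q vec_in_D], of "\<epsilon> / 2"] \<epsilon>
    have "\<forall>\<^sub>F s in sequentially. q (vec (N s) (P s) (int (k n)) - (oper ^^ k n) x) < \<epsilon> / 2" by simp
    then obtain s where s: "n < s" "q (vec (N s) (P s) (int (k n)) - (oper ^^ k n) x) < \<epsilon> / 2"
      using eventually_happens'[OF sequentially_bot eventually_conj[OF eventually_gt_at_top[of n]]] by blast
    have "M n \<le> N s" using MN[of n] incseqD[OF incN, of "Suc n" s] s(1) by simp
    then have "vec (N s) (e n) 0 = target r l" using bd[of l "N s"] Ln by (simp add: e_def M_def)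
    then have eq: "vec (N s) (\<lambda>c t. P s c (t + int (k n)) - e n c t) 0 = vec (N s) (P s) (int (k n)) - target r l"
      using vec_diff[of "N s" "\<lambda>c t. P s c (t + int (k n))" "e n" 0] vec_shift[of "N s" "P s" "int (k n)" 0] by simp
    have "q (vec (N s) (\<lambda>c t. P s c (t + int (k n)) - e n c t) 0)
        \<le> B * jet_norm W (N s) (\<lambda>c t. P s c (t + int (k n)) - e n c t) 0"
    proof (rule vec_bound[OF q B(2)])
      fix c j assume cj: "m < lev c j"
      then have "\<not> c < bd l" using m[of c] by auto
      then have ec: "e n c = (\<lambda>_. 0)" using e[of n] by (simp add: poly_family_def M_def Ln)
      show "(fwd_diff ^^ j) (\<lambda>t. P s c (t + int (k n)) - e n c t) 0 = 0"
      proof (rule fwd_diff_pow_eq_0)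
        \<comment> \<open>\<open>lev c j\<close> is positive, so \<open>j\<close>, and with it
          \<open>i\<close>, is below \<open>chain_level c\<close>, inside the range of the exact
          zeros.\<close>
        fix i assume "i \<le> j"
        then have "P s c (int (k n) + int i) = 0" using cj by (intro zero[OF s(1) ec]) simp
        then show "P s c (0 + int i + int (k n)) - e n c (0 + int i) = 0" by (simp add: ec add.commute)
      qed
    qed
    also have "\<dots> \<le> B * (2 * (1/2) ^ n)" by (intro mult_left_mono near[OF s(1)] B(1))
    finally have "q (vec (N s) (P s) (int (k n)) - target r l) < \<epsilon> / 2" unfolding eq using small by simp
    moreover have "q ((oper ^^ k n) x - vec (N s) (P s) (int (k n))) < \<epsilon> / 2"
      using s(2) D.seminorm_minus_commute[OF sn oper_pow_in_D[OF xD] vec_in_D] by simp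
    moreover have "q ((oper ^^ k n) x - target r l) \<le>
        q ((oper ^^ k n) x - vec (N s) (P s) (int (k n))) + q (vec (N s) (P s) (int (k n)) - target r l)"
      using D.seminorm_add[OF sn, of "(oper ^^ k n) x - vec (N s) (P s) (int (k n))" "vec (N s) (P s) (int (k n)) - target r l"]
        oper_pow_in_D[OF xD, of "k n"] by simp
    ultimately have "q ((oper ^^ k n) x - target r l) < \<epsilon>" by linarith
    then show ?thesis by blast
  qed
  have "z \<in> D closure_of {(oper ^^ n) x |n. True}" if z: "z \<in> topspace D" for z
  proof (rule D.closure_ofI_seminorm[OF z])
    show "{(oper ^^ n) x |n. True} \<subseteq> topspace D" using oper_pow_in_D[OF xD] by blast
    fix q assume q: "cts_seminorm dscl D q"
    then have sn: "seminorm_on dscl (topspace D) q" by (simp add: cts_seminorm_def)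
    obtain l where l: "q (target r l - z) < 1/2" using target_dense[OF r q z, of "1/2"] by auto
    obtain n where n: "q ((oper ^^ n) x - target r l) < 1/2" using orbit[OF q, of "1/2" l] by auto
    have "q ((oper ^^ n) x - z) \<le> q ((oper ^^ n) x - target r l) + q (target r l - z)"
      using D.seminorm_add[OF sn, of "(oper ^^ n) x - target r l" "target r l - z"]
        oper_pow_in_D[OF xD, of n] z by simp
    then have "q ((oper ^^ n) x - z) < 1" using l n by linarith
    then show "\<exists>s\<in>{(oper ^^ n) x |n. True}. q (s - z) < 1" by blast
  qed
  then have "D closure_of {(oper ^^ n) x |n. True} = topspace D"
    using closure_of_subset_topspace[of D] by blast
  then show ?thesis
    unfolding hypercyclic_operator_def using continuous_oper linear_oper xD by blast
qed

end

theorem theorem1p10: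
  fixes scl :: "'k::real_or_complex \<Rightarrow> 'a::ab_group_add \<Rightarrow> 'a"
    and X :: "nat \<Rightarrow> 'a topology"
    and D :: "(nat \<Rightarrow>\<^sub>0 'a) topology"
  assumes "\<And>n. locally_convex_space scl (X n)"
    and "\<And>n. \<not> has_weak_topology scl (X n)"
    and "\<And>n. \<exists>x. l1_sequence scl (X n) x \<and>
               X n closure_of module.span scl (range x) = topspace (X n)"
    and "locally_convex_direct_sum scl X D"
  shows "\<exists>S. hypercyclic_operator (direct_sum_scale scl) D S"
proof -
  interpret lc_direct_sum scl X D by unfold_locales (rule assms(1), rule assms(4))
  have "\<forall>n. \<exists>F. case F of (p, g, f, C, \<Phi>) \<Rightarrow> X.biorthogonal n p g f C \<Phi>"
  proof
    fix n
    obtain x where "l1_sequence scl (X n) x" "X n closure_of X.span (range x) = topspace (X n)"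
      using assms(3) by blast
    then obtain p g f C \<Phi> where "X.biorthogonal n p g f C \<Phi>"
      using X.biorthogonal_exists[OF assms(2)] by blast
    then show "\<exists>F. case F of (p, g, f, C, \<Phi>) \<Rightarrow> X.biorthogonal n p g f C \<Phi>"
      by (intro exI[of _ "(p, g, f, C, \<Phi>)"]) simp
  qed
  from choice[OF this] obtain F where F: "\<And>n. case F n of (p, g, f, C, \<Phi>) \<Rightarrow> X.biorthogonal n p g f C \<Phi>"
    by blast
  interpret framed_sum scl X D "\<lambda>n. fst (F n)" "\<lambda>n. fst (snd (F n))" "\<lambda>n. fst (snd (snd (F n)))"
    "\<lambda>n. fst (snd (snd (snd (F n))))" "\<lambda>n. snd (snd (snd (snd (F n))))"
    by unfold_locales (use F in \<open>simp add: case_prod_unfold\<close>)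
  show ?thesis using hypercyclic_oper by blast
qed

end
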